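(* Let $\{X_n;n\ge 1\}$ be a sequence of independent random variables in a sub-linear expectation space $(\Omega,\mathscr H,\widehat{\mathbb E})$ with $\widehat{\mathbb E}[X_n^2]<\infty$ for all $n$, and let $\mathbb V$ be a sub-additive capacity on $\mathcal F$ satisfying the compatibility property (C). Put $S_n=\sum_{i=1}^nX_i$, $s_n^2=\sum_{k=1}^n\widehat{\mathbb E}[X_k^2]$, $t_n=\sqrt{2\log\log s_n^2}$, $a_n=s_nt_n$, and $$\overline\Gamma_n(p,\alpha)=\widehat{\mathbb E}\Big[\big((|X_n|\wedge a_n-\alpha s_n/t_n)^+\big)^p\Big],\qquad \overline\Lambda_n(p,\alpha)=\sum_{j=1}^n\widehat{\mathbb E}\Big[\big((|X_j|\wedge a_n-\alpha s_n/t_n)^+\big)^p\Big].$$ Suppose that $s_n^2\to\infty$, that $$\sum_{n=1}^\infty\mathbb V(|X_n|\ge\epsilon a_n)<\infty\quad\text{for all }\epsilon>0,$$ and that for every $\alpha>0$ there exist some $p\ge2$ and $d\ge0$ such that $$\sum_{n=1}^\infty\frac{\overline\Gamma_n(p,\alpha)}{a_n^p}\left(\frac{\overline\Lambda_n(p,\alpha)}{a_n^p}\right)^d<\infty .$$ Then for every $\epsilon>0$, $$\lim_{n\to\infty}\max_N\mathbb V\Big(\inf_{n\le m\le N}\frac{S_m-\widehat{\mathcal E}[S_m]}{a_m}<-1-\epsilon\ \text{ or }\ \sup_{n\le m\le N}\frac{S_m-\widehat{\mathbb E}[S_m]}{a_m}>1+\epsilon\Big)=0.$$ If $\mathbb V$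 is countably sub-additive, then for every $\epsilon>0$, $$\lim_{n\to\infty}\mathbb V\Big(\inf_{m\ge n}\frac{S_m-\widehat{\mathcal E}[S_m]}{a_m}<-1-\epsilon\ \text{ or }\ \sup_{m\ge n}\frac{S_m-\widehat{\mathbb E}[S_m]}{a_m}>1+\epsilon\Big)=0.$$ Moreover, with $\widehat{\mathbb V}^*$ the countably sub-additive extension of $\widehat{\mathbb V}$, $$\widehat{\mathbb V}^*\Big(\liminf_{n\to\infty}\frac{S_n-\widehat{\mathcal E}[S_n]}{a_n}<-1\ \text{ or }\ \limsup_{n\to\infty}\frac{S_n-\widehat{\mathbb E}[S_n]}{a_n}>1\Big)=0.$$
   Context: Sub-linear expectation space: $(\Omega,\mathcal F)$ is a measurable space and $\mathscr H$ is a linear space of real measurable functions on it such that $\varphi(X_1,\dots,X_n)\in\mathscr H$ whenever $X_1,\dots,X_n\in\mathscr H$ and $\varphi\in C_{l,Lip}(\mathbb R^n)$, where $C_{l,Lip}(\mathbb R^n)$ is the set of $\varphi$ with $|\varphi(x)-\varphi(y)|\le C(1+|x|^m+|y|^m)|x-y|$ for some $C>0$, $m\in\mathbb N$ depending on $\varphi$. A sub-linear expectation is a map $\widehat{\mathbb E}:\mathscr H\to[-\infty,\infty]$ such that: $X\ge Y$ implies $\widehat{\mathbb E}[X]\ge\widehat{\mathbb E}[Y]$; $\widehat{\mathbb E}[c]=c$ for constants $c$; $\widehat{\mathbb E}[X+Y]\le\widehat{\mathbb E}[X]+\widehat{\mathbb E}[Y]$ whenever the right side is not of the form $\infty-\infty$;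 $\widehat{\mathbb E}[\lambda X]=\lambda\widehat{\mathbb E}[X]$ for $\lambda\ge0$ (with $0\cdot\infty=0$). The conjugate expectation is $\widehat{\mathcal E}[X]=-\widehat{\mathbb E}[-X]$. Elements of $\mathscr H$ are called random variables. Independence: a random vector $\bm Y\in\mathscr H^n$ is independent to $\bm X\in\mathscr H^m$ if $\widehat{\mathbb E}[\varphi(\bm X,\bm Y)]=\widehat{\mathbb E}\big[\widehat{\mathbb E}[\varphi(\bm x,\bm Y)]|_{\bm x=\bm X}\big]$ for each $\varphi\in C_{l,Lip}(\mathbb R^m\times\mathbb R^n)$ with $\overline\varphi(\bm x):=\widehat{\mathbb E}[|\varphi(\bm x,\bm Y)|]<\infty$ for all $\bm x$ and $\widehat{\mathbb E}[|\overline\varphi(\bm X)|]<\infty$. A sequence $\{X_n\}$ is independent if $X_{i+1}$ is independent to $(X_1,\dots,X_i)$ for each $i\ge1$. Capacities: a capacity is a monotone set function $V:\mathcal F\to[0,1]$ with $V(\emptyset)=0$, $V(\Omega)=1$; it is sub-additive if $V(A\cup B)\le V(A)+V(B)$, and countably sub-additive if $V(\bigcup_nA_n)\le\sum_nV(A_n)$. Property (C) for $\mathbb V$: $\widehat{\mathbb E}[f]\le\mathbb V(A)\le\widehat{\mathbb E}[g]$ whenever $f\le I_A\le g$, $f,g\in\mathscr H$, $A\in\mathcal F$. Define $\widehat{\mathbb V}(A)=\inf\{\widehat{\mathbb E}[\xi]:I_A\le\xi,\ \xi\in\mathscr H\}$ and $\widehat{\mathbb V}^*(A)=\inf\{\sum_{n=1}^\infty\widehat{\mathbb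 V}(A_n):A\subset\bigcup_{n=1}^\infty A_n\}$, $A,A_n\in\mathcal F$. Conventions: $\log x=\ln\max(e,x)$; $x\wedge y=\min(x,y)$; $x^+=\max(x,0)$; $\max_N$ denotes the supremum over integers $N\ge n$. *)

theory Defs
  imports "HOL-Analysis.Analysis"
begin

text \<open>
  A vector of dimension \<open>n\<close> is given by the first \<open>n\<close> coordinates of a function
  \<open>nat \<Rightarrow> real\<close>, and \<open>L2_set x {..<n}\<close> is its Euclidean norm.  The Lipschitz condition
  below is required for all \<open>x\<close> and \<open>y\<close>, so it also makes \<open>\<phi>\<close> independent of
  the coordinates from \<open>n\<close> on: functions in \<open>C_lLip n\<close> are functions of \<open>n\<close> variables.
\<close>

definition C_lLip :: "nat \<Rightarrow> ((nat \<Rightarrow> real) \<Rightarrow> real) set" where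
  "C_lLip n = {\<phi>. \<exists>C>0. \<exists>m::nat. \<forall>x y.
     \<bar>\<phi> x - \<phi> y\<bar> \<le> C * (1 + L2_set x {..<n} ^ m + L2_set y {..<n} ^ m)
                      * L2_set (\<lambda>i. x i - y i) {..<n}}"

lemma C_lLip_cong:
  assumes "\<phi> \<in> C_lLip n" and "\<And>i. i < n \<Longrightarrow> x i = y i"
  shows "\<phi> x = \<phi> y"
proof -
  have "L2_set (\<lambda>i. x i - y i) {..<n} = 0"
    using assms(2) by (simp add: L2_set_eq_0_iff)
  moreover obtain C and m :: nat where
    "\<bar>\<phi> x - \<phi> y\<bar> \<le> C * (1 + L2_set x {..<n} ^ m + L2_set y {..<n} ^ m)
                      * L2_set (\<lambda>i. x i - y i) {..<n}"
    using assms(1) unfolding C_lLip_def by blast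
  ultimately show ?thesis by simp
qed

text \<open>
  Only the measurable space \<open>(space M, sets M)\<close> of \<open>M\<close> is used.  The expectation \<open>E\<close>
  is a total function, but it is constrained (and meaningful) on \<open>H\<close> only; by monotonicity,
  \<open>E X\<close> depends only on the values of \<open>X\<close> on \<open>space M\<close>.
\<close>

locale sublinear_expectation_space =
  fixes M :: "'a measure" and H :: "('a \<Rightarrow> real) set" and E :: "('a \<Rightarrow> real) \<Rightarrow> ereal"
  assumes H_measurable: "X \<in> H \<Longrightarrow> X \<in> borel_measurable M"
    and H_zero: "(\<lambda>\<omega>. 0) \<in> H"
    and H_add: "X \<in> H \<Longrightarrow> Y \<in> H \<Longrightarrow> (\<lambda>\<omega>. X \<omega> + Y \<omega>) \<in> H"
    and H_scale: "X \<in> H \<Longrightarrow> (\<lambda>\<omega>. c * X \<omega>) \<in> H"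
    and H_comp: "\<phi> \<in> C_lLip n \<Longrightarrow> (\<And>i. i < n \<Longrightarrow> Z i \<in> H) \<Longrightarrow> (\<lambda>\<omega>. \<phi> (\<lambda>i. Z i \<omega>)) \<in> H"
    and E_mono: "X \<in> H \<Longrightarrow> Y \<in> H \<Longrightarrow> (\<And>\<omega>. \<omega> \<in> space M \<Longrightarrow> Y \<omega> \<le> X \<omega>) \<Longrightarrow> E Y \<le> E X"
    and E_const: "E (\<lambda>\<omega>. c) = ereal c"
    and E_subadd: "X \<in> H \<Longrightarrow> Y \<in> H
      \<Longrightarrow> \<not> (E X = \<infinity> \<and> E Y = -\<infinity>) \<Longrightarrow> \<not> (E X = -\<infinity> \<and> E Y = \<infinity>)
      \<Longrightarrow> E (\<lambda>\<omega>. X \<omega> + Y \<omega>) \<le> E X + E Y"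
    and E_pos_homogeneous: "X \<in> H \<Longrightarrow> 0 \<le> r \<Longrightarrow> E (\<lambda>\<omega>. r * X \<omega>) = ereal r * E X"

definition conj_expectation :: "(('a \<Rightarrow> real) \<Rightarrow> ereal) \<Rightarrow> ('a \<Rightarrow> real) \<Rightarrow> ereal" where
  "conj_expectation E X = - E (\<lambda>\<omega>. - X \<omega>)"

definition vec_append :: "nat \<Rightarrow> (nat \<Rightarrow> real) \<Rightarrow> (nat \<Rightarrow> real) \<Rightarrow> (nat \<Rightarrow> real)" where
  "vec_append m x y = (\<lambda>i. if i < m then x i else y (i - m))"

text \<open>
  \<open>independent_to H E n Y m X\<close>: the \<open>n\<close>-dimensional \<open>Y\<close> is independent to the
  \<open>m\<close>-dimensional \<open>X\<close>.  The test functions are those for which the two outer expectations are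
  defined, i.e. \<open>\<phi>bar(X)\<close> and \<open>E[\<phi>(x,Y)]|x=X\<close> belong to \<open>H\<close>.  Both \<open>E[|\<phi>(x,Y)|]\<close> and
  \<open>E[\<phi>(x,Y)]\<close> are finite for such \<open>\<phi>\<close>, so \<open>real_of_ereal\<close> loses nothing.
\<close>

definition independent_to ::
  "('a \<Rightarrow> real) set \<Rightarrow> (('a \<Rightarrow> real) \<Rightarrow> ereal) \<Rightarrow> nat \<Rightarrow> (nat \<Rightarrow> 'a \<Rightarrow> real)
    \<Rightarrow> nat \<Rightarrow> (nat \<Rightarrow> 'a \<Rightarrow> real) \<Rightarrow> bool" where
  "independent_to H E n Y m X \<longleftrightarrow>
     (\<forall>i<n. Y i \<in> H) \<and> (\<forall>i<m. X i \<in> H) \<and>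
     (\<forall>\<phi> \<in> C_lLip (m + n).
        let \<phi>bar = (\<lambda>x. E (\<lambda>\<omega>. \<bar>\<phi> (vec_append m x (\<lambda>i. Y i \<omega>))\<bar>));
            \<psi> = (\<lambda>x. E (\<lambda>\<omega>. \<phi> (vec_append m x (\<lambda>i. Y i \<omega>))));
            \<phi>barX = (\<lambda>\<omega>. real_of_ereal (\<phi>bar (\<lambda>i. X i \<omega>)));
            \<psi>X = (\<lambda>\<omega>. real_of_ereal (\<psi> (\<lambda>i. X i \<omega>)))
        in (\<forall>x. \<phi>bar x < \<infinity>) \<longrightarrow> \<phi>barX \<in> H \<longrightarrow> \<psi>X \<in> H \<longrightarrow> E (\<lambda>\<omega>. \<bar>\<phi>barX \<omega>\<bar>) < \<infinity> \<longrightarrow>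
           E (\<lambda>\<omega>. \<phi> (vec_append m (\<lambda>i. X i \<omega>) (\<lambda>i. Y i \<omega>))) = E \<psi>X)"

text \<open>Sequences \<open>X 1, X 2, \<dots>\<close> are indexed from 1; \<open>X 0\<close> is never used.\<close>

definition independent_seq ::
  "('a \<Rightarrow> real) set \<Rightarrow> (('a \<Rightarrow> real) \<Rightarrow> ereal) \<Rightarrow> (nat \<Rightarrow> 'a \<Rightarrow> real) \<Rightarrow> bool" where
  "independent_seq H E X \<longleftrightarrow>
     (\<forall>i\<ge>1. independent_to H E 1 (\<lambda>j. X (i + 1)) i (\<lambda>j. X (j + 1)))"

definition capacity :: "'a measure \<Rightarrow> ('a set \<Rightarrow> real) \<Rightarrow> bool" where
  "capacity M V \<longleftrightarrow>
     (\<forall>A\<in>sets M. 0 \<le> V A \<and> V A \<le> 1) \<and>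
     (\<forall>A\<in>sets M. \<forall>B\<in>sets M. A \<subseteq> B \<longrightarrow> V A \<le> V B) \<and>
     V {} = 0 \<and> V (space M) = 1"

definition sub_additive :: "'a measure \<Rightarrow> ('a set \<Rightarrow> real) \<Rightarrow> bool" where
  "sub_additive M V \<longleftrightarrow> (\<forall>A\<in>sets M. \<forall>B\<in>sets M. V (A \<union> B) \<le> V A + V B)"

definition countably_sub_additive :: "'a measure \<Rightarrow> ('a set \<Rightarrow> real) \<Rightarrow> bool" where
  "countably_sub_additive M V \<longleftrightarrow>
     (\<forall>A :: nat \<Rightarrow> 'a set. range A \<subseteq> sets M \<longrightarrow> ereal (V (\<Union>n. A n)) \<le> (\<Sum>n. ereal (V (A n))))"

definition property_C ::
  "'a measure \<Rightarrow> ('a \<Rightarrow> real) set \<Rightarrow> (('a \<Rightarrow> real) \<Rightarrow> ereal) \<Rightarrow> ('a set \<Rightarrow> real) \<Rightarrow> bool" where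
  "property_C M H E V \<longleftrightarrow>
     (\<forall>f\<in>H. \<forall>g\<in>H. \<forall>A\<in>sets M.
        (\<forall>\<omega>\<in>space M. f \<omega> \<le> indicator A \<omega> \<and> indicator A \<omega> \<le> g \<omega>)
          \<longrightarrow> E f \<le> ereal (V A) \<and> ereal (V A) \<le> E g)"

definition V_hat ::
  "'a measure \<Rightarrow> ('a \<Rightarrow> real) set \<Rightarrow> (('a \<Rightarrow> real) \<Rightarrow> ereal) \<Rightarrow> 'a set \<Rightarrow> ereal" where
  "V_hat M H E A = Inf {E \<xi> | \<xi>. \<xi> \<in> H \<and> (\<forall>\<omega>\<in>space M. indicator A \<omega> \<le> \<xi> \<omega>)}"

definition V_hat_star ::
  "'a measure \<Rightarrow> ('a \<Rightarrow> real) set \<Rightarrow> (('a \<Rightarrow> real) \<Rightarrow> ereal) \<Rightarrow> 'a set \<Rightarrow> ereal" where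
  "V_hat_star M H E A =
     Inf {(\<Sum>n. V_hat M H E (B n)) | B :: nat \<Rightarrow> 'a set. range B \<subseteq> sets M \<and> A \<subseteq> (\<Union>n. B n)}"

definition log_e :: "real \<Rightarrow> real" where
  "log_e x = ln (max (exp 1) x)"

definition S_part :: "(nat \<Rightarrow> 'a \<Rightarrow> real) \<Rightarrow> nat \<Rightarrow> 'a \<Rightarrow> real" where
  "S_part X n = (\<lambda>\<omega>. \<Sum>i=1..n. X i \<omega>)"

text \<open>
  The uses of \<open>real_of_ereal\<close> below, and on the expectations of partial sums later, are only on
  finite values: the second moments are assumed finite, and the variables in
  \<open>Gam\<close> and \<open>Lam\<close> are bounded.
\<close>

definition s_sq :: "(('a \<Rightarrow> real) \<Rightarrow> ereal) \<Rightarrow> (nat \<Rightarrow> 'a \<Rightarrow> real) \<Rightarrow> nat \<Rightarrow> real" where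
  "s_sq E X n = (\<Sum>k=1..n. real_of_ereal (E (\<lambda>\<omega>. (X k \<omega>)\<^sup>2)))"

definition s_norm :: "(('a \<Rightarrow> real) \<Rightarrow> ereal) \<Rightarrow> (nat \<Rightarrow> 'a \<Rightarrow> real) \<Rightarrow> nat \<Rightarrow> real" where
  "s_norm E X n = sqrt (s_sq E X n)"

definition t_norm :: "(('a \<Rightarrow> real) \<Rightarrow> ereal) \<Rightarrow> (nat \<Rightarrow> 'a \<Rightarrow> real) \<Rightarrow> nat \<Rightarrow> real" where
  "t_norm E X n = sqrt (2 * log_e (log_e (s_sq E X n)))"

definition a_norm :: "(('a \<Rightarrow> real) \<Rightarrow> ereal) \<Rightarrow> (nat \<Rightarrow> 'a \<Rightarrow> real) \<Rightarrow> nat \<Rightarrow> real" where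
  "a_norm E X n = s_norm E X n * t_norm E X n"

definition trunc_excess ::
  "(('a \<Rightarrow> real) \<Rightarrow> ereal) \<Rightarrow> (nat \<Rightarrow> 'a \<Rightarrow> real) \<Rightarrow> real \<Rightarrow> real \<Rightarrow> nat \<Rightarrow> nat \<Rightarrow> 'a \<Rightarrow> real" where
  "trunc_excess E X p \<alpha> n j = (\<lambda>\<omega>.
     (max (min \<bar>X j \<omega>\<bar> (a_norm E X n) - \<alpha> * s_norm E X n / t_norm E X n) 0) powr p)"

definition Gam ::
  "(('a \<Rightarrow> real) \<Rightarrow> ereal) \<Rightarrow> (nat \<Rightarrow> 'a \<Rightarrow> real) \<Rightarrow> real \<Rightarrow> real \<Rightarrow> nat \<Rightarrow> real" where
  "Gam E X p \<alpha> n = real_of_ereal (E (trunc_excess E X p \<alpha> n n))"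

text \<open>In \<open>Lam\<close> the truncation levels keep the index \<open>n\<close> while the variable runs over \<open>j\<close>.\<close>

definition Lam ::
  "(('a \<Rightarrow> real) \<Rightarrow> ereal) \<Rightarrow> (nat \<Rightarrow> 'a \<Rightarrow> real) \<Rightarrow> real \<Rightarrow> real \<Rightarrow> nat \<Rightarrow> real" where
  "Lam E X p \<alpha> n = (\<Sum>j=1..n. real_of_ereal (E (trunc_excess E X p \<alpha> n j)))"

text \<open>
  In HOL \<open>0 powr 0 = 0\<close>.  In the term below this agrees with the convention \<open>0^0 = 1\<close>, since
  \<open>0 \<le> Gam \<le> Lam\<close>: if the base of the second power is 0 then the first factor is 0 as well.
\<close>

definition GL_term ::
  "(('a \<Rightarrow> real) \<Rightarrow> ereal) \<Rightarrow> (nat \<Rightarrow> 'a \<Rightarrow> real) \<Rightarrow> real \<Rightarrow> real \<Rightarrow> real \<Rightarrow> nat \<Rightarrow> real" where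
  "GL_term E X p d \<alpha> n =
     Gam E X p \<alpha> n / a_norm E X n powr p * (Lam E X p \<alpha> n / a_norm E X n powr p) powr d"

text \<open>
  Normalized deviations of the partial sums from the lower and the upper expectation.  At the
  finitely many indices where \<open>a_norm\<close> may vanish they are 0, which affects no limit.
\<close>

definition dev_lower ::
  "(('a \<Rightarrow> real) \<Rightarrow> ereal) \<Rightarrow> (nat \<Rightarrow> 'a \<Rightarrow> real) \<Rightarrow> nat \<Rightarrow> 'a \<Rightarrow> real" where
  "dev_lower E X m \<omega> =
     (S_part X m \<omega> - real_of_ereal (conj_expectation E (S_part X m))) / a_norm E X m"

definition dev_upper ::
  "(('a \<Rightarrow> real) \<Rightarrow> ereal) \<Rightarrow> (nat \<Rightarrow> 'a \<Rightarrow> real) \<Rightarrow> nat \<Rightarrow> 'a \<Rightarrow> real" where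
  "dev_upper E X m \<omega> = (S_part X m \<omega> - real_of_ereal (E (S_part X m))) / a_norm E X m"

end

theory Submission
  imports Defs
begin

text \<open>
  Passing to \<open>-X\<close> reduces everything to the upper deviations.  Truncate each \<open>X i\<close> from above at
  \<open>\<delta> a\<^sub>i\<close>; the part cut off is controlled by the first summability hypothesis.  For the
  truncated sums \<open>T\<close> the process \<open>exp (h (T\<^sub>m - E S\<^sub>m) - c\<^sub>m)\<close> is a supermartingale for suitable
  \<open>c\<close>, and a pathwise (Azema-Yor) argument, which only needs test functions that are bounded
  and Lipschitz, gives a maximal inequality.  Cut time into blocks on which \<open>s\<^sub>n\<close> lies between
  \<open>l\<^sup>k\<close> and \<open>l\<^bsup>k+1\<^esup>\<close>, with \<open>l\<close> close to 1.  Values of \<open>X i\<close> above a multiple of \<open>s/t\<close> enter the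
  exponential moment through a quantity \<open>Q\<^sub>k\<close>, the sum of the \<open>Gam\<close> up to block \<open>k\<close> divided by
  \<open>a\<^sup>p\<close>.  With \<open>h = t/s\<close>, or a smaller \<open>h\<close> if \<open>Q\<^sub>k\<close> is not tiny, a block is bad with capacity at
  most \<open>C (exp (- (1 + \<epsilon>) t\<^sup>2 / 2) + Q\<^sub>k\<^bsup>d+1\<^esup>)\<close>, provided \<open>\<delta>\<close> is small.  The first term is of order
  \<open>k\<^bsup>-1-\<epsilon>\<^esup>\<close>; the second is summable because the second summability hypothesis, summed over one
  block, dominates the \<open>(d+1)\<close>-st power of the contribution of that block to \<open>Q\<^sub>k\<close>, and earlier
  contributions decay geometrically.
\<close>


section \<open>Real inequalities\<close>

text \<open>The obstacle is that \<open>E\<close> is only sub-additive, acts only on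
  \<open>H\<close>, and that independence can be used only through continuous test functions and in
  one direction: the last variable is integrated out first, with the past frozen. First passage
  times and their indicators are therefore out of reach. The transform that replaces them must have
  Lipschitz coefficients, and these must be nonnegative, since scaling is controlled only for
  nonnegative factors: \<open>E z \<le> 1\<close> gives a bound on the expectation of k * (z - 1)
  only for k \<ge> 0.

  Truncating from above is enough, because the exponential is harmless at minus infinity; and min(x,
  y) \<le> x keeps the mean of X i itself as the centring, so no correction term appears.

  In the first conclusion V is only finitely sub-additive, and property (C) yields V \<le>
  \<open>V_hat\<close>. So smallness is proved for \<open>V_hat\<close>, through covers by one
  sequence of sets of small total \<open>V_hat\<close>, finitely many of which suffice for each
  index. This single property, \<open>tail_null\<close>, yields all three conclusions.\<close>

lemma exp_le_quadratic:
  fixes u v :: real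
  assumes "u \<le> v" "0 \<le> v"
  shows "exp u \<le> 1 + u + u\<^sup>2 / 2 * exp v"
proof (cases "0 \<le> u")
  case True
  obtain t where t: "\<bar>t\<bar> \<le> \<bar>u\<bar>" "exp u = (\<Sum>m<2. u ^ m / fact m) + exp t / fact 2 * u ^ 2"
    using Maclaurin_exp_le[of u 2] by auto
  have "exp t \<le> exp v"
    using t(1) assms True by auto
  then have "exp t / 2 * u\<^sup>2 \<le> exp v / 2 * u\<^sup>2"
    by (intro mult_right_mono) auto
  with t(2) show ?thesis
    by (simp add: numeral_2_eq_2 algebra_simps)
next
  case False
  \<comment> \<open>A negative u needs another argument, because the intermediate point t above is
    only known to satisfy |t| \<le> |u| and may exceed v. Instead exp w is bounded below by its
    quadratic Taylor polynomial, whose product with the same polynomial at -w is 1 + w^4/4 \<ge>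
    1.\<close>
  define w where "w = - u"
  have w: "0 \<le> w" using False by (simp add: w_def)
  have pos: "0 < 1 + w + w\<^sup>2 / 2" using w by (simp add: add_pos_nonneg)
  have ge1: "1 \<le> (1 - w + w\<^sup>2 / 2) * (1 + w + w\<^sup>2 / 2)"
  proof -
    have "(1 - w + w\<^sup>2 / 2) * (1 + w + w\<^sup>2 / 2) = 1 + (w\<^sup>2)\<^sup>2 / 4"
      by (simp add: power2_eq_square field_simps)
    then show ?thesis by simp
  qed
  have "exp u = 1 / exp w" by (simp add: w_def exp_minus field_simps)
  also have "\<dots> \<le> 1 / (1 + w + w\<^sup>2 / 2)"
    using exp_lower_Taylor_quadratic[OF w] pos by (intro divide_left_mono) auto
  also have "\<dots> \<le> 1 - w + w\<^sup>2 / 2"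
    using ge1 pos by (simp add: divide_le_eq)
  also have "\<dots> = 1 + u + u\<^sup>2 / 2 * 1" by (simp add: w_def)
  also have "\<dots> \<le> 1 + u + u\<^sup>2 / 2 * exp v"
    using assms(2) by (intro add_left_mono mult_left_mono) auto
  finally show ?thesis .
qed

lemma powr_diff_le:
  fixes x y q :: real
  assumes "0 \<le> y" "y \<le> x" "1 \<le> q"
  shows "x powr q - y powr q \<le> q * x powr (q - 1) * (x - y)"
proof -
  consider "y = x" | "y = 0" "y < x" | "0 < y" "y < x" using assms by linarith
  then show ?thesis
  proof cases
    \<comment> \<open>The derivative rule for powr requires a positive base, so y = 0 is done by
      hand from x^q = x^(q-1) * x.\<close>
    case 2
    have "x powr q = 1 * (x powr (q - 1) * x)"
      using 2 powr_add[of x "q - 1" 1] by simp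
    also have "\<dots> \<le> q * (x powr (q - 1) * x)"
      using 2 assms by (intro mult_right_mono) auto
    finally show ?thesis using 2 by simp
  next
    case 3
    have "\<exists>z>y. z < x \<and> x powr q - y powr q = (x - y) * (q * z powr (q - 1))"
      using 3 by (intro MVT2) (auto intro!: derivative_eq_intros)
    then obtain z where z: "y < z" "z < x"
      "x powr q - y powr q = (x - y) * (q * z powr (q - 1))" by auto
    have "z powr (q - 1) \<le> x powr (q - 1)"
      using z 3 assms by (intro powr_mono2) auto
    then show ?thesis
      using z assms by (simp add: mult.commute mult_left_mono)
  qed auto
qed

text \<open>A discrete form of G^(d+1) = (d+1) * integral of G^d dG for the partial sums G: each
  increment of G^(d+1) is at most d+1 times the new value of G^d times the increment of G. It is the
  bridge from the product in \<open>GL_term\<close> to a pure power of a block sum.\<close>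

lemma powr_sum_le_weighted_sum:
  fixes g :: "nat \<Rightarrow> real"
  assumes g: "\<And>i. 0 \<le> g i" and d: "0 \<le> d"
  shows "(\<Sum>i\<in>{a..<b}. g i) powr (d + 1)
    \<le> (d + 1) * (\<Sum>n\<in>{a..<b}. g n * (\<Sum>i\<in>{a..n}. g i) powr d)"
proof (induction b)
  case (Suc b)
  show ?case
  proof (cases "a \<le> b")
    case True
    define P where "P = (\<Sum>i\<in>{a..<b}. g i)"
    have P0: "0 \<le> P" unfolding P_def by (intro sum_nonneg g)
    have full: "(\<Sum>i\<in>{a..b}. g i) = P + g b"
      using True unfolding P_def by (simp add: atLeastLessThanSuc_atLeastAtMost[symmetric])
    have "(P + g b) powr (d + 1) - P powr (d + 1) \<le> (d + 1) * (P + g b) powr d * g b"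
      using powr_diff_le[of P "P + g b" "d + 1"] P0 g[of b] d by simp
    with Suc.IH show ?thesis
      using True full unfolding P_def[symmetric]
      by (simp add: P_def[symmetric] algebra_simps)
  qed simp
qed simp

section \<open>Slow variation of the iterated logarithm\<close>

lemma log_e_ge1: "1 \<le> log_e x"
proof -
  have "ln (exp 1) \<le> ln (max (exp 1) x)"
    by (subst ln_le_cancel_iff) (auto simp: less_max_iff_disj)
  then show ?thesis by (simp add: log_e_def)
qed

lemma log_e_mono: "x \<le> y \<Longrightarrow> log_e x \<le> log_e y"
  unfolding log_e_def by (subst ln_le_cancel_iff) (auto simp: less_max_iff_disj)

text \<open>Slow variation is used only in this crude form. The bounds ln c \<le> c - 1 and
  \<open>1 \<le> log_e v\<close> turn the additive error ln c into the factor c, and in this shape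
  the estimate can be iterated to reach \<open>LL\<close>.\<close>

lemma log_e_scale_le:
  assumes "1 \<le> c"
  shows "log_e (c * v) \<le> c * log_e v"
proof -
  have pos: "0 < max (exp 1) v" by (auto simp: less_max_iff_disj)
  have "max (exp 1) (c * v) \<le> c * max (exp 1) v"
    using assms mult_mono[of 1 c "exp 1 :: real" "max (exp 1) v"] mult_left_mono[of v "max (exp 1) v" c]
    by auto
  then have "log_e (c * v) \<le> ln (c * max (exp 1) v)"
    unfolding log_e_def using pos assms
    by (subst ln_le_cancel_iff) (auto simp: less_max_iff_disj)
  also have "\<dots> = ln c + log_e v"
    using pos assms by (simp add: log_e_def ln_mult)
  also have "ln c \<le> (c - 1) * 1"
    using assms by (simp add: ln_le_minus_one)
  also have "\<dots> \<le> (c - 1) * log_e v"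
    using assms log_e_ge1 by (intro mult_left_mono) auto
  finally show ?thesis by (simp add: algebra_simps)
qed

definition LL :: "real \<Rightarrow> real" where "LL v = log_e (log_e v)"

lemma LL_ge1: "1 \<le> LL v"
  by (simp add: LL_def log_e_ge1)

lemma LL_mono: "x \<le> y \<Longrightarrow> LL x \<le> LL y"
  by (simp add: LL_def log_e_mono)

lemma LL_scale_le:
  assumes "1 \<le> c"
  shows "LL (c * v) \<le> c * LL v"
  unfolding LL_def
  using log_e_mono[OF log_e_scale_le[OF assms]] log_e_scale_le[OF assms] order_trans by blast

text \<open>Monotonicity of v / LL v with denominators cleared; it makes the threshold s/t monotone
  in s.\<close>

lemma LL_ratio_le:
  assumes "0 < x" "x \<le> y"
  shows "LL y * x \<le> LL x * y"
  using LL_scale_le[of "y / x" x] assms by (simp add: field_simps)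

lemma ln_ln_le_LL:
  assumes "1 < v"
  shows "ln (ln v) \<le> LL v"
proof -
  have "ln v \<le> log_e v" using assms unfolding log_e_def by auto
  then have "ln (ln v) \<le> ln (log_e v)"
    using assms log_e_ge1[of v] ln_gt_zero[OF assms] by (subst ln_le_cancel_iff) auto
  also have "\<dots> \<le> LL v"
    unfolding LL_def log_e_def[of "log_e v"] using log_e_ge1[of v] by auto
  finally show ?thesis .
qed

section \<open>Lipschitz functions of finitely many coordinates\<close>

text \<open>Globally Lipschitz functions send integrable variables to integrable ones, which fails
  for polynomially growing members of \<open>C_lLip\<close>, as only second moments are available.
  With the l1 norm, freezing coordinates just deletes summands.\<close>

definition lip :: "nat \<Rightarrow> ((nat \<Rightarrow> real) \<Rightarrow> real) \<Rightarrow> bool" where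
  "lip n \<phi> \<longleftrightarrow> (\<exists>C. \<forall>x y. \<bar>\<phi> x - \<phi> y\<bar> \<le> C * (\<Sum>i<n. \<bar>x i - y i\<bar>))"

text \<open>Boundedness is added because products are needed, and a product of Lipschitz functions
  is in general Lipschitz only for bounded factors.\<close>

definition blip :: "nat \<Rightarrow> ((nat \<Rightarrow> real) \<Rightarrow> real) \<Rightarrow> bool" where
  "blip n \<phi> \<longleftrightarrow> lip n \<phi> \<and> (\<exists>K. \<forall>x. \<bar>\<phi> x\<bar> \<le> K)"

lemma lipE:
  assumes "lip n \<phi>"
  obtains C where "0 < C" "\<And>x y. \<bar>\<phi> x - \<phi> y\<bar> \<le> C * (\<Sum>i<n. \<bar>x i - y i\<bar>)"
proof -
  obtain C where C: "\<And>x y. \<bar>\<phi> x - \<phi> y\<bar> \<le> C * (\<Sum>i<n. \<bar>x i - y i\<bar>)"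
    using assms unfolding lip_def by blast
  have "\<bar>\<phi> x - \<phi> y\<bar> \<le> (\<bar>C\<bar> + 1) * (\<Sum>i<n. \<bar>x i - y i\<bar>)" for x y
    by (rule order_trans[OF C]) (auto intro!: mult_right_mono sum_nonneg)
  then show thesis by (intro that[of "\<bar>C\<bar> + 1"]) auto
qed

lemma lip_cong:
  assumes "lip n \<phi>" "\<And>i. i < n \<Longrightarrow> x i = y i"
  shows "\<phi> x = \<phi> y"
proof -
  obtain C where "\<And>x y. \<bar>\<phi> x - \<phi> y\<bar> \<le> C * (\<Sum>i<n. \<bar>x i - y i\<bar>)"
    using assms(1) lipE by metis
  from this[of x y] show ?thesis using assms(2) by simp
qed

lemma lip_C_lLip:
  assumes "lip n \<phi>"
  shows "\<phi> \<in> C_lLip n"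
proof -
  obtain C where C: "0 < C" "\<And>x y. \<bar>\<phi> x - \<phi> y\<bar> \<le> C * (\<Sum>i<n. \<bar>x i - y i\<bar>)"
    using assms lipE by metis
  have "\<bar>\<phi> x - \<phi> y\<bar> \<le> (C * (real n + 1)) * (1 + L2_set x {..<n} ^ 0 + L2_set y {..<n} ^ 0)
      * L2_set (\<lambda>i. x i - y i) {..<n}" for x y
  proof -
    let ?L = "L2_set (\<lambda>i. x i - y i) {..<n}"
    have "(\<Sum>i<n. \<bar>x i - y i\<bar>) \<le> (\<Sum>i<n. ?L)"
    proof (rule sum_mono)
      fix i assume "i \<in> {..<n}"
      then have "\<bar>x i - y i\<bar> \<le> L2_set (\<lambda>i. \<bar>x i - y i\<bar>) {..<n}"
        by (intro member_le_L2_set) auto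
      then show "\<bar>x i - y i\<bar> \<le> ?L" by (simp add: L2_set_def)
    qed
    also have "\<dots> \<le> ((real n + 1) * 3) * ?L"
      by (auto intro!: mult_right_mono)
    finally have "C * (\<Sum>i<n. \<bar>x i - y i\<bar>) \<le> C * (((real n + 1) * 3) * ?L)"
      using C(1) by (intro mult_left_mono) auto
    with C(2)[of x y] show ?thesis by (simp add: mult.assoc)
  qed
  moreover have "0 < C * (real n + 1)" using C(1) by simp
  ultimately show ?thesis unfolding C_lLip_def by blast
qed

lemma lip_mono:
  assumes "lip m \<phi>" "m \<le> n"
  shows "lip n \<phi>"
proof -
  obtain C where C: "0 < C" "\<And>x y. \<bar>\<phi> x - \<phi> y\<bar> \<le> C * (\<Sum>i<m. \<bar>x i - y i\<bar>)"
    using assms lipE by metis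
  have "(\<Sum>i<m. \<bar>x i - y i\<bar>) \<le> (\<Sum>i<n. \<bar>x i - y i\<bar>)" for x y :: "nat \<Rightarrow> real"
    using assms(2) by (intro sum_mono2) auto
  then have "\<bar>\<phi> x - \<phi> y\<bar> \<le> C * (\<Sum>i<n. \<bar>x i - y i\<bar>)" for x y
    using C by (meson mult_left_mono order_trans less_imp_le)
  then show ?thesis unfolding lip_def by blast
qed

lemma lip_const: "lip n (\<lambda>x. c)"
  unfolding lip_def by (intro exI[of _ 0]) auto

lemma lip_comp:
  assumes "C-lipschitz_on UNIV f" "lip n \<phi>"
  shows "lip n (\<lambda>x. f (\<phi> x))"
proof -
  obtain D where D: "\<And>x y. \<bar>\<phi> x - \<phi> y\<bar> \<le> D * (\<Sum>i<n. \<bar>x i - y i\<bar>)"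
    using assms(2) lipE by metis
  have C: "0 \<le> C" "\<bar>f u - f v\<bar> \<le> C * \<bar>u - v\<bar>" for u v
    using assms(1) by (auto simp: lipschitz_on_def dist_real_def)
  have "\<bar>f (\<phi> x) - f (\<phi> y)\<bar> \<le> (C * D) * (\<Sum>i<n. \<bar>x i - y i\<bar>)" for x y
    using order_trans[OF C(2) mult_left_mono[OF D C(1)]] by (simp add: mult.assoc)
  then show ?thesis unfolding lip_def by blast
qed

lemma lip_coord:
  assumes "i < n"
  shows "lip n (\<lambda>x. x i)"
  unfolding lip_def
  using assms by (intro exI[of _ 1]) (auto intro!: member_le_sum)

lemma lip_add:
  assumes "lip n \<phi>" "lip n \<psi>"
  shows "lip n (\<lambda>x. \<phi> x + \<psi> x)"
proof -
  obtain C where C: "\<And>x y. \<bar>\<phi> x - \<phi> y\<bar> \<le> C * (\<Sum>i<n. \<bar>x i - y i\<bar>)"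
    using assms(1) lipE by metis
  obtain D where D: "\<And>x y. \<bar>\<psi> x - \<psi> y\<bar> \<le> D * (\<Sum>i<n. \<bar>x i - y i\<bar>)"
    using assms(2) lipE by metis
  have "\<bar>\<phi> x + \<psi> x - (\<phi> y + \<psi> y)\<bar> \<le> (C + D) * (\<Sum>i<n. \<bar>x i - y i\<bar>)" for x y
    using C[of x y] D[of x y] by (simp add: distrib_right)
  then show ?thesis unfolding lip_def by blast
qed

lemma lip_sum:
  assumes "\<And>i. i \<in> I \<Longrightarrow> lip n (\<phi> i)"
  shows "lip n (\<lambda>x. \<Sum>i\<in>I. \<phi> i x)"
  using assms
proof (induction I rule: infinite_finite_induct)
qed (auto intro: lip_const lip_add)

lemma lip_max:
  assumes "lip n \<phi>" "lip n \<psi>"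
  shows "lip n (\<lambda>x. max (\<phi> x) (\<psi> x))"
proof -
  obtain C where C: "0 < C" "\<And>x y. \<bar>\<phi> x - \<phi> y\<bar> \<le> C * (\<Sum>i<n. \<bar>x i - y i\<bar>)"
    using assms(1) lipE by metis
  obtain D where D: "0 < D" "\<And>x y. \<bar>\<psi> x - \<psi> y\<bar> \<le> D * (\<Sum>i<n. \<bar>x i - y i\<bar>)"
    using assms(2) lipE by metis
  have "\<bar>max (\<phi> x) (\<psi> x) - max (\<phi> y) (\<psi> y)\<bar> \<le> (C + D) * (\<Sum>i<n. \<bar>x i - y i\<bar>)" for x y
    using order_trans[OF abs_ge_zero C(2)[of x y]] order_trans[OF abs_ge_zero D(2)[of x y]]
      C(2)[of x y] D(2)[of x y] by (auto simp: distrib_right max_def)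
  then show ?thesis unfolding lip_def by blast
qed

lemma blip_const: "blip n (\<lambda>x. c)"
  unfolding blip_def using lip_const by auto

lemma blip_mono: "blip m \<phi> \<Longrightarrow> m \<le> n \<Longrightarrow> blip n \<phi>"
  unfolding blip_def using lip_mono by blast

lemma blip_add:
  assumes "blip n \<phi>" "blip n \<psi>"
  shows "blip n (\<lambda>x. \<phi> x + \<psi> x)"
proof -
  obtain K K' where "\<And>x. \<bar>\<phi> x\<bar> \<le> K" "\<And>x. \<bar>\<psi> x\<bar> \<le> K'"
    using assms unfolding blip_def by blast
  then have "\<bar>\<phi> x + \<psi> x\<bar> \<le> K + K'" for x
    using abs_triangle_ineq[of "\<phi> x" "\<psi> x"] by (meson add_mono order_trans)
  then show ?thesis using assms lip_add unfolding blip_def by blast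
qed

lemma blip_max:
  assumes "blip n \<phi>" "blip n \<psi>"
  shows "blip n (\<lambda>x. max (\<phi> x) (\<psi> x))"
proof -
  obtain K K' where "\<And>x. \<bar>\<phi> x\<bar> \<le> K" "\<And>x. \<bar>\<psi> x\<bar> \<le> K'"
    using assms unfolding blip_def by blast
  then have "\<bar>max (\<phi> x) (\<psi> x)\<bar> \<le> max K K'" for x
    by (metis max_def max.coboundedI1 max.coboundedI2)
  then show ?thesis using assms lip_max unfolding blip_def by blast
qed

lemma blip_mult:
  assumes "blip n \<phi>" "blip n \<psi>"
  shows "blip n (\<lambda>x. \<phi> x * \<psi> x)"
proof -
  obtain C where C: "\<And>x y. \<bar>\<phi> x - \<phi> y\<bar> \<le> C * (\<Sum>i<n. \<bar>x i - y i\<bar>)"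
    using assms unfolding blip_def by (metis lipE)
  obtain D where D: "\<And>x y. \<bar>\<psi> x - \<psi> y\<bar> \<le> D * (\<Sum>i<n. \<bar>x i - y i\<bar>)"
    using assms unfolding blip_def by (metis lipE)
  obtain K K' where K: "\<And>x. \<bar>\<phi> x\<bar> \<le> K" "\<And>x. \<bar>\<psi> x\<bar> \<le> K'"
    using assms unfolding blip_def by blast
  have K0: "0 \<le> K" "0 \<le> K'" using order_trans[OF abs_ge_zero K(1)] order_trans[OF abs_ge_zero K(2)]
    by auto
  have "\<bar>\<phi> x * \<psi> x - \<phi> y * \<psi> y\<bar> \<le> (K * D + C * K') * (\<Sum>i<n. \<bar>x i - y i\<bar>)" for x y
  proof -
    let ?s = "\<Sum>i<n. \<bar>x i - y i\<bar>"
    have "\<phi> x * \<psi> x - \<phi> y * \<psi> y = \<phi> x * (\<psi> x - \<psi> y) + (\<phi> x - \<phi> y) * \<psi> y"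
      by (simp add: algebra_simps)
    then have "\<bar>\<phi> x * \<psi> x - \<phi> y * \<psi> y\<bar> \<le> \<bar>\<phi> x\<bar> * \<bar>\<psi> x - \<psi> y\<bar> + \<bar>\<phi> x - \<phi> y\<bar> * \<bar>\<psi> y\<bar>"
      by (metis abs_mult abs_triangle_ineq)
    also have "\<dots> \<le> K * (D * ?s) + (C * ?s) * K'"
      using K0 order_trans[OF abs_ge_zero C[of x y]]
      by (intro add_mono mult_mono K C D) auto
    finally show ?thesis by (simp add: algebra_simps)
  qed
  moreover have "\<bar>\<phi> x * \<psi> x\<bar> \<le> K * K'" for x
    using K K0 by (auto simp: abs_mult intro!: mult_mono)
  ultimately show ?thesis unfolding blip_def lip_def by blast
qed

lemma blip_comp_lip:
  assumes "C-lipschitz_on UNIV f" "\<And>u. \<bar>f u\<bar> \<le> K" "lip n \<phi>"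
  shows "blip n (\<lambda>x. f (\<phi> x))"
  using lip_comp[OF assms(1,3)] assms(2) unfolding blip_def by blast

section \<open>Calculus of upper bounds for a sub-linear expectation\<close>

context sublinear_expectation_space
begin

lemma lip_H:
  assumes "lip n \<phi>" "\<And>i. i < n \<Longrightarrow> Z i \<in> H"
  shows "(\<lambda>\<omega>. \<phi> (\<lambda>i. Z i \<omega>)) \<in> H"
  using H_comp[OF lip_C_lLip[OF assms(1)] assms(2)] .

lemma H_const: "(\<lambda>\<omega>. c) \<in> H"
  using lip_H[OF lip_const[of 0 c]] by simp

lemma lipschitz_H:
  assumes "C-lipschitz_on UNIV f" "X \<in> H"
  shows "(\<lambda>\<omega>. f (X \<omega>)) \<in> H"
  using lip_H[OF lip_comp[OF assms(1) lip_coord[of 0 1]], of "\<lambda>_. X"] assms(2) by simp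

lemma abs_H: "X \<in> H \<Longrightarrow> (\<lambda>\<omega>. \<bar>X \<omega>\<bar>) \<in> H"
  by (rule lipschitz_H[of 1]) (auto intro!: lipschitz_onI simp: dist_real_def)

lemma uminus_H: "X \<in> H \<Longrightarrow> (\<lambda>\<omega>. - X \<omega>) \<in> H"
  using H_scale[of X "-1"] by simp

lemma sum_H: "(\<And>i. i \<in> I \<Longrightarrow> X i \<in> H) \<Longrightarrow> (\<lambda>\<omega>. \<Sum>i\<in>I. X i \<omega>) \<in> H"
  by (induction I rule: infinite_finite_induct) (auto intro: H_zero H_add)

lemma square_H:
  assumes "X \<in> H"
  shows "(\<lambda>\<omega>. (X \<omega>)\<^sup>2) \<in> H"
proof -
  have "\<bar>(x 0)\<^sup>2 - (y 0)\<^sup>2\<bar> \<le> 1 * (1 + L2_set x {..<1} ^ 1 + L2_set y {..<1} ^ 1)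
      * L2_set (\<lambda>i. x i - y i) {..<1}" for x y :: "nat \<Rightarrow> real"
  proof -
    have "\<bar>(x 0)\<^sup>2 - (y 0)\<^sup>2\<bar> = \<bar>x 0 + y 0\<bar> * \<bar>x 0 - y 0\<bar>"
      by (simp add: power2_eq_square abs_mult[symmetric] algebra_simps)
    also have "\<dots> \<le> (1 + \<bar>x 0\<bar> + \<bar>y 0\<bar>) * \<bar>x 0 - y 0\<bar>"
      by (intro mult_right_mono) auto
    finally show ?thesis by (simp add: L2_set_def)
  qed
  then have "(\<lambda>x. (x 0)\<^sup>2) \<in> C_lLip 1"
    unfolding C_lLip_def using zero_less_one by blast
  from H_comp[OF this, of "\<lambda>_. X"] assms show ?thesis by simp
qed

lemma E_nonneg:
  assumes "X \<in> H" "\<And>\<omega>. \<omega> \<in> space M \<Longrightarrow> 0 \<le> X \<omega>"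
  shows "0 \<le> E X"
  using E_mono[OF assms(1) H_const[of 0]] assms(2) E_const[of 0] by (simp add: zero_ereal_def)

text \<open>Real upper bounds exclude the excepted cases of \<open>E_subadd\<close>: neither
  expectation can be \<infinity>, and -\<infinity> alone does no harm.\<close>

lemma E_add_le:
  assumes "X \<in> H" "Y \<in> H" "E X \<le> ereal a" "E Y \<le> ereal b"
  shows "E (\<lambda>\<omega>. X \<omega> + Y \<omega>) \<le> ereal (a + b)"
proof -
  have "E (\<lambda>\<omega>. X \<omega> + Y \<omega>) \<le> E X + E Y"
    using assms(3,4) by (intro E_subadd assms(1,2)) auto
  also have "\<dots> \<le> ereal a + ereal b" using assms(3,4) by (rule add_mono)
  finally show ?thesis by simp
qed

lemma E_scale_le:
  assumes "X \<in> H" "0 \<le> r" "E X \<le> ereal a"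
  shows "E (\<lambda>\<omega>. r * X \<omega>) \<le> ereal (r * a)"
  using ereal_mult_left_mono[OF assms(3), of "ereal r"] assms(1,2) by (simp add: E_pos_homogeneous)

lemma E_sum_le:
  assumes "finite I" "\<And>i. i \<in> I \<Longrightarrow> X i \<in> H" "\<And>i. i \<in> I \<Longrightarrow> E (X i) \<le> ereal (a i)"
  shows "E (\<lambda>\<omega>. \<Sum>i\<in>I. X i \<omega>) \<le> ereal (\<Sum>i\<in>I. a i)"
  using assms by (induction I) (auto simp: E_const intro!: E_add_le sum_H)

text \<open>Equality, although \<open>E\<close> is only sub-additive: the constant is added and then
  subtracted again, and sub-additivity is used both times.\<close>

lemma E_add_const:
  assumes "X \<in> H"
  shows "E (\<lambda>\<omega>. X \<omega> + c) = E X + ereal c"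
proof (rule antisym)
  have le: "E (\<lambda>\<omega>. Y \<omega> + b) \<le> E Y + ereal b" if "Y \<in> H" for Y b
    using E_subadd[OF that H_const[of b]] by (simp add: E_const)
  show "E (\<lambda>\<omega>. X \<omega> + c) \<le> E X + ereal c" by (rule le[OF assms])
  have "E (\<lambda>\<omega>. (X \<omega> + c) + (- c)) \<le> E (\<lambda>\<omega>. X \<omega> + c) + ereal (- c)"
    by (intro le H_add assms H_const)
  then show "E X + ereal c \<le> E (\<lambda>\<omega>. X \<omega> + c)"
    by (cases "E X"; cases "E (\<lambda>\<omega>. X \<omega> + c)") auto
qed

section \<open>Integrable variables\<close>

definition integ :: "('a \<Rightarrow> real) \<Rightarrow> bool" where
  "integ X \<longleftrightarrow> X \<in> H \<and> E (\<lambda>\<omega>. \<bar>X \<omega>\<bar>) < \<infinity>"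

lemma integ_real:
  assumes "integ X"
  shows "E X = ereal (real_of_ereal (E X))"
proof -
  have X: "X \<in> H" and fin: "E (\<lambda>\<omega>. \<bar>X \<omega>\<bar>) < \<infinity>" using assms by (auto simp: integ_def)
  have up: "E X \<le> E (\<lambda>\<omega>. \<bar>X \<omega>\<bar>)" by (intro E_mono abs_H X) auto
  have up': "E (\<lambda>\<omega>. - X \<omega>) \<le> E (\<lambda>\<omega>. \<bar>X \<omega>\<bar>)" by (intro E_mono abs_H uminus_H X) auto
  \<comment> \<open>The value -\<infinity> would force E 0 = -\<infinity>, by sub-additivity for X
    and -X, since the expectation of -X is below that of |X| and so not \<infinity>.\<close>
  have "E X \<noteq> -\<infinity>"
  proof
    assume "E X = -\<infinity>"
    then have "E (\<lambda>\<omega>. X \<omega> + - X \<omega>) \<le> E X + E (\<lambda>\<omega>. - X \<omega>)"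
      using up' fin by (intro E_subadd X uminus_H) auto
    with \<open>E X = -\<infinity>\<close> up' fin show False
      by (cases "E (\<lambda>\<omega>. - X \<omega>)") (auto simp: E_const)
  qed
  then show ?thesis using up fin by (cases "E X") auto
qed

lemma integ_const: "integ (\<lambda>\<omega>. c)"
  by (simp add: integ_def H_const E_const)

lemma integ_mono:
  assumes "X \<in> H" "Y \<in> H" "E Y < \<infinity>" "\<And>\<omega>. \<omega> \<in> space M \<Longrightarrow> \<bar>X \<omega>\<bar> \<le> Y \<omega>"
  shows "integ X"
  using E_mono[OF assms(2) abs_H[OF assms(1)] assms(4)] assms by (auto simp: integ_def)

lemma integ_square:
  assumes "X \<in> H" "E (\<lambda>\<omega>. (X \<omega>)\<^sup>2) < \<infinity>"
  shows "integ X"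
proof (rule integ_mono[OF assms(1)])
  show "(\<lambda>\<omega>. (X \<omega>)\<^sup>2 + 1) \<in> H" by (intro H_add square_H H_const assms)
  show "E (\<lambda>\<omega>. (X \<omega>)\<^sup>2 + 1) < \<infinity>"
    using assms by (subst E_add_const) (auto intro: square_H)
  show "\<bar>X \<omega>\<bar> \<le> (X \<omega>)\<^sup>2 + 1" for \<omega>
    using sum_squares_bound[of "\<bar>X \<omega>\<bar>" 1] by simp
qed

lemma integ_bounded:
  assumes "X \<in> H" "\<And>\<omega>. \<omega> \<in> space M \<Longrightarrow> \<bar>X \<omega>\<bar> \<le> K"
  shows "integ X"
  by (rule integ_mono[OF assms(1) H_const[of K]]) (use assms in \<open>auto simp: E_const\<close>)

lemma lip_integ:
  assumes "lip n \<phi>" "\<And>i. i < n \<Longrightarrow> integ (Z i)"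
  shows "integ (\<lambda>\<omega>. \<phi> (\<lambda>i. Z i \<omega>))"
proof -
  obtain C where C: "0 < C" "\<And>x y. \<bar>\<phi> x - \<phi> y\<bar> \<le> C * (\<Sum>i<n. \<bar>x i - y i\<bar>)"
    using assms(1) lipE by metis
  have Z: "Z i \<in> H" if "i < n" for i using assms(2)[OF that] by (simp add: integ_def)
  let ?Y = "\<lambda>\<omega>. C * (\<Sum>i<n. \<bar>Z i \<omega>\<bar>)"
  have sH: "(\<lambda>\<omega>. \<Sum>i<n. \<bar>Z i \<omega>\<bar>) \<in> H" by (intro sum_H abs_H Z) auto
  have fin: "E (\<lambda>\<omega>. \<bar>Z i \<omega>\<bar>) \<le> ereal (real_of_ereal (E (\<lambda>\<omega>. \<bar>Z i \<omega>\<bar>)))" if "i < n" for i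
    using assms(2)[OF that] Z[OF that]
    by (subst integ_real[symmetric]) (auto simp: integ_def abs_H)
  have "E (\<lambda>\<omega>. \<Sum>i<n. \<bar>Z i \<omega>\<bar>) \<le> ereal (\<Sum>i<n. real_of_ereal (E (\<lambda>\<omega>. \<bar>Z i \<omega>\<bar>)))"
    by (intro E_sum_le) (auto intro: abs_H Z fin)
  from E_scale_le[OF sH _ this, of C] C(1) have le: "E ?Y < \<infinity>"
    by (auto intro: le_less_trans)
  show ?thesis
  proof (rule integ_mono)
    show "(\<lambda>\<omega>. \<phi> (\<lambda>i. Z i \<omega>)) \<in> H" using lip_H[OF assms(1) Z] .
    show "(\<lambda>\<omega>. ?Y \<omega> + \<bar>\<phi> (\<lambda>_. 0)\<bar>) \<in> H" by (intro H_add H_scale sH H_const)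
    show "E (\<lambda>\<omega>. ?Y \<omega> + \<bar>\<phi> (\<lambda>_. 0)\<bar>) < \<infinity>"
      using le by (subst E_add_const) (auto intro: H_scale sH)
    show "\<bar>\<phi> (\<lambda>i. Z i \<omega>)\<bar> \<le> ?Y \<omega> + \<bar>\<phi> (\<lambda>_. 0)\<bar>" for \<omega>
      using C(2)[of "\<lambda>i. Z i \<omega>" "\<lambda>_. 0"] by simp
  qed
qed

section \<open>The set function \<open>V_hat\<close> and its relation to V\<close>

lemma V_hat_le:
  assumes "\<xi> \<in> H" "\<And>\<omega>. \<omega> \<in> space M \<Longrightarrow> indicator A \<omega> \<le> \<xi> \<omega>"
  shows "V_hat M H E A \<le> E \<xi>"
  unfolding V_hat_def using assms by (intro Inf_lower) auto

lemma V_hat_nonneg: "0 \<le> V_hat M H E A"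
  unfolding V_hat_def
proof (rule Inf_greatest, clarify)
  fix \<xi> assume "\<xi> \<in> H" "\<forall>\<omega>\<in>space M. indicator A \<omega> \<le> \<xi> \<omega>"
  then show "0 \<le> E \<xi>"
    by (intro E_nonneg) (metis indicator_pos_le order_trans)+
qed

lemma capacity_le_V_hat:
  assumes "property_C M H E V" "A \<in> sets M"
  shows "ereal (V A) \<le> V_hat M H E A"
  unfolding V_hat_def
proof (rule Inf_greatest, clarify)
  fix \<xi> assume \<xi>: "\<xi> \<in> H" "\<forall>\<omega>\<in>space M. indicator A \<omega> \<le> \<xi> \<omega>"
  show "ereal (V A) \<le> E \<xi>"
    using assms(1)[unfolded property_C_def, rule_format, OF H_zero \<xi>(1) assms(2)] \<xi>(2) by simp
qed

lemma lip_fiber_integ: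
  assumes \<phi>: "lip (Suc m) \<phi>" and Y: "integ Y"
  shows "integ (\<lambda>\<omega>. \<phi> (\<lambda>i. if i < m then x i else Y \<omega>))"
proof -
  have Z: "integ (if i < m then \<lambda>\<omega>. x i else Y)" for i
    using integ_const Y by simp
  have h: "integ (\<lambda>\<omega>. \<phi> (\<lambda>i. (if i < m then \<lambda>\<omega>. x i else Y) \<omega>))"
    by (rule lip_integ[OF \<phi> Z])
  have eq: "(\<lambda>i. (if i < m then \<lambda>\<omega>. x i else Y) \<omega>) = (\<lambda>i. if i < m then x i else Y \<omega>)" for \<omega>
    by (rule ext) simp
  show ?thesis using h unfolding eq .
qed

lemma lip_fiber:
  assumes \<phi>: "lip (Suc m) \<phi>" and Y: "integ Y"
  shows "lip m (\<lambda>x. real_of_ereal (E (\<lambda>\<omega>. \<phi> (\<lambda>i. if i < m then x i else Y \<omega>))))"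
proof -
  define F where "F x = (\<lambda>\<omega>. \<phi> (\<lambda>i. if i < m then x i else Y \<omega>))" for x
  have integ: "integ (F x)" for x
    unfolding F_def by (rule lip_fiber_integ[OF \<phi> Y])
  have H: "F x \<in> H" for x
    using integ[of x] by (simp add: integ_def)
  obtain C where C: "0 < C" "\<And>x y. \<bar>\<phi> x - \<phi> y\<bar> \<le> C * (\<Sum>i<Suc m. \<bar>x i - y i\<bar>)"
    using \<phi> lipE by metis
  have one: "real_of_ereal (E (F x)) \<le> real_of_ereal (E (F y)) + C * (\<Sum>i<m. \<bar>x i - y i\<bar>)" for x y
  proof -
    let ?c = "C * (\<Sum>i<m. \<bar>x i - y i\<bar>)"
    have "E (F x) \<le> E (\<lambda>\<omega>. F y \<omega> + ?c)"
    proof (rule E_mono[OF H_add[OF H H_const] H])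
      have "\<bar>F x \<omega> - F y \<omega>\<bar> \<le> ?c" for \<omega>
        using C(2)[of "\<lambda>i. if i < m then x i else Y \<omega>" "\<lambda>i. if i < m then y i else Y \<omega>"]
        unfolding F_def by simp
      then show "F x \<omega> \<le> F y \<omega> + ?c" for \<omega> by (simp add: abs_le_iff algebra_simps)
    qed
    also have "\<dots> = E (F y) + ereal ?c"
      by (rule E_add_const[OF H])
    finally have "E (F x) \<le> E (F y) + ereal ?c" .
    moreover obtain a b where "E (F x) = ereal a" "E (F y) = ereal b"
      using integ_real[OF integ] by blast
    ultimately show ?thesis by simp
  qed
  have "\<bar>real_of_ereal (E (F x)) - real_of_ereal (E (F y))\<bar> \<le> C * (\<Sum>i<m. \<bar>x i - y i\<bar>)" for x y
  proof -
    have sw: "(\<Sum>i<m. \<bar>y i - x i\<bar>) = (\<Sum>i<m. \<bar>x i - y i\<bar>)"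
      by (intro sum.cong) auto
    show ?thesis using one[of x y] one[of y x] unfolding sw by linarith
  qed
  then show ?thesis unfolding lip_def F_def by blast
qed

end

section \<open>Independent sequences: integrating out the last variable\<close>

locale independent_sequence = sublinear_expectation_space +
  fixes X :: "nat \<Rightarrow> 'a \<Rightarrow> real"
  assumes X_H: "1 \<le> n \<Longrightarrow> X n \<in> H"
    and X_indep: "independent_seq H E X"
    and X_square: "1 \<le> n \<Longrightarrow> E (\<lambda>\<omega>. (X n \<omega>)\<^sup>2) < \<infinity>"
begin

lemma X_integ: "1 \<le> n \<Longrightarrow> integ (X n)"
  using integ_square X_H X_square by blast

lemma E_independent:
  assumes \<phi>: "lip (Suc m) \<phi>"
  shows "E (\<lambda>\<omega>. \<phi> (\<lambda>i. X (Suc i) \<omega>))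
    = E (\<lambda>\<omega>. real_of_ereal (E (\<lambda>\<omega>'. \<phi> (\<lambda>i. if i < m then X (Suc i) \<omega> else X (Suc m) \<omega>'))))"
proof (cases "m = 0")
  \<comment> \<open>\<open>independent_seq\<close> starts with the independence of X 2 to X 1 and
    says nothing for m = 0. There the inner expectation is a constant, and only its finiteness has
    to be checked.\<close>
  case True
  have "(\<lambda>\<omega>. \<phi> (\<lambda>i. X (Suc i) \<omega>)) = (\<lambda>\<omega>. \<phi> (\<lambda>i. X (Suc 0) \<omega>))"
    using True by (intro ext lip_cong[OF \<phi>]) auto
  moreover have "E (\<lambda>\<omega>. \<phi> (\<lambda>i. X (Suc 0) \<omega>))
      = ereal (real_of_ereal (E (\<lambda>\<omega>. \<phi> (\<lambda>i. X (Suc 0) \<omega>))))"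
    using integ_real[OF lip_fiber_integ[OF \<phi> X_integ[of "Suc m"], of "\<lambda>_. 0"]] True by simp
  ultimately show ?thesis using True by (simp add: E_const)
next
  case False
  let ?Y = "X (Suc m)"
  have ind: "independent_to H E 1 (\<lambda>j. ?Y) m (\<lambda>j. X (j + 1))"
    using X_indep False unfolding independent_seq_def by simp
  \<comment> \<open>The fibre lemma is also applied to |\<phi>|; it supplies the membership in
    \<open>H\<close> of the variable called \<open>\<phi>barX\<close> in
    \<open>independent_to\<close>.\<close>
  have lipabs: "lip (Suc m) (\<lambda>x. \<bar>\<phi> x\<bar>)"
    by (rule lip_comp[OF _ \<phi>, of 1]) (auto intro!: lipschitz_onI simp: dist_real_def)
  have app: "vec_append m x (\<lambda>i. ?Y \<omega>) = (\<lambda>i. if i < m then x i else ?Y \<omega>)" for x \<omega>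
    by (auto simp: vec_append_def)
  have fin: "E (\<lambda>\<omega>. \<bar>\<phi> (\<lambda>i. if i < m then x i else ?Y \<omega>)\<bar>) < \<infinity>" for x
    using lip_fiber_integ[OF \<phi> X_integ[of "Suc m"], of x] by (simp add: integ_def)
  note l = lip_fiber[OF \<phi> X_integ[of "Suc m"]] lip_fiber[OF lipabs X_integ[of "Suc m"]]
  have HX: "integ (\<lambda>\<omega>. \<psi> (\<lambda>i. X (Suc i) \<omega>))" if "lip m \<psi>" for \<psi>
    using lip_integ[OF that, of "\<lambda>i. X (Suc i)"] X_integ by simp
  have "E (\<lambda>\<omega>. \<phi> (vec_append m (\<lambda>i. X (i + 1) \<omega>) (\<lambda>i. ?Y \<omega>)))
      = E (\<lambda>\<omega>. real_of_ereal (E (\<lambda>\<omega>'. \<phi> (vec_append m (\<lambda>i. X (i + 1) \<omega>) (\<lambda>i. ?Y \<omega>')))))"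
    using ind lip_C_lLip[OF \<phi>] HX[OF l(1)] HX[OF l(2)] fin
    unfolding independent_to_def Let_def by (simp add: app integ_def)
  moreover have "\<phi> (vec_append m (\<lambda>i. X (i + 1) \<omega>) (\<lambda>i. ?Y \<omega>)) = \<phi> (\<lambda>i. X (Suc i) \<omega>)" for \<omega>
    by (rule lip_cong[OF \<phi>]) (auto simp: vec_append_def less_Suc_eq)
  ultimately show ?thesis by (simp add: app)
qed

text \<open>This takes the place of conditioning: a bound on the expectation over the last variable,
  valid for every frozen past, survives substitution of the random past.\<close>

lemma E_independent_le:
  assumes \<phi>: "lip (Suc m) \<phi>" and w: "lip m w"
    and le: "\<And>x. E (\<lambda>\<omega>. \<phi> (\<lambda>i. if i < m then x i else X (Suc m) \<omega>)) \<le> ereal (w x)"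
  shows "E (\<lambda>\<omega>. \<phi> (\<lambda>i. X (Suc i) \<omega>)) \<le> E (\<lambda>\<omega>. w (\<lambda>i. X (Suc i) \<omega>))"
proof -
  have "real_of_ereal (E (\<lambda>\<omega>. \<phi> (\<lambda>i. if i < m then x i else X (Suc m) \<omega>))) \<le> w x" for x
    using le[of x] by (subst (asm) integ_real[OF lip_fiber_integ[OF \<phi> X_integ]]) simp_all
  then show ?thesis
    unfolding E_independent[OF \<phi>]
    using lip_H[OF lip_fiber[OF \<phi> X_integ[of "Suc m"]], of "\<lambda>i. X (Suc i)"]
      lip_H[OF w, of "\<lambda>i. X (Suc i)"] X_H
    by (intro E_mono) auto
qed

text \<open>Independence restores additivity on sums: for a frozen past the sum is the last variable
  plus a constant. Thus the centring in \<open>dev_upper\<close> is the sum of the means.\<close>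

lemma E_S_part: "E (S_part X n) = ereal (\<Sum>i=1..n. real_of_ereal (E (X i)))"
proof (induction n)
  case 0
  show ?case by (simp add: S_part_def E_const)
next
  case (Suc n)
  let ?e = "real_of_ereal (E (X (Suc n)))"
  have S: "S_part X k \<omega> = (\<Sum>i<k. X (Suc i) \<omega>)" for k \<omega>
    unfolding S_part_def by (simp add: sum.atLeast1_atMost_eq)
  have SH: "S_part X n \<in> H"
    unfolding S_part_def by (intro sum_H X_H) auto
  have fib: "E (\<lambda>\<omega>. \<Sum>i<Suc n. (if i < n then x i else X (Suc n) \<omega>)) = ereal ((\<Sum>i<n. x i) + ?e)"
    for x :: "nat \<Rightarrow> real"
  proof -
    have "E (\<lambda>\<omega>. \<Sum>i<Suc n. (if i < n then x i else X (Suc n) \<omega>))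
        = E (\<lambda>\<omega>. X (Suc n) \<omega> + (\<Sum>i<n. x i))" by (simp add: add.commute)
    also have "\<dots> = ereal ?e + ereal (\<Sum>i<n. x i)"
      using integ_real[OF X_integ[of "Suc n"]] by (simp add: E_add_const X_H)
    finally show ?thesis by (simp add: add.commute)
  qed
  have "lip (Suc n) (\<lambda>x. \<Sum>i<Suc n. x i)" by (intro lip_sum lip_coord) auto
  from E_independent[OF this]
  have "E (S_part X (Suc n)) = E (\<lambda>\<omega>. (\<Sum>i<n. X (Suc i) \<omega>) + ?e)"
    unfolding fib by (simp add: S[abs_def])
  also have "\<dots> = E (S_part X n) + ereal ?e"
    using E_add_const[OF SH, of ?e] by (simp add: S[abs_def])
  finally show ?case using Suc.IH by simp
qed

end

section \<open>A maximal inequality\<close>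

definition run_prod :: "real \<Rightarrow> (nat \<Rightarrow> real \<Rightarrow> real) \<Rightarrow> nat \<Rightarrow> (nat \<Rightarrow> real) \<Rightarrow> real" where
  "run_prod c z m x = c * (\<Prod>i<m. z i (x i))"

primrec run_max :: "real \<Rightarrow> (nat \<Rightarrow> real \<Rightarrow> real) \<Rightarrow> nat \<Rightarrow> (nat \<Rightarrow> real) \<Rightarrow> real" where
  "run_max c z 0 x = c"
| "run_max c z (Suc m) x = max (run_max c z m x) (run_prod c z (Suc m) x)"

text \<open>
  An Azema-Yor process: with the running maximum \<open>L\<close> of \<open>R = run_prod c z\<close>, the concave
  function \<open>F u = 4 u / (1 + u)\<close> and \<open>f = F'\<close>, it starts at \<open>F c\<close>, has the increments
  \<open>f L dR\<close>, and stays above \<open>F L - f L (L - R)\<close>, which is at least 1 once \<open>L \<ge> 1\<close>.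
\<close>

primrec azema_yor :: "real \<Rightarrow> (nat \<Rightarrow> real \<Rightarrow> real) \<Rightarrow> nat \<Rightarrow> (nat \<Rightarrow> real) \<Rightarrow> real" where
  "azema_yor c z 0 x = 4 * c / (1 + c)"
| "azema_yor c z (Suc m) x = azema_yor c z m x
    + (4 * (1 / (1 + max 0 (run_max c z m x)))\<^sup>2 * run_prod c z m x) * (z m (x m) - 1)"

lemma run_prod_nonneg:
  assumes "0 < c" "\<And>i u. 0 \<le> z i u"
  shows "0 \<le> run_prod c z m x"
  unfolding run_prod_def using assms by (intro mult_nonneg_nonneg prod_nonneg) auto

lemma run_max_pos:
  assumes "0 < c"
  shows "0 < run_max c z m x"
  using assms by (induction m) auto

lemma run_prod_le_run_max:
  assumes "i \<le> m"
  shows "run_prod c z i x \<le> run_max c z m x"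
  using assms
proof (induction m)
  case 0
  then show ?case by (simp add: run_prod_def)
next
  case (Suc m)
  then show ?case by (cases "i = Suc m") (auto simp: le_Suc_eq)
qed

text \<open>For F(u) = 4u/(1+u), the first identity is the chord formula of F, and the second
  evaluates F(u) - u F'(u). The latter is at least 1 exactly from u = 1 on, which is the origin of
  the constant 4.\<close>

lemma chord_of_concave:
  fixes u v :: real
  assumes "0 < u" "0 < v"
  shows "4 * v / (1 + v) = 4 * u / (1 + u) + 4 * (v - u) / ((1 + u) * (1 + v))"
    and "4 * u / (1 + u) - 4 / (1 + u)\<^sup>2 * u = (2 * u / (1 + u))\<^sup>2"
proof -
  define a b where "a = 1 + u" and "b = 1 + v"
  then have ab: "0 < a" "0 < b" "u = a - 1" "v = b - 1" using assms by auto
  show "4 * v / (1 + v) = 4 * u / (1 + u) + 4 * (v - u) / ((1 + u) * (1 + v))"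
    using ab(1,2) unfolding ab(3,4) by (simp add: field_simps)
  show "4 * u / (1 + u) - 4 / (1 + u)\<^sup>2 * u = (2 * u / (1 + u))\<^sup>2"
    using ab(1,2) unfolding ab(3,4) by (simp add: field_simps power2_eq_square)
qed

text \<open>Between records both sides change by the same amount, the slope at L times the increment
  of R. At a record L jumps up to R, and by concavity F rises by at most the slope at the old record
  times the jump.\<close>

lemma azema_yor_lower:
  assumes c: "0 < c" and z: "\<And>i u. 0 \<le> z i u"
  defines "L \<equiv> run_max c z" and "R \<equiv> run_prod c z"
  shows "4 * L m x / (1 + L m x) - 4 / (1 + L m x)\<^sup>2 * (L m x - R m x) \<le> azema_yor c z m x"
proof (induction m)
  case 0
  show ?case by (simp add: L_def R_def run_prod_def)
next
  case (Suc m)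
  have L: "0 < L m x" unfolding L_def by (rule run_max_pos[OF c])
  have R: "R m x \<le> L m x" unfolding L_def R_def by (rule run_prod_le_run_max) simp
  have RS: "R (Suc m) x = R m x * z m (x m)" by (simp add: R_def run_prod_def)
  have LS: "L (Suc m) x = max (L m x) (R (Suc m) x)" by (simp add: L_def R_def)
  define f where "f = 4 / (1 + L m x)\<^sup>2"
  have step: "azema_yor c z (Suc m) x = azema_yor c z m x + f * (R (Suc m) x - R m x)"
    using L by (simp add: L_def[symmetric] R_def[symmetric] RS f_def power_divide algebra_simps)
  have base: "4 * L m x / (1 + L m x) - f * (L m x - R (Suc m) x) \<le> azema_yor c z (Suc m) x"
    using Suc.IH unfolding step f_def[symmetric] by (simp add: algebra_simps)
  show ?case
  proof (cases "R (Suc m) x \<le> L m x")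
    case True
    then have "L (Suc m) x = L m x" using LS by simp
    with base show ?thesis by (simp add: f_def)
  next
    case False
    let ?u = "L m x" and ?v = "R (Suc m) x"
    have v: "?u < ?v" using False by simp
    have "4 * ?v / (1 + ?v) = 4 * ?u / (1 + ?u) + 4 * (?v - ?u) / ((1 + ?u) * (1 + ?v))"
      using L v by (intro chord_of_concave) auto
    also have "4 * (?v - ?u) / ((1 + ?u) * (1 + ?v)) \<le> 4 * (?v - ?u) / ((1 + ?u) * (1 + ?u))"
      using L v by (intro divide_left_mono mult_left_mono mult_pos_pos) auto
    also have "\<dots> = f * (?v - ?u)" by (simp add: f_def power2_eq_square)
    finally have "4 * ?v / (1 + ?v) \<le> 4 * ?u / (1 + ?u) - f * (?u - ?v)"
      by (simp add: algebra_simps)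
    with base LS v show ?thesis by simp
  qed
qed

lemma azema_yor_ge_indicator:
  assumes c: "0 < c" and z: "\<And>i u. 0 \<le> z i u"
  shows "0 \<le> azema_yor c z m x"
    and "1 \<le> run_max c z m x \<Longrightarrow> 1 \<le> azema_yor c z m x"
proof -
  let ?L = "run_max c z m x" and ?R = "run_prod c z m x"
  have L: "0 < ?L" by (rule run_max_pos[OF c])
  have R: "0 \<le> ?R" by (rule run_prod_nonneg[OF c z])
  \<comment> \<open>Replacing R by 0 only lowers the bound, and what remains is the square in
    \<open>chord_of_concave\<close>.\<close>
  have "4 / (1 + ?L)\<^sup>2 * (?L - ?R) \<le> 4 / (1 + ?L)\<^sup>2 * ?L"
    using L R by (intro mult_left_mono) auto
  moreover have "4 * ?L / (1 + ?L) - 4 / (1 + ?L)\<^sup>2 * ?L = (2 * ?L / (1 + ?L))\<^sup>2"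
    using L by (intro chord_of_concave) auto
  ultimately have ge: "(2 * ?L / (1 + ?L))\<^sup>2 \<le> azema_yor c z m x"
    using azema_yor_lower[of c z m x, OF c z] by linarith
  then show "0 \<le> azema_yor c z m x" by (meson order_trans zero_le_power2)
  assume "1 \<le> ?L"
  then have "1 \<le> (2 * ?L / (1 + ?L))\<^sup>2" by (intro one_le_power) (auto simp: field_simps)
  with ge show "1 \<le> azema_yor c z m x" by linarith
qed

lemma blip_azema_yor:
  assumes c: "0 < c" and lz: "\<And>i. \<exists>C. C-lipschitz_on UNIV (z i)"
    and bz: "\<And>i. \<exists>K. \<forall>u. \<bar>z i u\<bar> \<le> K"
  shows "blip m (run_prod c z m)" "blip m (run_max c z m)"
    "blip m (\<lambda>x. 4 * (1 / (1 + max 0 (run_max c z m x)))\<^sup>2 * run_prod c z m x)"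
    "blip m (azema_yor c z m)"
proof -
  have z: "blip (Suc i) (\<lambda>x. z i (x i))" for i
    using lz[of i] bz[of i] by (metis blip_comp_lip lip_coord lessI)
  have prod: "blip m (run_prod c z m)" for m
  proof (induction m)
    case 0
    show ?case by (simp add: run_prod_def[abs_def] blip_const)
  next
    case (Suc m)
    have "blip (Suc m) (\<lambda>x. run_prod c z m x * z m (x m))"
      by (intro blip_mult z blip_mono[OF Suc.IH]) simp
    then show ?case by (simp add: run_prod_def[abs_def] mult.assoc)
  qed
  have max: "blip m (run_max c z m)" for m
  proof (induction m)
    case 0
    show ?case by (simp add: blip_const)
  next
    case (Suc m)
    have "blip (Suc m) (\<lambda>x. max (run_max c z m x) (run_prod c z (Suc m) x))"
      by (intro blip_max prod blip_mono[OF Suc.IH]) simp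
    then show ?case by simp
  qed
  \<comment> \<open>The \<open>max 0\<close> in \<open>azema_yor\<close> changes no value, as the
    running maximum is positive, but it makes this function Lipschitz on the whole line.\<close>
  have inv: "1-lipschitz_on UNIV (\<lambda>u::real. 1 / (1 + max 0 u))"
  proof (rule lipschitz_onI)
    fix u v :: real
    have "\<bar>1 / (1 + max 0 u) - 1 / (1 + max 0 v)\<bar>
        = \<bar>max 0 v - max 0 u\<bar> / ((1 + max 0 u) * (1 + max 0 v))"
      by (simp add: diff_frac_eq abs_mult)
    also have "\<dots> \<le> \<bar>max 0 v - max 0 u\<bar> / 1"
      by (intro divide_left_mono) (auto intro: order_trans[OF _ mult_mono[of 1 _ 1]])
    also have "\<dots> \<le> \<bar>u - v\<bar>" by auto
    finally show "dist (1 / (1 + max 0 u)) (1 / (1 + max 0 v)) \<le> 1 * dist u v"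
      by (simp add: dist_real_def)
  qed simp
  have bd: "\<bar>1 / (1 + max 0 u)\<bar> \<le> 1" for u :: real by (simp add: max_def)
  have coef: "blip m (\<lambda>x. 4 * (1 / (1 + max 0 (run_max c z m x)))\<^sup>2 * run_prod c z m x)" for m
    unfolding power2_eq_square
    by (intro blip_mult blip_const prod blip_comp_lip[OF inv bd])
      (use max in \<open>auto simp: blip_def\<close>)
  show "blip m (azema_yor c z m)"
  proof (induction m)
    case 0
    show ?case by (simp add: blip_const)
  next
    case (Suc m)
    have "blip (Suc m) (\<lambda>x. azema_yor c z m x
        + (4 * (1 / (1 + max 0 (run_max c z m x)))\<^sup>2 * run_prod c z m x) * (z m (x m) + (- 1)))"
      by (intro blip_add blip_mult[OF blip_mono[OF coef]] blip_mono[OF Suc.IH] z blip_const) auto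
    then show ?case by simp
  qed
  show "blip m (run_prod c z m)" "blip m (run_max c z m)"
    "blip m (\<lambda>x. 4 * (1 / (1 + max 0 (run_max c z m x)))\<^sup>2 * run_prod c z m x)"
    by (rule prod max coef)+
qed

context independent_sequence
begin

text \<open>\<open>W N\<close> dominates the indicator of the event, its expectation does not
  increase with the time, and it starts at 4c/(1+c) \<le> 4c. The price for avoiding a stopping time
  is the factor 4.\<close>

lemma maximal_inequality:
  assumes c: "0 < c" and z: "\<And>i u. 0 \<le> z i u"
    and lz: "\<And>i. \<exists>C. C-lipschitz_on UNIV (z i)"
    and bz: "\<And>i. \<exists>K. \<forall>u. \<bar>z i u\<bar> \<le> K"
    and Ez: "\<And>i. E (\<lambda>\<omega>. z i (X (Suc i) \<omega>)) \<le> 1"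
  shows "V_hat M H E {\<omega> \<in> space M. \<exists>m\<le>N. 1 \<le> c * (\<Prod>i<m. z i (X (Suc i) \<omega>))} \<le> ereal (4 * c)"
proof -
  note bl = blip_azema_yor[of c z, OF c lz bz]
  have lipW: "lip m (azema_yor c z m)" for m using bl(4)[of m] by (simp add: blip_def)
  define W where "W m = (\<lambda>\<omega>. azema_yor c z m (\<lambda>i. X (Suc i) \<omega>))" for m
  have WH: "W m \<in> H" for m
    unfolding W_def using lip_H[OF lipW, of m "\<lambda>i. X (Suc i)"] X_H by simp
  have EW: "E (W m) \<le> ereal (4 * c)" for m
  proof (induction m)
    case 0
    have "4 * c / (1 + c) \<le> 4 * c / 1" using c by (intro divide_left_mono) auto
    then show ?case by (simp add: W_def E_const)
  next
    case (Suc m)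
    have "E (W (Suc m)) \<le> E (W m)"
      unfolding W_def
    proof (rule E_independent_le[OF lipW lipW])
      fix x :: "nat \<Rightarrow> real"
      define k where "k = 4 * (1 / (1 + max 0 (run_max c z m x)))\<^sup>2 * run_prod c z m x"
      have k: "0 \<le> k" unfolding k_def using run_prod_nonneg[of c z m x, OF c z] by simp
      let ?x = "\<lambda>\<omega> i. if i < m then x i else X (Suc m) \<omega>"
      have eq: "g (?x \<omega>) = g x" if "blip m g" for \<omega> g
        using that by (intro lip_cong[of m g]) (auto simp: blip_def)
      have "azema_yor c z (Suc m) (?x \<omega>) = azema_yor c z m x + k * (z m (X (Suc m) \<omega>) - 1)" for \<omega>
        using eq[OF bl(3)[of m]] eq[OF bl(4)[of m]] unfolding k_def by simp
      \<comment> \<open>For a frozen past the new value is affine in the last factor, with slope k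
        \<ge> 0, so its expectation is at most the value for a factor equal to 1.\<close>
      then have rw: "(\<lambda>\<omega>. azema_yor c z (Suc m) (?x \<omega>))
          = (\<lambda>\<omega>. k * z m (X (Suc m) \<omega>) + (azema_yor c z m x - k))"
        by (auto simp: algebra_simps)
      obtain C where "C-lipschitz_on UNIV (z m)" using lz by blast
      then have zH: "(\<lambda>\<omega>. z m (X (Suc m) \<omega>)) \<in> H" by (rule lipschitz_H) (simp add: X_H)
      have "E (\<lambda>\<omega>. k * z m (X (Suc m) \<omega>)) \<le> ereal (k * 1)"
        using Ez[of m] k zH by (intro E_scale_le) (auto simp: one_ereal_def)
      then have "E (\<lambda>\<omega>. k * z m (X (Suc m) \<omega>)) + ereal (azema_yor c z m x - k)
          \<le> ereal (k * 1) + ereal (azema_yor c z m x - k)" by (rule add_right_mono)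
      then show "E (\<lambda>\<omega>. azema_yor c z (Suc m) (?x \<omega>)) \<le> ereal (azema_yor c z m x)"
        unfolding rw by (subst E_add_const[OF H_scale[OF zH]]) simp
    qed
    with Suc.IH show ?case by simp
  qed
  have "V_hat M H E {\<omega> \<in> space M. \<exists>m\<le>N. 1 \<le> c * (\<Prod>i<m. z i (X (Suc i) \<omega>))} \<le> E (W N)"
  proof (rule V_hat_le[OF WH])
    fix \<omega>
    note ge = azema_yor_ge_indicator[of c z N "\<lambda>i. X (Suc i) \<omega>", OF c z]
    have "1 \<le> W N \<omega>" if "m \<le> N" "1 \<le> c * (\<Prod>i<m. z i (X (Suc i) \<omega>))" for m
      using ge(2) run_prod_le_run_max[OF that(1), of c z "\<lambda>i. X (Suc i) \<omega>"] that(2)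
      by (simp add: run_prod_def W_def)
    then show "indicator {\<omega> \<in> space M. \<exists>m\<le>N. 1 \<le> c * (\<Prod>i<m. z i (X (Suc i) \<omega>))} \<omega> \<le> W N \<omega>"
      using ge(1) by (auto simp: indicator_def W_def)
  qed
  also have "\<dots> \<le> ereal (4 * c)" by (rule EW)
  finally show ?thesis .
qed

end

section \<open>Exponential bounds for truncated partial sums\<close>

lemma exp_diff_le:
  fixes a b K :: real
  assumes "a \<le> K" "b \<le> K"
  shows "\<bar>exp a - exp b\<bar> \<le> exp K * \<bar>a - b\<bar>"
proof -
  have one: "exp a - exp b \<le> exp K * (a - b)" if "b \<le> a" "a \<le> K" for a b :: real
  proof -
    have "exp a - exp b = exp a * (1 - exp (b - a))" by (simp add: algebra_simps exp_diff)
    also have "\<dots> \<le> exp a * (a - b)"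
    proof (rule mult_left_mono)
      show "1 - exp (b - a) \<le> a - b" using exp_ge_add_one_self[of "b - a"] by linarith
    qed simp
    also have "\<dots> \<le> exp K * (a - b)" using that by (intro mult_right_mono) auto
    finally show ?thesis .
  qed
  show ?thesis
    using one[of a b] one[of b a] assms by (cases "b \<le> a") (auto simp: abs_if)
qed

lemma lipschitz_exp_min:
  assumes "0 \<le> h"
  shows "(h * exp (h * y + d))-lipschitz_on UNIV (\<lambda>u::real. exp (h * min u y + d))"
proof (rule lipschitz_onI)
  fix u v :: real
  have "\<bar>exp (h * min u y + d) - exp (h * min v y + d)\<bar>
      \<le> exp (h * y + d) * \<bar>h * min u y + d - (h * min v y + d)\<bar>"
    using assms by (intro exp_diff_le) (auto intro!: mult_left_mono)
  also have "\<bar>h * min u y + d - (h * min v y + d)\<bar> = h * \<bar>min u y - min v y\<bar>"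
    using assms by (simp add: right_diff_distrib[symmetric] abs_mult)
  also have "exp (h * y + d) * (h * \<bar>min u y - min v y\<bar>) \<le> exp (h * y + d) * (h * \<bar>u - v\<bar>)"
    using assms by (intro mult_left_mono) auto
  finally show "dist (exp (h * min u y + d)) (exp (h * min v y + d))
      \<le> h * exp (h * y + d) * dist u v"
    by (simp add: dist_real_def mult.assoc mult.left_commute)
qed (use assms in simp)

text \<open>On the range [0, a] of the truncated variable the p-th power has slope at most p *
  a^(p-1). This puts the variables of \<open>Gam\<close> and \<open>Lam\<close> into
  \<open>H\<close>.\<close>

lemma lipschitz_trunc_powr:
  assumes a: "0 \<le> a" and b: "0 \<le> b" and p: "1 \<le> p"
  shows "(p * a powr (p - 1))-lipschitz_on UNIV (\<lambda>u::real. (max (min \<bar>u\<bar> a - b) 0) powr p)"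
proof -
  define g where "g u = max (min \<bar>u\<bar> a - b) 0" for u :: real
  have g: "0 \<le> g u" "g u \<le> a" for u using a b by (auto simp: g_def)
  have gl: "g u - g v \<le> \<bar>u - v\<bar>" for u v
  proof -
    have "max r 0 - max t 0 \<le> \<bar>r - t\<bar>" "\<bar>min r a - min t a\<bar> \<le> \<bar>r - t\<bar>" for r t :: real
      by linarith+
    note le = this
    have "g u - g v \<le> \<bar>min \<bar>u\<bar> a - b - (min \<bar>v\<bar> a - b)\<bar>" unfolding g_def by (rule le(1))
    also have "\<dots> = \<bar>min \<bar>u\<bar> a - min \<bar>v\<bar> a\<bar>" by (simp only: diff_diff_eq2 diff_add_cancel)
    also have "\<dots> \<le> \<bar>\<bar>u\<bar> - \<bar>v\<bar>\<bar>" by (rule le(2))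
    also have "\<dots> \<le> \<bar>u - v\<bar>" by (rule abs_triangle_ineq3)
    finally show ?thesis .
  qed
  have one: "\<bar>g u powr p - g v powr p\<bar> \<le> p * a powr (p - 1) * \<bar>u - v\<bar>" if "g v \<le> g u" for u v
  proof -
    have "g u powr p - g v powr p \<le> p * g u powr (p - 1) * (g u - g v)"
      using that g p by (intro powr_diff_le) auto
    also have "\<dots> \<le> p * a powr (p - 1) * \<bar>u - v\<bar>"
      using that g p by (intro mult_mono gl mult_left_mono powr_mono2) auto
    finally show ?thesis
      using powr_mono2[OF _ g(1) that, of p] p by simp
  qed
  have "dist (g u powr p) (g v powr p) \<le> p * a powr (p - 1) * dist u v" for u v
    using one[of u v] one[of v u] linear[of "g u" "g v"]
    by (auto simp: dist_real_def abs_minus_commute)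
  then have "(p * a powr (p - 1))-lipschitz_on UNIV (\<lambda>u. g u powr p)"
    using p by (intro lipschitz_onI) auto
  then show ?thesis by (simp only: g_def)
qed

text \<open>The first bound splits at 2b. Below it the quadratic estimate costs exp(2hb). Above it
  min(|x|, a) exceeds 2b, so that at least b remains after subtracting b' \<le> b; then the p-th
  power of the excess divided by b^p is at least 1 and pays for the largest possible value exp(hy).
  The second bound is the quadratic estimate alone.\<close>

lemma exp_truncated_le:
  fixes h x y b :: real
  assumes h: "0 \<le> h" and yi: "0 \<le> yi" "yi \<le> y" "yi \<le> a" and b: "0 < b" "b' \<le> b" and p: "0 \<le> p"
  shows "exp (h * min x yi) \<le> 1 + h * x + h\<^sup>2 * exp (2 * h * b) / 2 * x\<^sup>2
    + exp (h * y) / b powr p * (max (min \<bar>x\<bar> a - b') 0) powr p"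
    and "exp (h * min x yi) \<le> 1 + h * x + h\<^sup>2 * exp (h * y) / 2 * x\<^sup>2"
proof -
  let ?Y = "min x yi"
  have sq: "?Y\<^sup>2 \<le> x\<^sup>2"
    using yi by (auto simp: min_def intro!: power_mono)
  have lin: "h * ?Y \<le> h * x" using h by (intro mult_left_mono) auto
  have quad: "exp (h * ?Y) \<le> 1 + h * x + h\<^sup>2 * exp v / 2 * x\<^sup>2" if "h * ?Y \<le> v" "0 \<le> v" for v
  proof -
    have "exp (h * ?Y) \<le> 1 + h * ?Y + (h * ?Y)\<^sup>2 / 2 * exp v"
      by (rule exp_le_quadratic[OF that])
    also have "(h * ?Y)\<^sup>2 / 2 * exp v = (h\<^sup>2 * exp v / 2) * ?Y\<^sup>2" by (simp add: power_mult_distrib)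
    also have "\<dots> \<le> (h\<^sup>2 * exp v / 2) * x\<^sup>2" using sq by (intro mult_left_mono) auto
    finally show ?thesis using lin by linarith
  qed
  show "exp (h * ?Y) \<le> 1 + h * x + h\<^sup>2 * exp (h * y) / 2 * x\<^sup>2"
    using h yi by (intro quad mult_left_mono mult_nonneg_nonneg) auto
  let ?r = "exp (h * y) / b powr p * (max (min \<bar>x\<bar> a - b') 0) powr p"
  have r0: "0 \<le> ?r" by simp
  show "exp (h * ?Y) \<le> 1 + h * x + h\<^sup>2 * exp (2 * h * b) / 2 * x\<^sup>2 + ?r"
  proof (cases "?Y \<le> 2 * b")
    case True
    then have "h * ?Y \<le> 2 * h * b" using h mult_left_mono[OF True h] by (simp add: mult.left_commute)
    then have "exp (h * ?Y) \<le> 1 + h * x + h\<^sup>2 * exp (2 * h * b) / 2 * x\<^sup>2"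
      using h b by (intro quad) auto
    with r0 show ?thesis by linarith
  next
    case False
    then have big: "b \<le> max (min \<bar>x\<bar> a - b') 0" using yi b by (auto simp: min_def max_def split: if_splits)
    have "exp (h * ?Y) \<le> exp (h * y)" using h yi by (auto intro!: mult_left_mono)
    also have "\<dots> = exp (h * y) / b powr p * b powr p" using b by simp
    also have "\<dots> \<le> ?r" using big b p by (intro mult_left_mono powr_mono2) auto
    finally have "exp (h * ?Y) \<le> ?r" .
    moreover have "0 \<le> h * x"
      using False h b by (intro mult_nonneg_nonneg) (auto simp: min_def split: if_splits)
    moreover have "0 \<le> h\<^sup>2 * exp (2 * h * b) / 2 * x\<^sup>2" by simp
    ultimately show ?thesis by linarith
  qed
qed

context sublinear_expectation_space
begin

lemma V_hat_mono:
  assumes "A \<subseteq> B"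
  shows "V_hat M H E A \<le> V_hat M H E B"
  unfolding V_hat_def
proof (rule Inf_superset_mono, clarify)
  fix \<xi> assume "\<xi> \<in> H" "\<forall>\<omega>\<in>space M. indicator B \<omega> \<le> \<xi> \<omega>"
  moreover have "indicator A \<omega> \<le> (indicator B \<omega> :: real)" for \<omega>
    using assms by (auto simp: indicator_def)
  ultimately show "\<exists>\<xi>'. E \<xi> = E \<xi>' \<and> \<xi>' \<in> H \<and> (\<forall>\<omega>\<in>space M. indicator A \<omega> \<le> \<xi>' \<omega>)"
    by (intro exI[of _ \<xi>] conjI ballI refl) (auto intro: order_trans)
qed

end

context independent_sequence
begin

definition mean :: "nat \<Rightarrow> real" where "mean i = real_of_ereal (E (X i))"

definition trunc_sum :: "(nat \<Rightarrow> real) \<Rightarrow> nat \<Rightarrow> 'a \<Rightarrow> real" where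
  "trunc_sum y m \<omega> = (\<Sum>i=1..m. min (X i \<omega>) (y i))"

lemma E_X: "1 \<le> i \<Longrightarrow> E (X i) = ereal (mean i)"
  unfolding mean_def using integ_real X_integ by blast

lemma deviation_inequality:
  assumes h: "0 < h" and \<kappa>: "\<And>i. 1 \<le> i \<Longrightarrow> i \<le> N \<Longrightarrow> 0 \<le> \<kappa> i"
    and Ee: "\<And>i. 1 \<le> i \<Longrightarrow> i \<le> N \<Longrightarrow>
      E (\<lambda>\<omega>. exp (h * min (X i \<omega>) (y i))) \<le> ereal (1 + h * mean i + \<kappa> i)"
  shows "V_hat M H E {\<omega> \<in> space M. \<exists>m\<le>N. x < trunc_sum y m \<omega> - (\<Sum>i=1..m. mean i)}
    \<le> ereal (4 * exp (- h * x + (\<Sum>i=1..N. \<kappa> i)))"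
proof -
  \<comment> \<open>With this normalisation each factor has expectation at most 1, because 1 + h *
    mean + \<kappa> \<le> exp(h * mean + \<kappa>).\<close>
  define d where "d i = - h * mean (Suc i) - \<kappa> (Suc i)" for i
  \<comment> \<open>The factor is 1 beyond N, because \<open>maximal_inequality\<close> asks for all
    i while the moment bound is given up to N only. Times m \<le> N never meet those
    factors.\<close>
  define z where "z i u = (if i < N then exp (h * min u (y (Suc i)) + d i) else 1)" for i u
  define c where "c = exp (- h * x + (\<Sum>i=1..N. \<kappa> i))"
  have z0: "0 \<le> z i u" for i u by (simp add: z_def)
  have lz: "\<exists>C. C-lipschitz_on UNIV (z i)" for i
  proof (cases "i < N")
    case True
    then show ?thesis
      using lipschitz_exp_min[of h "y (Suc i)" "d i"] h by (auto simp: z_def[abs_def])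
  next
    case False
    then show ?thesis
      by (intro exI[of _ 0]) (auto simp: z_def[abs_def] intro!: lipschitz_onI)
  qed
  have bz: "\<exists>K. \<forall>u. \<bar>z i u\<bar> \<le> K" for i
  proof (intro exI[of _ "max 1 (exp (h * y (Suc i) + d i))"] allI)
    fix u
    have "h * min u (y (Suc i)) \<le> h * y (Suc i)" using h by (intro mult_left_mono) auto
    then have "exp (h * min u (y (Suc i)) + d i) \<le> exp (h * y (Suc i) + d i)" by simp
    then show "\<bar>z i u\<bar> \<le> max 1 (exp (h * y (Suc i) + d i))"
      by (cases "i < N") (auto simp: z_def intro: max.coboundedI2)
  qed
  have Ez: "E (\<lambda>\<omega>. z i (X (Suc i) \<omega>)) \<le> 1" for i
  proof (cases "i < N")
    case True
    let ?U = "\<lambda>\<omega>. exp (h * min (X (Suc i) \<omega>) (y (Suc i)))"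
    have UH: "?U \<in> H"
      using lipschitz_H[OF lipschitz_exp_min[of h "y (Suc i)" 0] X_H[of "Suc i"]] h by simp
    have "exp (d i) * (1 + h * mean (Suc i) + \<kappa> (Suc i)) \<le> exp (d i) * exp (- d i)"
    proof (rule mult_left_mono)
      show "1 + h * mean (Suc i) + \<kappa> (Suc i) \<le> exp (- d i)"
        using exp_ge_add_one_self[of "- d i"] unfolding d_def by linarith
    qed simp
    also have "\<dots> = 1" by (simp only: exp_add[symmetric] add.right_inverse exp_zero)
    finally have le: "ereal (exp (d i) * (1 + h * mean (Suc i) + \<kappa> (Suc i))) \<le> 1"
      by (simp only: one_ereal_def ereal_less_eq)
    have "E (\<lambda>\<omega>. exp (d i) * ?U \<omega>) \<le> ereal (exp (d i) * (1 + h * mean (Suc i) + \<kappa> (Suc i)))"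
      using Ee[of "Suc i"] True by (intro E_scale_le[OF UH]) auto
    moreover have "(\<lambda>\<omega>. exp (d i) * ?U \<omega>) = (\<lambda>\<omega>. z i (X (Suc i) \<omega>))"
      unfolding z_def using True by (simp only: if_True exp_add[symmetric] add.commute)
    ultimately show ?thesis using order_trans[OF _ le] by simp
  next
    case False
    then show ?thesis by (simp add: z_def E_const one_ereal_def)
  qed
  have "V_hat M H E {\<omega> \<in> space M. \<exists>m\<le>N. x < trunc_sum y m \<omega> - (\<Sum>i=1..m. mean i)}
      \<le> V_hat M H E {\<omega> \<in> space M. \<exists>m\<le>N. 1 \<le> c * (\<Prod>i<m. z i (X (Suc i) \<omega>))}"
  proof (rule V_hat_mono, clarify)
    fix \<omega> m assume \<omega>: "\<omega> \<in> space M" "m \<le> N" "x < trunc_sum y m \<omega> - (\<Sum>i=1..m. mean i)"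
    have "(\<Prod>i<m. z i (X (Suc i) \<omega>)) = exp (\<Sum>i<m. h * min (X (Suc i) \<omega>) (y (Suc i)) + d i)"
      unfolding exp_sum[OF finite_lessThan] using \<omega>(2) by (intro prod.cong) (auto simp: z_def)
    also have "(\<Sum>i<m. h * min (X (Suc i) \<omega>) (y (Suc i)) + d i)
        = h * (trunc_sum y m \<omega> - (\<Sum>i=1..m. mean i)) - (\<Sum>i=1..m. \<kappa> i)"
      by (induction m) (simp_all add: trunc_sum_def d_def algebra_simps)
    finally have "c * (\<Prod>i<m. z i (X (Suc i) \<omega>))
        = exp ((- h * x + (\<Sum>i=1..N. \<kappa> i))
            + (h * (trunc_sum y m \<omega> - (\<Sum>i=1..m. mean i)) - (\<Sum>i=1..m. \<kappa> i)))"
      unfolding c_def by (simp only: exp_add)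
    also have "(- h * x + (\<Sum>i=1..N. \<kappa> i))
            + (h * (trunc_sum y m \<omega> - (\<Sum>i=1..m. mean i)) - (\<Sum>i=1..m. \<kappa> i))
        = h * (trunc_sum y m \<omega> - (\<Sum>i=1..m. mean i) - x) + ((\<Sum>i=1..N. \<kappa> i) - (\<Sum>i=1..m. \<kappa> i))"
      by (simp add: right_diff_distrib)
    finally have eq: "c * (\<Prod>i<m. z i (X (Suc i) \<omega>))
        = exp (h * (trunc_sum y m \<omega> - (\<Sum>i=1..m. mean i) - x)
            + ((\<Sum>i=1..N. \<kappa> i) - (\<Sum>i=1..m. \<kappa> i)))" .
    \<comment> \<open>The compensator at time m is at most the one at time N that is built into c;
      this is what \<kappa> \<ge> 0 is for.\<close>
    have "(\<Sum>i=1..m. \<kappa> i) \<le> (\<Sum>i=1..N. \<kappa> i)"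
      using \<omega>(2) \<kappa> by (intro sum_mono2) auto
    moreover have "0 \<le> h * (trunc_sum y m \<omega> - (\<Sum>i=1..m. mean i) - x)"
      using h \<omega>(3) by (intro mult_nonneg_nonneg) auto
    ultimately have "1 \<le> c * (\<Prod>i<m. z i (X (Suc i) \<omega>))" unfolding eq by simp
    with \<omega>(2) show "\<exists>m\<le>N. 1 \<le> c * (\<Prod>i<m. z i (X (Suc i) \<omega>))" by blast
  qed
  also have "\<dots> \<le> ereal (4 * c)"
    by (rule maximal_inequality[OF _ z0 lz bz Ez]) (simp add: c_def)
  finally show ?thesis unfolding c_def .
qed

section \<open>Second moments, norms and truncated excesses\<close>

definition second_moment :: "nat \<Rightarrow> real" where
  "second_moment i = real_of_ereal (E (\<lambda>\<omega>. (X i \<omega>)\<^sup>2))"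

lemma E_square: "1 \<le> i \<Longrightarrow> E (\<lambda>\<omega>. (X i \<omega>)\<^sup>2) = ereal (second_moment i)"
  unfolding second_moment_def
  using X_square[of i] by (intro integ_real) (simp add: integ_def square_H X_H)

lemma second_moment_nonneg: "0 \<le> second_moment i" if "1 \<le> i"
proof -
  have "0 \<le> E (\<lambda>\<omega>. (X i \<omega>)\<^sup>2)" using X_H[OF that] by (intro E_nonneg square_H) auto
  then show ?thesis using E_square[OF that] by simp
qed

lemma s_sq_eq: "s_sq E X n = (\<Sum>i=1..n. second_moment i)"
  by (simp add: s_sq_def second_moment_def)

lemma s_sq_mono: "m \<le> n \<Longrightarrow> s_sq E X m \<le> s_sq E X n"
  unfolding s_sq_eq by (rule sum_mono2) (auto simp: second_moment_nonneg)

lemma s_sq_nonneg: "0 \<le> s_sq E X n"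
  unfolding s_sq_eq by (rule sum_nonneg) (simp add: second_moment_nonneg)

lemma s_norm_nonneg: "0 \<le> s_norm E X n"
  by (simp add: s_norm_def s_sq_nonneg)

lemma s_norm_mono: "m \<le> n \<Longrightarrow> s_norm E X m \<le> s_norm E X n"
  by (simp add: s_norm_def s_sq_mono)

lemma t_norm_ge1: "1 \<le> t_norm E X n"
  using LL_ge1[of "s_sq E X n"] by (simp add: t_norm_def LL_def)

lemma a_norm_nonneg: "0 \<le> a_norm E X n"
  using t_norm_ge1[of n] s_norm_nonneg[of n] by (simp add: a_norm_def)

lemma trunc_excess_H:
  assumes "1 \<le> p" "0 \<le> \<alpha>" "1 \<le> j"
  shows "trunc_excess E X p \<alpha> n j \<in> H"
proof -
  have "0 \<le> \<alpha> * s_norm E X n / t_norm E X n"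
    using assms t_norm_ge1[of n] s_norm_nonneg[of n] by simp
  from lipschitz_H[OF lipschitz_trunc_powr[OF a_norm_nonneg this assms(1)] X_H[OF assms(3)]]
  show ?thesis unfolding trunc_excess_def .
qed

lemma trunc_excess_bounds:
  assumes "0 \<le> p" "0 \<le> \<alpha>"
  shows "0 \<le> trunc_excess E X p \<alpha> n j \<omega>" "trunc_excess E X p \<alpha> n j \<omega> \<le> a_norm E X n powr p"
proof -
  have "0 \<le> \<alpha> * s_norm E X n / t_norm E X n"
    using assms t_norm_ge1[of n] s_norm_nonneg[of n] by simp
  then show "trunc_excess E X p \<alpha> n j \<omega> \<le> a_norm E X n powr p"
    unfolding trunc_excess_def using assms a_norm_nonneg[of n] by (intro powr_mono2) auto
qed (simp add: trunc_excess_def)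

lemma E_trunc_excess:
  assumes "1 \<le> p" "0 \<le> \<alpha>" "1 \<le> j"
  shows "E (trunc_excess E X p \<alpha> n j) = ereal (real_of_ereal (E (trunc_excess E X p \<alpha> n j)))"
    and "0 \<le> real_of_ereal (E (trunc_excess E X p \<alpha> n j))"
proof -
  show "E (trunc_excess E X p \<alpha> n j) = ereal (real_of_ereal (E (trunc_excess E X p \<alpha> n j)))"
    using trunc_excess_bounds[of p \<alpha> n j] assms
    by (intro integ_real integ_bounded[of _ "a_norm E X n powr p"] trunc_excess_H) auto
  have "0 \<le> E (trunc_excess E X p \<alpha> n j)"
    using trunc_excess_bounds(1)[of p \<alpha> n j] assms by (intro E_nonneg trunc_excess_H) auto
  then show "0 \<le> real_of_ereal (E (trunc_excess E X p \<alpha> n j))"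
    by (rule real_of_ereal_pos)
qed

lemma Gam_nonneg: "1 \<le> p \<Longrightarrow> 0 \<le> \<alpha> \<Longrightarrow> 1 \<le> n \<Longrightarrow> 0 \<le> Gam E X p \<alpha> n"
  unfolding Gam_def by (rule E_trunc_excess(2))

lemma E_trunc_excess_self:
  "1 \<le> p \<Longrightarrow> 0 \<le> \<alpha> \<Longrightarrow> 1 \<le> i \<Longrightarrow> E (trunc_excess E X p \<alpha> i i) = ereal (Gam E X p \<alpha> i)"
  unfolding Gam_def by (rule E_trunc_excess(1))

text \<open>Two bounds for one event, since neither serves for all sizes of the excess sum. The
  first has the sharp variance factor exp(2hb) but contains the \<open>Gam\<close>; the second is
  free of them and pays with exp(hy) in the variance term.\<close>

lemma deviation_inequality_excess:
  assumes h: "0 < h" and b: "0 < b" and p: "1 \<le> p" and \<beta>: "0 \<le> \<beta>"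
    and y: "\<And>i. 1 \<le> i \<Longrightarrow> i \<le> N \<Longrightarrow> 0 \<le> yi i \<and> yi i \<le> y \<and> yi i \<le> a_norm E X i"
    and bi: "\<And>i. 1 \<le> i \<Longrightarrow> i \<le> N \<Longrightarrow> \<beta> * s_norm E X i / t_norm E X i \<le> b"
  shows "V_hat M H E {\<omega> \<in> space M. \<exists>m\<le>N. x < trunc_sum yi m \<omega> - (\<Sum>i=1..m. mean i)}
    \<le> ereal (4 * exp (- h * x + h\<^sup>2 * exp (2 * h * b) / 2 * s_sq E X N
        + exp (h * y) / b powr p * (\<Sum>i=1..N. Gam E X p \<beta> i)))" (is ?excess)
    and "V_hat M H E {\<omega> \<in> space M. \<exists>m\<le>N. x < trunc_sum yi m \<omega> - (\<Sum>i=1..m. mean i)}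
    \<le> ereal (4 * exp (- h * x + h\<^sup>2 * exp (h * y) / 2 * s_sq E X N))" (is ?square)
proof -
  let ?P = "\<lambda>i \<omega>. exp (h * min (X i \<omega>) (yi i))"
  let ?A = "h\<^sup>2 * exp (2 * h * b) / 2" and ?B = "exp (h * y) / b powr p"
    and ?C = "h\<^sup>2 * exp (h * y) / 2"
  have PH: "?P i \<in> H" if "1 \<le> i" for i
    using lipschitz_H[OF lipschitz_exp_min[of h "yi i" 0] X_H[OF that]] h by simp
  have lin: "E (\<lambda>\<omega>. h * X i \<omega> + 1) \<le> ereal (h * mean i + 1)"
    "(\<lambda>\<omega>. h * X i \<omega> + 1) \<in> H" if "1 \<le> i" for i
  proof -
    have hX: "(\<lambda>\<omega>. h * X i \<omega>) \<in> H" by (rule H_scale[OF X_H[OF that]])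
    have "E (\<lambda>\<omega>. h * X i \<omega>) \<le> ereal (h * mean i)"
      using h E_X[OF that] by (intro E_scale_le[OF X_H[OF that]]) auto
    then show "E (\<lambda>\<omega>. h * X i \<omega> + 1) \<le> ereal (h * mean i + 1)"
      by (rule E_add_le[OF hX H_const]) (simp add: E_const)
    show "(\<lambda>\<omega>. h * X i \<omega> + 1) \<in> H" by (rule H_add[OF hX H_const])
  qed
  have sq: "E (\<lambda>\<omega>. D * (X i \<omega>)\<^sup>2) \<le> ereal (D * second_moment i)"
    "(\<lambda>\<omega>. D * (X i \<omega>)\<^sup>2) \<in> H" if "1 \<le> i" "0 \<le> D" for i D
    using E_scale_le[OF square_H[OF X_H[OF that(1)]] that(2)] H_scale[OF square_H[OF X_H[OF that(1)]]]
      E_square[OF that(1)] by simp_all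
  have ex: "E (\<lambda>\<omega>. ?B * trunc_excess E X p \<beta> i i \<omega>) \<le> ereal (?B * Gam E X p \<beta> i)"
    "(\<lambda>\<omega>. ?B * trunc_excess E X p \<beta> i i \<omega>) \<in> H" if "1 \<le> i" for i
  proof -
    have "E (trunc_excess E X p \<beta> i i) \<le> ereal (Gam E X p \<beta> i)"
      using E_trunc_excess_self[OF p \<beta> that] by simp
    then show "E (\<lambda>\<omega>. ?B * trunc_excess E X p \<beta> i i \<omega>) \<le> ereal (?B * Gam E X p \<beta> i)"
      by (rule E_scale_le[OF trunc_excess_H[OF p \<beta> that], rotated]) simp
    show "(\<lambda>\<omega>. ?B * trunc_excess E X p \<beta> i i \<omega>) \<in> H"
      by (rule H_scale[OF trunc_excess_H[OF p \<beta> that]])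
  qed
  have E1: "E (?P i) \<le> ereal (1 + h * mean i + (?A * second_moment i + ?B * Gam E X p \<beta> i))"
    if i: "1 \<le> i" "i \<le> N" for i
  proof -
    have "E (?P i) \<le> E (\<lambda>\<omega>. (h * X i \<omega> + 1 + ?A * (X i \<omega>)\<^sup>2) + ?B * trunc_excess E X p \<beta> i i \<omega>)"
    proof (rule E_mono)
      show "(\<lambda>\<omega>. (h * X i \<omega> + 1 + ?A * (X i \<omega>)\<^sup>2) + ?B * trunc_excess E X p \<beta> i i \<omega>) \<in> H"
        by (rule H_add[OF H_add[OF lin(2) sq(2)] ex(2)]) (use i in auto)
      show "?P i \<in> H" by (rule PH[OF i(1)])
      show "?P i \<omega> \<le> (h * X i \<omega> + 1 + ?A * (X i \<omega>)\<^sup>2) + ?B * trunc_excess E X p \<beta> i i \<omega>" for \<omega>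
        using exp_truncated_le(1)[of h "yi i" y "a_norm E X i" b
            "\<beta> * s_norm E X i / t_norm E X i" p "X i \<omega>"] h y[OF i] b bi[OF i] p
        by (simp add: trunc_excess_def algebra_simps)
    qed
    also have "\<dots> \<le> ereal ((h * mean i + 1 + ?A * second_moment i) + ?B * Gam E X p \<beta> i)"
      by (rule E_add_le[OF H_add[OF lin(2) sq(2)] ex(2) E_add_le[OF lin(2) sq(2) lin(1) sq(1)] ex(1)])
        (use i in auto)
    finally show ?thesis by (simp add: algebra_simps)
  qed
  have E2: "E (?P i) \<le> ereal (1 + h * mean i + ?C * second_moment i)" if i: "1 \<le> i" "i \<le> N" for i
  proof -
    have "E (?P i) \<le> E (\<lambda>\<omega>. h * X i \<omega> + 1 + ?C * (X i \<omega>)\<^sup>2)"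
    proof (rule E_mono)
      show "(\<lambda>\<omega>. h * X i \<omega> + 1 + ?C * (X i \<omega>)\<^sup>2) \<in> H"
        by (rule H_add[OF lin(2) sq(2)]) (use i in auto)
      show "?P i \<in> H" by (rule PH[OF i(1)])
      show "?P i \<omega> \<le> h * X i \<omega> + 1 + ?C * (X i \<omega>)\<^sup>2" for \<omega>
        using exp_truncated_le(2)[of h "yi i" y "a_norm E X i" b b p "X i \<omega>"] h y[OF i] b p
        by (simp add: algebra_simps)
    qed
    also have "\<dots> \<le> ereal (h * mean i + 1 + ?C * second_moment i)"
      by (rule E_add_le[OF lin(2) sq(2) lin(1) sq(1)]) (use i in auto)
    finally show ?thesis by (simp add: algebra_simps)
  qed
  have k1: "0 \<le> ?A * second_moment i + ?B * Gam E X p \<beta> i" if "1 \<le> i" for i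
    using second_moment_nonneg[OF that] Gam_nonneg[OF p \<beta> that]
    by (intro add_nonneg_nonneg mult_nonneg_nonneg) auto
  have k2: "0 \<le> ?C * second_moment i" if "1 \<le> i" for i
    using second_moment_nonneg[OF that] by (intro mult_nonneg_nonneg) auto
  have eq1: "(\<Sum>i=1..N. ?A * second_moment i + ?B * Gam E X p \<beta> i)
      = ?A * s_sq E X N + ?B * (\<Sum>i=1..N. Gam E X p \<beta> i)"
    by (simp only: sum.distrib sum_distrib_left s_sq_eq)
  have eq2: "(\<Sum>i=1..N. ?C * second_moment i) = ?C * s_sq E X N"
    by (simp only: sum_distrib_left s_sq_eq)
  show ?excess
    using deviation_inequality[of h N "\<lambda>i. ?A * second_moment i + ?B * Gam E X p \<beta> i", OF h k1 E1]
    unfolding eq1 by (simp only: add.assoc)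
  show ?square
    using deviation_inequality[of h N "\<lambda>i. ?C * second_moment i", OF h k2 E2]
    unfolding eq2 .
qed

end

section \<open>Choice of the exponential parameter\<close>

lemma ln_square_le:
  assumes "1 \<le> (x::real)"
  shows "(ln x)\<^sup>2 \<le> 4 * x"
proof -
  have "ln x = 2 * ln (sqrt x)" using assms by (simp add: ln_sqrt)
  also have "ln (sqrt x) \<le> sqrt x" using assms ln_le_minus_one[of "sqrt x"] by simp
  finally have "ln x \<le> 2 * sqrt x" by simp
  then have "(ln x)\<^sup>2 \<le> (2 * sqrt x)\<^sup>2" using assms by (intro power_mono) auto
  then show ?thesis using assms by (simp add: power_mult_distrib)
qed

text \<open>To be used with \<sigma> = l^k, \<tau> = \<open>tscale (l ^ k)\<close>, B the value of
  s^2 at the end of the block and G the sum of the \<open>Gam\<close>. Three regimes of Q = G /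
  (\<sigma> * \<tau>)^p occur. If Q is so small that the excess term stays bounded at h = \<tau> /
  \<sigma>, this h gives the Gaussian term. If Q is small, but not that small, h is lowered until
  exp(2hy) = 1/Q. If Q exceeds \<tau>^(-4p), the bound without G is used with h = ln \<tau> / y. The
  last two regimes give Q^D because x \<ge> 4 * p * D * y, which is the reason for the divisor in
  y.\<close>

lemma exponent_choice:
  fixes l \<alpha> \<epsilon> p D :: real
  assumes l: "1 < l" and \<alpha>: "0 < \<alpha>" and \<epsilon>: "0 < \<epsilon>" "exp (2 * \<alpha> * l\<^sup>2) * l\<^sup>2 \<le> 1 + \<epsilon>"
    and p: "2 \<le> p" and D: "1 \<le> D"
  obtains C where "0 < C"
    "\<And>\<sigma> \<tau> B G. 0 < \<sigma> \<Longrightarrow> 1 < \<tau> \<Longrightarrow> 0 \<le> B \<Longrightarrow> B \<le> l\<^sup>2 * \<sigma>\<^sup>2 \<Longrightarrow> 0 \<le> G \<Longrightarrow>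
      \<exists>h>0. (let b = l\<^sup>2 * \<alpha> * \<sigma> / \<tau>; y = \<sigma> * \<tau> / (4 * p * D); x = (1 + \<epsilon>) * (\<sigma> * \<tau>);
        R = C * (exp (- (1 + \<epsilon>) * \<tau>\<^sup>2 / 2) + (G / (\<sigma> * \<tau>) powr p) powr D) in
        exp (- h * x + h\<^sup>2 * exp (2 * h * b) / 2 * B + exp (h * y) / b powr p * G) \<le> R \<or>
        exp (- h * x + h\<^sup>2 * exp (h * y) / 2 * B) \<le> R)"
proof -
  define K1 where "K1 = 1 / (l\<^sup>2 * \<alpha>) powr p"
  define K2 where "K2 = 2 * (4 * p * D)\<^sup>2 * l\<^sup>2"
  define C where "C = exp (max K1 K2)"
  have C: "0 < C" "exp K1 \<le> C" "exp K2 \<le> C" by (auto simp: C_def)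
  show thesis
  proof (rule that[OF C(1)])
    fix \<sigma> \<tau> B G :: real
    assume \<sigma>: "0 < \<sigma>" and \<tau>: "1 < \<tau>" and B: "0 \<le> B" "B \<le> l\<^sup>2 * \<sigma>\<^sup>2" and G: "0 \<le> G"
    define b y x Q where "b = l\<^sup>2 * \<alpha> * \<sigma> / \<tau>" and "y = \<sigma> * \<tau> / (4 * p * D)"
      and "x = (1 + \<epsilon>) * (\<sigma> * \<tau>)" and "Q = G / (\<sigma> * \<tau>) powr p"
    define g where "g = exp (- (1 + \<epsilon>) * \<tau>\<^sup>2 / 2)"
    have pos: "0 < b" "0 < y" "0 < x" "0 \<le> Q" "0 < g"
      using l \<alpha> \<sigma> \<tau> \<epsilon> p D G unfolding b_def y_def x_def Q_def g_def by (auto intro!: divide_pos_pos)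
    \<comment> \<open>For h \<le> \<tau> / \<sigma> one has h * b \<le> \<alpha> * l^2, so the
      hypothesis on \<epsilon> absorbs both the exponential and the factor l^2 in the bound on B.
      Consequently the quadratic term takes away at most half of h * x.\<close>
    have Ebd: "exp (2 * h * b) * B \<le> (1 + \<epsilon>) * \<sigma>\<^sup>2" if "0 \<le> h" "h \<le> \<tau> / \<sigma>" for h
    proof -
      have "h * b \<le> \<tau> / \<sigma> * b" using that pos by (intro mult_right_mono) auto
      also have "\<dots> = \<alpha> * l\<^sup>2" using \<sigma> \<tau> by (simp add: b_def)
      finally have "exp (2 * h * b) \<le> exp (2 * \<alpha> * l\<^sup>2)" by simp
      then have "exp (2 * h * b) * B \<le> exp (2 * \<alpha> * l\<^sup>2) * (l\<^sup>2 * \<sigma>\<^sup>2)"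
        using B by (intro mult_mono) auto
      also have "\<dots> \<le> (1 + \<epsilon>) * \<sigma>\<^sup>2"
        using mult_right_mono[OF \<epsilon>(2), of "\<sigma>\<^sup>2"] by (simp add: mult.assoc)
      finally show ?thesis .
    qed
    have quad: "h\<^sup>2 * exp (2 * h * b) / 2 * B \<le> h * x / 2" if "0 \<le> h" "h \<le> \<tau> / \<sigma>" for h
    proof -
      have "h\<^sup>2 * exp (2 * h * b) / 2 * B = h / 2 * (h * (exp (2 * h * b) * B))"
        by (simp add: power2_eq_square)
      also have "\<dots> \<le> h / 2 * (\<tau> / \<sigma> * ((1 + \<epsilon>) * \<sigma>\<^sup>2))"
        using that B by (intro mult_left_mono mult_mono[OF that(2) Ebd[OF that]]) auto
      also have "\<dots> = h * x / 2" using \<sigma> by (simp add: x_def power2_eq_square)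
      finally show ?thesis .
    qed
    \<comment> \<open>As \<sigma> * \<tau> / b = \<tau>^2 / (l^2 * \<alpha>), the excess term is K1
      times exp(hy) * Q * \<tau>^(2p). The square of the latter is the product of exp(2hy) * Q and Q
      * \<tau>^(4p), each at most 1; hence the threshold \<tau>^(-4p).\<close>
    have excess: "exp (h * y) / b powr p * G \<le> K1" if "Q \<le> \<tau> powr (- 4 * p)" "exp (2 * (h * y)) * Q \<le> 1" for h
    proof -
      have "\<sigma> * \<tau> / b = \<tau>\<^sup>2 / (l\<^sup>2 * \<alpha>)"
        using \<sigma> \<tau> l \<alpha> by (simp add: b_def power2_eq_square field_simps)
      moreover have "(\<tau>\<^sup>2) powr p = \<tau> powr (2 * p)"
        using \<tau> by (simp add: powr_powr[symmetric])
      ultimately have "(\<sigma> * \<tau>) powr p / b powr p = \<tau> powr (2 * p) * K1"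
        using \<sigma> \<tau> pos(1) l \<alpha> unfolding K1_def
        by (subst powr_divide[symmetric]) (auto simp: powr_divide)
      moreover have "G = Q * (\<sigma> * \<tau>) powr p" using \<sigma> \<tau> by (simp add: Q_def)
      moreover have "exp (h * y) / b powr p * G = exp (h * y) * Q * ((\<sigma> * \<tau>) powr p / b powr p)"
        unfolding \<open>G = _\<close> by simp
      ultimately have eq: "exp (h * y) / b powr p * G = (exp (h * y) * (Q * \<tau> powr (2 * p))) * K1"
        by (simp only: mult.assoc)
      have "(exp (h * y) * (Q * \<tau> powr (2 * p)))\<^sup>2 = (exp (2 * (h * y)) * Q) * (Q * \<tau> powr (4 * p))"
        by (simp add: power2_eq_square exp_add[symmetric] powr_add[symmetric] algebra_simps)
      also have "\<dots> \<le> 1 * 1"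
      proof (intro mult_mono that(2))
        have "Q * \<tau> powr (4 * p) \<le> \<tau> powr (- 4 * p) * \<tau> powr (4 * p)"
          using that(1) by (intro mult_right_mono) auto
        also have "\<dots> = 1" using \<tau> by (simp add: powr_add[symmetric])
        finally show "Q * \<tau> powr (4 * p) \<le> 1" .
      qed (use pos in auto)
      finally have "exp (h * y) * (Q * \<tau> powr (2 * p)) \<le> 1"
        by (simp add: power_le_one_iff abs_square_le_1 abs_le_iff)
      then have "(exp (h * y) * (Q * \<tau> powr (2 * p))) * K1 \<le> 1 * K1"
        by (intro mult_right_mono) (auto simp: K1_def)
      with eq show ?thesis by simp
    qed
    have "\<exists>h>0. exp (- h * x + h\<^sup>2 * exp (2 * h * b) / 2 * B + exp (h * y) / b powr p * G)
          \<le> C * (g + Q powr D) \<or>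
        exp (- h * x + h\<^sup>2 * exp (h * y) / 2 * B) \<le> C * (g + Q powr D)"
    proof (cases "Q \<le> \<tau> powr (- 4 * p)")
      case small: True
      show ?thesis
      proof (cases "exp (2 * (\<tau> / \<sigma> * y)) * Q \<le> 1")
        case True
        let ?h = "\<tau> / \<sigma>"
        have h: "0 < ?h" using \<sigma> \<tau> by simp
        have "- ?h * x + ?h\<^sup>2 * exp (2 * ?h * b) / 2 * B + exp (?h * y) / b powr p * G
            \<le> - ?h * x + ?h * x / 2 + K1"
          using quad[of ?h] excess[OF small True] h by (intro add_mono) auto
        also have "\<dots> = - (1 + \<epsilon>) * \<tau>\<^sup>2 / 2 + K1"
          using \<sigma> by (simp add: x_def power2_eq_square field_simps)
        finally have "exp (- ?h * x + ?h\<^sup>2 * exp (2 * ?h * b) / 2 * B + exp (?h * y) / b powr p * G)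
            \<le> g * exp K1" by (simp add: g_def exp_add[symmetric])
        also have "\<dots> \<le> (g + Q powr D) * C" using C pos by (intro mult_mono) auto
        finally show ?thesis using h by (intro exI[of _ ?h]) (simp add: mult.commute)
      next
        case False
        then have Q0: "0 < Q" using pos(4) by (cases "Q = 0") auto
        \<comment> \<open>The solution of exp(2hy) = 1/Q. It lies below \<tau> / \<sigma> because
          the test of this case failed there, so the estimate of the quadratic term still
          applies.\<close>
        define h where "h = - ln Q / (2 * y)"
        have "\<tau> powr (- 4 * p) < \<tau> powr 0" using \<tau> p by (intro powr_less_mono) auto
        then have "Q < 1" using small \<tau> by simp
        then have "ln Q < 0" using Q0 by simp
        then have h: "0 < h" using pos by (simp add: h_def divide_neg_pos)
        have hy: "2 * (h * y) = - ln Q" using pos by (simp add: h_def)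
        have "0 < ln (exp (2 * (\<tau> / \<sigma> * y)) * Q)" using False by (intro ln_gt_zero) auto
        then have "- ln Q < 2 * (\<tau> / \<sigma> * y)" using Q0 by (simp add: ln_mult)
        then have "h * y < \<tau> / \<sigma> * y" using hy by simp
        then have hle: "h \<le> \<tau> / \<sigma>" using pos(2) mult_less_cancel_right_pos[of y h "\<tau> / \<sigma>"] by simp
        have e1: "exp (2 * (h * y)) * Q \<le> 1" unfolding hy using Q0 exp_ln[OF Q0] by (subst exp_minus) simp
        have "x = (1 + \<epsilon>) * (4 * p * D * y)" using p D by (simp add: x_def y_def)
        then have "h * x / 2 = (1 + \<epsilon>) * p * D * (2 * (h * y))" by (simp add: field_simps)
        also have "\<dots> \<ge> 1 * D * (2 * (h * y))"
          using \<epsilon> p D h pos mult_mono[of 1 "1 + \<epsilon>" 1 p] by (intro mult_right_mono) auto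
        finally have hx: "- D * ln Q \<le> h * x / 2" unfolding hy by simp
        have "- h * x + h\<^sup>2 * exp (2 * h * b) / 2 * B + exp (h * y) / b powr p * G
            \<le> - h * x + h * x / 2 + K1"
          using quad[OF _ hle] excess[OF small e1] h by (intro add_mono) auto
        also have "\<dots> \<le> D * ln Q + K1" using hx by simp
        finally have "exp (- h * x + h\<^sup>2 * exp (2 * h * b) / 2 * B + exp (h * y) / b powr p * G)
            \<le> Q powr D * exp K1" using Q0 by (simp add: powr_def exp_add[symmetric])
        also have "\<dots> \<le> (g + Q powr D) * C" using C pos by (intro mult_mono) auto
        finally show ?thesis using h by (intro exI[of _ h]) (simp add: mult.commute)
      qed
    next
      case False
      \<comment> \<open>Now exp(hy) = \<tau>, so the quadratic term is of order (ln \<tau>)^2 /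
        \<tau> and bounded by K2, while exp(-hx) \<le> \<tau>^(-4pD) \<le> Q^D.\<close>
      define h where "h = ln \<tau> / y"
      have h: "0 < h" using \<tau> pos by (simp add: h_def)
      have hy: "exp (h * y) = \<tau>" using pos \<tau> by (simp add: h_def)
      have "h\<^sup>2 * exp (h * y) / 2 * B \<le> h\<^sup>2 * \<tau> / 2 * (l\<^sup>2 * \<sigma>\<^sup>2)"
        unfolding hy using B \<tau> by (intro mult_left_mono) auto
      also have "\<dots> = (ln \<tau>)\<^sup>2 * (4 * p * D)\<^sup>2 * l\<^sup>2 / (2 * \<tau>)"
        using \<sigma> \<tau> p D by (simp add: h_def y_def power_divide power_mult_distrib)
          (simp add: power2_eq_square)
      also have "\<dots> \<le> (4 * \<tau>) * (4 * p * D)\<^sup>2 * l\<^sup>2 / (2 * \<tau>)"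
        using ln_square_le[of \<tau>] \<tau> by (intro divide_right_mono mult_right_mono) auto
      also have "\<dots> = K2" using \<tau> by (simp add: K2_def)
      finally have q: "h\<^sup>2 * exp (h * y) / 2 * B \<le> K2" .
      have "x = (1 + \<epsilon>) * (4 * p * D * y)" using p D by (simp add: x_def y_def)
      then have "h * x = (1 + \<epsilon>) * (4 * p * D * ln \<tau>)" using pos by (simp add: h_def)
      also have "\<dots> \<ge> 1 * (4 * p * D * ln \<tau>)"
        using \<epsilon> p D \<tau> by (intro mult_right_mono) auto
      finally have hx: "4 * p * D * ln \<tau> \<le> h * x" by simp
      have "exp (- h * x + h\<^sup>2 * exp (h * y) / 2 * B) \<le> exp (D * (- 4 * p * ln \<tau>) + K2)"
      proof -
        have "- (D * (- 4 * p * ln \<tau>)) = 4 * p * D * ln \<tau>" by simp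
        then have "- h * x + h\<^sup>2 * exp (h * y) / 2 * B \<le> D * (- 4 * p * ln \<tau>) + K2"
          using q hx by linarith
        then show ?thesis by (simp only: exp_le_cancel_iff)
      qed
      also have "\<dots> = (\<tau> powr (- 4 * p)) powr D * exp K2"
      proof -
        have "(\<tau> powr (- 4 * p)) powr D = exp (D * (- 4 * p * ln \<tau>))"
          using \<tau> by (simp add: powr_def)
        then show ?thesis by (simp only: exp_add)
      qed
      also have "\<dots> \<le> (g + Q powr D) * C"
      proof (rule mult_mono[OF _ C(3)])
        have "(\<tau> powr (- 4 * p)) powr D \<le> Q powr D"
          using False D by (intro powr_mono2) auto
        then show "(\<tau> powr (- 4 * p)) powr D \<le> g + Q powr D" using pos by simp
      qed (use pos in auto)
      finally show ?thesis using h by (intro exI[of _ h]) (simp add: mult.commute)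
    qed
    then show "\<exists>h>0. (let b = l\<^sup>2 * \<alpha> * \<sigma> / \<tau>; y = \<sigma> * \<tau> / (4 * p * D); x = (1 + \<epsilon>) * (\<sigma> * \<tau>);
        R = C * (exp (- (1 + \<epsilon>) * \<tau>\<^sup>2 / 2) + (G / (\<sigma> * \<tau>) powr p) powr D) in
        exp (- h * x + h\<^sup>2 * exp (2 * h * b) / 2 * B + exp (h * y) / b powr p * G) \<le> R \<or>
        exp (- h * x + h\<^sup>2 * exp (h * y) / 2 * B) \<le> R)"
      unfolding Let_def b_def[symmetric] y_def[symmetric] x_def[symmetric] Q_def[symmetric] g_def[symmetric] .
  qed
qed

section \<open>Summation over blocks\<close>

lemma summable_block_sums:
  fixes f :: "nat \<Rightarrow> real"
  assumes "\<And>n. 0 \<le> f n" "summable f" "mono N"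
  shows "summable (\<lambda>k. \<Sum>n\<in>{N k..<N (Suc k)}. f n)"
proof (rule summableI_nonneg_bounded)
  show "0 \<le> (\<Sum>n\<in>{N k..<N (Suc k)}. f n)" for k by (intro sum_nonneg assms)
  fix K
  have "(\<Sum>k<K. \<Sum>n\<in>{N k..<N (Suc k)}. f n) = (\<Sum>n\<in>{N 0..<N K}. f n)"
  proof (induction K)
    case (Suc K)
    have "N 0 \<le> N K" "N K \<le> N (Suc K)" using assms(3) by (auto simp: mono_def)
    from sum.atLeastLessThan_concat[OF this, of f] Suc.IH show ?case by simp
  qed simp
  also have "\<dots> \<le> suminf f" using assms by (intro sum_le_suminf) auto
  finally show "(\<Sum>k<K. \<Sum>n\<in>{N k..<N (Suc k)}. f n) \<le> suminf f" .
qed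

text \<open>Of the two factors r in r^2, one goes into the maximum \<open>Mx\<close> and the other
  is summed as a geometric series. The D-th power of a maximum is at most the sum of the D-th
  powers, and this sum is a Cauchy product of two summable series.\<close>

lemma summable_geometric_convolution_powr:
  fixes v :: "nat \<Rightarrow> real"
  assumes v: "\<And>k. 0 \<le> v k" "summable (\<lambda>k. v k powr D)" and r: "0 < r" "r < 1" and D: "0 < D"
  shows "summable (\<lambda>k. (\<Sum>l\<le>k. v l * (r\<^sup>2) ^ (k - l)) powr D)"
proof -
  have bound: "(\<Sum>l\<le>k. v l * (r\<^sup>2) ^ (k - l)) powr D
      \<le> (1 / (1 - r)) powr D * (\<Sum>l\<le>k. v l powr D * (r powr D) ^ (k - l))" for k
  proof -
    define Mx where "Mx = Max ((\<lambda>l. v l * r ^ (k - l)) ` {..k})"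
    have le: "v l * r ^ (k - l) \<le> Mx" if "l \<le> k" for l
      unfolding Mx_def using that by (intro Max_ge) auto
    have "Mx \<in> (\<lambda>l. v l * r ^ (k - l)) ` {..k}" unfolding Mx_def by (intro Max_in) auto
    then obtain l0 where l0: "l0 \<le> k" "Mx = v l0 * r ^ (k - l0)" by auto
    have Mx0: "0 \<le> Mx" using l0 v r by simp
    have "(\<Sum>l\<le>k. v l * (r\<^sup>2) ^ (k - l)) \<le> (\<Sum>l\<le>k. Mx * r ^ (k - l))"
    proof (rule sum_mono)
      fix l assume "l \<in> {..k}"
      then have "(v l * r ^ (k - l)) * r ^ (k - l) \<le> Mx * r ^ (k - l)"
        using r by (intro mult_right_mono le) auto
      then show "v l * (r\<^sup>2) ^ (k - l) \<le> Mx * r ^ (k - l)"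
        by (simp add: power2_eq_square power_mult_distrib)
    qed
    also have "\<dots> = Mx * (\<Sum>l\<le>k. r ^ l)"
    proof -
      have "(\<Sum>l\<le>k. r ^ (k - l)) = (\<Sum>l\<le>k. r ^ l)"
        by (rule sum.reindex_bij_witness[of _ "\<lambda>l. k - l" "\<lambda>l. k - l"]) auto
      then show ?thesis by (simp only: sum_distrib_left[symmetric])
    qed
    also have "(\<Sum>l\<le>k. r ^ l) \<le> 1 / (1 - r)"
      using r sum_le_suminf[OF summable_geometric[of r], of "{..k}"] by (simp add: suminf_geometric)
    then have "Mx * (\<Sum>l\<le>k. r ^ l) \<le> Mx * (1 / (1 - r))" using Mx0 by (rule mult_left_mono)
    finally have "(\<Sum>l\<le>k. v l * (r\<^sup>2) ^ (k - l)) powr D \<le> (Mx * (1 / (1 - r))) powr D"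
      using v r D by (intro powr_mono2 sum_nonneg) auto
    also have "\<dots> = (1 / (1 - r)) powr D * Mx powr D"
      using Mx0 r by (simp only: powr_mult mult.commute)
    also have "Mx powr D = v l0 powr D * (r powr D) ^ (k - l0)"
      using v(1)[of l0] r unfolding l0(2)
      by (simp add: powr_mult powr_realpow[symmetric] powr_powr mult.commute)
    also have "\<dots> \<le> (\<Sum>l\<le>k. v l powr D * (r powr D) ^ (k - l))"
      using l0 r by (intro member_le_sum[of l0 "{..k}" "\<lambda>l. v l powr D * (r powr D) ^ (k - l)"]) auto
    finally show ?thesis using r by (simp add: mult_left_mono)
  qed
  have "r powr D < 1" using r D powr_less_mono2[of D r 1] by simp
  then have "summable (\<lambda>n. norm ((r powr D) ^ n))"
    by (intro summable_geometric[of "norm (r powr D)", simplified norm_power[symmetric]]) simp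
  moreover have "summable (\<lambda>n. norm (v n powr D))" using v(2) by simp
  ultimately have "summable (\<lambda>k. \<Sum>l\<le>k. v l powr D * (r powr D) ^ (k - l))"
    by (intro summable_Cauchy_product)
  then have "summable (\<lambda>k. (1 / (1 - r)) powr D * (\<Sum>l\<le>k. v l powr D * (r powr D) ^ (k - l)))"
    by (rule summable_mult)
  then show ?thesis
    by (rule summable_comparison_test') (use bound in auto)
qed

text \<open>The norming t as a function of s instead of the index, so that it can be evaluated at
  l^k, a value which no s_n need attain.\<close>

definition tscale :: "real \<Rightarrow> real" where "tscale v = sqrt (2 * LL (v\<^sup>2))"

lemma tscale_gt1: "1 < tscale v"
proof -
  have "1 < sqrt 2" by simp
  also have "\<dots> \<le> tscale v" using LL_ge1[of "v\<^sup>2"] by (simp add: tscale_def)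
  finally show ?thesis .
qed

lemma tscale_square: "(tscale v)\<^sup>2 = 2 * LL (v\<^sup>2)"
  using LL_ge1[of "v\<^sup>2"] by (simp add: tscale_def)

lemma tscale_mono: "0 \<le> u \<Longrightarrow> u \<le> v \<Longrightarrow> tscale u \<le> tscale v"
  by (simp add: tscale_def LL_mono power_mono)

lemma tscale_scale_le:
  assumes "1 \<le> c"
  shows "tscale (c * v) \<le> c * tscale v"
proof -
  have "1 \<le> c\<^sup>2" using assms by simp
  from LL_scale_le[OF this, of "v\<^sup>2"] have "tscale (c * v) \<le> sqrt (c\<^sup>2 * (2 * LL (v\<^sup>2)))"
    unfolding tscale_def by (simp add: power_mult_distrib)
  also have "\<dots> = c * tscale v" using assms by (simp add: real_sqrt_mult tscale_def)
  finally show ?thesis .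
qed

lemma ratio_tscale_mono:
  assumes "0 \<le> u" "u \<le> v"
  shows "u / tscale u \<le> v / tscale v"
proof (cases "u = 0")
  case True
  then show ?thesis using assms tscale_gt1[of v] by simp
next
  case False
  have "LL (v\<^sup>2) * u\<^sup>2 \<le> LL (u\<^sup>2) * v\<^sup>2"
    using False assms by (intro LL_ratio_le power_mono) auto
  then have "(tscale v * u)\<^sup>2 \<le> (tscale u * v)\<^sup>2"
    by (simp add: power_mult_distrib tscale_square)
  then have "tscale v * u \<le> tscale u * v"
    using assms tscale_gt1[of u] by (intro power2_le_imp_le[of "tscale v * u"]) auto
  then show ?thesis
    using tscale_gt1[of u] tscale_gt1[of v] by (simp add: field_simps)
qed

text \<open>Apart from the cut-off in the logarithms, exp(-(1+\<epsilon>) t^2 / 2) is the power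
  -(1+\<epsilon>) of log s^2, and along s = l^k that logarithm is linear in k.\<close>

lemma summable_exp_tscale:
  assumes l: "1 < l" and \<epsilon>: "0 < \<epsilon>"
  shows "summable (\<lambda>k. exp (- (1 + \<epsilon>) * (tscale (l ^ k))\<^sup>2 / 2))"
proof -
  define c where "c = 2 * ln l"
  have c: "0 < c" using l by (simp add: c_def)
  have le: "exp (- (1 + \<epsilon>) * (tscale (l ^ k))\<^sup>2 / 2) \<le> c powr (- (1 + \<epsilon>)) * real k powr (- (1 + \<epsilon>))"
    if "1 \<le> k" for k
  proof -
    have "1 < (l ^ k)\<^sup>2" using l that by (simp add: one_less_power)
    moreover have "ln ((l ^ k)\<^sup>2) = c * real k" using l by (simp add: c_def ln_realpow)
    ultimately have "ln (c * real k) \<le> LL ((l ^ k)\<^sup>2)" using ln_ln_le_LL by metis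
    then have "- (1 + \<epsilon>) * LL ((l ^ k)\<^sup>2) \<le> - (1 + \<epsilon>) * ln (c * real k)"
      using \<epsilon> by (intro mult_left_mono_neg) auto
    then have "exp (- (1 + \<epsilon>) * (tscale (l ^ k))\<^sup>2 / 2) \<le> exp (- (1 + \<epsilon>) * ln (c * real k))"
      by (simp add: tscale_square)
    also have "\<dots> = (c * real k) powr (- (1 + \<epsilon>))" using c that by (simp add: powr_def)
    finally show ?thesis using c by (simp add: powr_mult)
  qed
  have "summable (\<lambda>k. real k powr (- (1 + \<epsilon>)))" using \<epsilon> by (subst summable_real_powr_iff) simp
  then have "summable (\<lambda>k. c powr (- (1 + \<epsilon>)) * real k powr (- (1 + \<epsilon>)))" by (rule summable_mult)
  then show ?thesis
    by (rule summable_comparison_test'[where N = 1]) (use le in auto)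
qed

section \<open>Geometric blocks of indices\<close>

locale diverging_sequence = independent_sequence +
  assumes s_sq_at_top: "filterlim (s_sq E X) at_top sequentially"
begin

lemma t_norm_eq: "t_norm E X n = tscale (s_norm E X n)"
  using s_sq_nonneg[of n] by (simp add: t_norm_def tscale_def LL_def s_norm_def)

lemma a_norm_mono: "m \<le> n \<Longrightarrow> a_norm E X m \<le> a_norm E X n"
  unfolding a_norm_def t_norm_eq
  using s_norm_mono[of m n] s_norm_nonneg[of m] tscale_gt1[of "s_norm E X m"]
  by (intro mult_mono tscale_mono) auto

lemma s_norm_at_top: "filterlim (s_norm E X) at_top sequentially"
  unfolding s_norm_def[abs_def]
  by (rule filterlim_compose[OF sqrt_at_top s_sq_at_top])

lemma a_norm_at_top: "filterlim (a_norm E X) at_top sequentially"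
proof (rule filterlim_at_top_mono[OF s_norm_at_top])
  have "s_norm E X n * 1 \<le> a_norm E X n" for n
    unfolding a_norm_def using t_norm_ge1 s_norm_nonneg by (intro mult_left_mono) auto
  then show "\<forall>\<^sub>F n in sequentially. s_norm E X n \<le> a_norm E X n" by simp
qed

text \<open>Block k is the set of n with \<open>block_end l k < n\<close> and
  \<open>n \<le> block_end l (Suc k)\<close>, possibly empty; indices up to
  \<open>block_end l 0\<close> precede all blocks. \<open>Max\<close> is legitimate for l > 0: the
  set contains 0, as s_0 = 0, and is finite, as s diverges.\<close>

definition block_end :: "real \<Rightarrow> nat \<Rightarrow> nat" where
  "block_end l k = Max {n. s_norm E X n < l ^ k}"

lemma le_block_end_iff:
  assumes "0 < l"
  shows "n \<le> block_end l k \<longleftrightarrow> s_norm E X n < l ^ k"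
proof -
  let ?A = "{n. s_norm E X n < l ^ k}"
  obtain n0 where n0: "\<And>n. n0 \<le> n \<Longrightarrow> l ^ k \<le> s_norm E X n"
    using s_norm_at_top unfolding filterlim_at_top eventually_sequentially by blast
  have "?A \<subseteq> {..<n0}" using n0 by (auto simp: not_le[symmetric])
  then have fin: "finite ?A" by (rule finite_subset) simp
  have "0 \<in> ?A" using assms by (simp add: s_norm_def s_sq_def)
  then have "Max ?A \<in> ?A" using fin by (intro Max_in) auto
  then have "s_norm E X (block_end l k) < l ^ k" by (simp add: block_end_def)
  moreover have "n \<le> block_end l k" if "s_norm E X n < l ^ k" for n
    unfolding block_end_def using fin that by (intro Max_ge) auto
  ultimately show ?thesis using s_norm_mono le_less_trans by blast
qed

lemma block_end_mono:
  assumes "1 < l"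
  shows "mono (block_end l)"
proof (rule monoI)
  fix j k :: nat assume "j \<le> k"
  then have "l ^ j \<le> l ^ k" using assms by simp
  moreover have "s_norm E X (block_end l j) < l ^ j"
    using le_block_end_iff[of l "block_end l j" j] assms by simp
  ultimately have "s_norm E X (block_end l j) < l ^ k" by linarith
  then show "block_end l j \<le> block_end l k"
    using le_block_end_iff[of l "block_end l j" k] assms by simp
qed

text \<open>Valid for every n up to the end of the block, not only inside it, because the maximal
  inequality runs over the whole past.\<close>

lemma block_upper_bounds:
  assumes l: "1 < l" and n: "n \<le> block_end l (Suc k)"
  shows "s_norm E X n \<le> l * l ^ k"
    and "a_norm E X n \<le> l\<^sup>2 * (l ^ k * tscale (l ^ k))"
    and "s_norm E X n / t_norm E X n \<le> l * (l ^ k / tscale (l ^ k))"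
proof -
  show s: "s_norm E X n \<le> l * l ^ k"
    using le_block_end_iff[of l n "Suc k"] l n by simp
  have t: "t_norm E X n \<le> l * tscale (l ^ k)"
    unfolding t_norm_eq
    using tscale_mono[OF s_norm_nonneg s] tscale_scale_le[of l "l ^ k"] l by simp
  have "a_norm E X n \<le> (l * l ^ k) * (l * tscale (l ^ k))"
    unfolding a_norm_def using s t l t_norm_ge1[of n] by (intro mult_mono) auto
  then show "a_norm E X n \<le> l\<^sup>2 * (l ^ k * tscale (l ^ k))"
    by (simp add: power2_eq_square mult.assoc mult.left_commute)
  have "s_norm E X n / t_norm E X n \<le> l * l ^ k / tscale (l * l ^ k)"
    unfolding t_norm_eq by (rule ratio_tscale_mono[OF s_norm_nonneg s])
  also have "\<dots> \<le> l * l ^ k / tscale (l ^ k)"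
    using l tscale_gt1[of "l ^ k"] by (intro divide_left_mono tscale_mono mult_pos_pos) (auto intro: order.strict_trans[OF zero_less_one tscale_gt1])
  finally show "s_norm E X n / t_norm E X n \<le> l * (l ^ k / tscale (l ^ k))" by simp
qed

lemma block_lower_bounds:
  assumes l: "1 < l" and n: "block_end l k < n"
  shows "l ^ k \<le> s_norm E X n" and "l ^ k * tscale (l ^ k) \<le> a_norm E X n"
proof -
  show s: "l ^ k \<le> s_norm E X n"
    using le_block_end_iff[of l n k] l n by simp
  then show "l ^ k * tscale (l ^ k) \<le> a_norm E X n"
    unfolding a_norm_def t_norm_eq
    using l tscale_gt1[of "l ^ k"] s_norm_nonneg by (intro mult_mono tscale_mono) auto
qed

text \<open>Up to the end of block k, a_i is at most l^2 * l^k * t with t taken at l^k, so the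
  multiple of a_i chosen here stays below the level y of \<open>exponent_choice\<close>. Likewise
  s_i / t_i is at most l * l^k / t, so the factor l * \<alpha> in \<open>Gam\<close> fits the
  parameter b, which carries l^2 * \<alpha>.\<close>

lemma block_deviation_bound:
  assumes l: "1 < l" and \<alpha>: "0 < \<alpha>" and \<epsilon>: "0 < \<epsilon>" "exp (2 * \<alpha> * l\<^sup>2) * l\<^sup>2 \<le> 1 + \<epsilon>"
    and p: "2 \<le> p" and D: "1 \<le> D"
  obtains C where "0 < C" "\<And>k. V_hat M H E {\<omega> \<in> space M. \<exists>m\<le>block_end l (Suc k).
      (1 + \<epsilon>) * (l ^ k * tscale (l ^ k))
        < trunc_sum (\<lambda>i. 1 / (4 * p * D * l\<^sup>2) * a_norm E X i) m \<omega> - (\<Sum>i=1..m. mean i)}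
    \<le> ereal (4 * (C * (exp (- (1 + \<epsilon>) * (tscale (l ^ k))\<^sup>2 / 2)
        + ((\<Sum>i=1..block_end l (Suc k). Gam E X p (l * \<alpha>) i) / (l ^ k * tscale (l ^ k)) powr p) powr D)))"
proof -
  obtain C where C: "0 < C"
    "\<And>\<sigma> \<tau> B G. 0 < \<sigma> \<Longrightarrow> 1 < \<tau> \<Longrightarrow> 0 \<le> B \<Longrightarrow> B \<le> l\<^sup>2 * \<sigma>\<^sup>2 \<Longrightarrow> 0 \<le> G \<Longrightarrow>
      \<exists>h>0. (let b = l\<^sup>2 * \<alpha> * \<sigma> / \<tau>; y = \<sigma> * \<tau> / (4 * p * D); x = (1 + \<epsilon>) * (\<sigma> * \<tau>);
        R = C * (exp (- (1 + \<epsilon>) * \<tau>\<^sup>2 / 2) + (G / (\<sigma> * \<tau>) powr p) powr D) in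
        exp (- h * x + h\<^sup>2 * exp (2 * h * b) / 2 * B + exp (h * y) / b powr p * G) \<le> R \<or>
        exp (- h * x + h\<^sup>2 * exp (h * y) / 2 * B) \<le> R)"
    using exponent_choice[OF l \<alpha> \<epsilon> p D] by blast
  show thesis
  proof (rule that[OF C(1)])
    fix k
    let ?N = "block_end l (Suc k)"
    define \<sigma> \<tau> where "\<sigma> = l ^ k" and "\<tau> = tscale (l ^ k)"
    define G where "G = (\<Sum>i=1..?N. Gam E X p (l * \<alpha>) i)"
    define \<delta> where "\<delta> = 1 / (4 * p * D * l\<^sup>2)"
    define b y x where "b = l\<^sup>2 * \<alpha> * \<sigma> / \<tau>" and "y = \<sigma> * \<tau> / (4 * p * D)" and "x = (1 + \<epsilon>) * (\<sigma> * \<tau>)"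
    define R where "R = C * (exp (- (1 + \<epsilon>) * \<tau>\<^sup>2 / 2) + (G / (\<sigma> * \<tau>) powr p) powr D)"
    have pos: "0 < \<sigma>" "1 < \<tau>" using l tscale_gt1 by (auto simp: \<sigma>_def \<tau>_def)
    have G0: "0 \<le> G" unfolding G_def using p l \<alpha> by (intro sum_nonneg Gam_nonneg) auto
    have B: "s_sq E X ?N \<le> l\<^sup>2 * \<sigma>\<^sup>2"
    proof -
      have "s_sq E X ?N = (s_norm E X ?N)\<^sup>2" by (simp add: s_norm_def s_sq_nonneg)
      also have "\<dots> \<le> (l * l ^ k)\<^sup>2"
        using block_upper_bounds(1)[OF l order_refl] by (intro power_mono s_norm_nonneg)
      finally show ?thesis by (simp add: \<sigma>_def power_mult_distrib)
    qed
    obtain h where h: "0 < h"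
      "exp (- h * x + h\<^sup>2 * exp (2 * h * b) / 2 * s_sq E X ?N + exp (h * y) / b powr p * G) \<le> R \<or>
       exp (- h * x + h\<^sup>2 * exp (h * y) / 2 * s_sq E X ?N) \<le> R"
      using C(2)[OF pos s_sq_nonneg B G0] unfolding Let_def b_def y_def x_def R_def by blast
    have b0: "0 < b" using l \<alpha> pos by (simp add: b_def)
    have pD: "8 \<le> 4 * p * D" proof -
      have "2 * 1 \<le> p * D" using p D by (intro mult_mono) auto
      then show ?thesis by linarith
    qed
    have \<delta>: "0 < \<delta>" "\<delta> \<le> 1"
    proof -
      have "1 \<le> l\<^sup>2" using l by simp
      moreover have "1 \<le> 4 * p * D" using pD by linarith
      ultimately have "1 * 1 \<le> (4 * p * D) * l\<^sup>2"
        using p D by (intro mult_mono) auto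
      then have le: "1 \<le> 4 * p * D * l\<^sup>2" by (simp only: mult_1)
      then have q: "0 < 4 * p * D * l\<^sup>2" by linarith
      show "0 < \<delta>" unfolding \<delta>_def using q by (rule divide_pos_pos[OF zero_less_one])
      show "\<delta> \<le> 1" unfolding \<delta>_def divide_le_eq_1_pos[OF q] by (rule le)
    qed
    have yi: "0 \<le> \<delta> * a_norm E X i \<and> \<delta> * a_norm E X i \<le> y \<and> \<delta> * a_norm E X i \<le> a_norm E X i"
      if "1 \<le> i" "i \<le> ?N" for i
    proof -
      have "\<delta> * a_norm E X i \<le> \<delta> * (l\<^sup>2 * (\<sigma> * \<tau>))"
        using block_upper_bounds(2)[OF l that(2)] \<delta> by (intro mult_left_mono) (auto simp: \<sigma>_def \<tau>_def)
      also have "\<dots> = y" using l pD by (simp add: \<delta>_def y_def)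
      finally show ?thesis using \<delta> a_norm_nonneg[of i] mult_right_mono[of \<delta> 1 "a_norm E X i"] by simp
    qed
    have bi: "l * \<alpha> * s_norm E X i / t_norm E X i \<le> b" if "1 \<le> i" "i \<le> ?N" for i
    proof -
      have "l * \<alpha> * (s_norm E X i / t_norm E X i) \<le> l * \<alpha> * (l * (\<sigma> / \<tau>))"
        using block_upper_bounds(3)[OF l that(2)] l \<alpha> by (intro mult_left_mono) (auto simp: \<sigma>_def \<tau>_def)
      then show ?thesis by (simp add: b_def power2_eq_square algebra_simps)
    qed
    have p1: "1 \<le> p" and la: "0 \<le> l * \<alpha>" using p l \<alpha> by auto
    have dev: "V_hat M H E {\<omega> \<in> space M. \<exists>m\<le>?N. x < trunc_sum (\<lambda>i. \<delta> * a_norm E X i) m \<omega> - (\<Sum>i=1..m. mean i)}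
        \<le> ereal (4 * exp (- h * x + h\<^sup>2 * exp (2 * h * b) / 2 * s_sq E X ?N + exp (h * y) / b powr p * G))"
      "V_hat M H E {\<omega> \<in> space M. \<exists>m\<le>?N. x < trunc_sum (\<lambda>i. \<delta> * a_norm E X i) m \<omega> - (\<Sum>i=1..m. mean i)}
        \<le> ereal (4 * exp (- h * x + h\<^sup>2 * exp (h * y) / 2 * s_sq E X ?N))"
      unfolding G_def
      by (rule deviation_inequality_excess[OF h(1) b0 p1 la]; fact yi bi)+
    have "V_hat M H E {\<omega> \<in> space M. \<exists>m\<le>?N. x < trunc_sum (\<lambda>i. \<delta> * a_norm E X i) m \<omega> - (\<Sum>i=1..m. mean i)}
        \<le> ereal (4 * R)"
      using h(2)
    proof
      assume le: "exp (- h * x + h\<^sup>2 * exp (2 * h * b) / 2 * s_sq E X ?N + exp (h * y) / b powr p * G) \<le> R"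
      show ?thesis
        by (rule order_trans[OF dev(1)], subst ereal_less_eq(3))
          (rule mult_left_mono[OF le], simp)
    next
      assume le: "exp (- h * x + h\<^sup>2 * exp (h * y) / 2 * s_sq E X ?N) \<le> R"
      show ?thesis
        by (rule order_trans[OF dev(2)], subst ereal_less_eq(3)) (rule mult_left_mono[OF le], simp)
    qed
    then show "V_hat M H E {\<omega> \<in> space M. \<exists>m\<le>block_end l (Suc k).
      (1 + \<epsilon>) * (l ^ k * tscale (l ^ k))
        < trunc_sum (\<lambda>i. 1 / (4 * p * D * l\<^sup>2) * a_norm E X i) m \<omega> - (\<Sum>i=1..m. mean i)}
    \<le> ereal (4 * (C * (exp (- (1 + \<epsilon>) * (tscale (l ^ k))\<^sup>2 / 2)
        + ((\<Sum>i=1..block_end l (Suc k). Gam E X p (l * \<alpha>) i) / (l ^ k * tscale (l ^ k)) powr p) powr D)))"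
      unfolding x_def \<sigma>_def \<tau>_def \<delta>_def R_def G_def .
  qed
qed

text \<open>\<open>Lam\<close> at n measures earlier variables with the levels of n, while the block
  bound collects each \<open>Gam\<close> at its own levels. Inside a block s_n \<le> l * s_i and t_i
  \<le> t_n, so passing from i to n multiplies s/t by at most l, and the cap a can only
  grow.\<close>

lemma Gam_le_excess:
  assumes l: "1 < l" and \<alpha>: "0 < \<alpha>" and p: "1 \<le> p"
    and i: "block_end l k < i" "i \<le> n" and n: "n \<le> block_end l (Suc k)"
  shows "Gam E X p (l * \<alpha>) i \<le> real_of_ereal (E (trunc_excess E X p \<alpha> n i))"
proof -
  have i1: "1 \<le> i" using i by simp
  have s: "s_norm E X n \<le> l * s_norm E X i"
  proof -
    have "l * l ^ k \<le> l * s_norm E X i"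
      using block_lower_bounds(1)[OF l i(1)] l by (intro mult_left_mono) auto
    then show ?thesis using block_upper_bounds(1)[OF l n] by linarith
  qed
  have t: "t_norm E X i \<le> t_norm E X n"
    unfolding t_norm_eq by (intro tscale_mono s_norm_nonneg s_norm_mono i(2))
  have "\<alpha> * (s_norm E X n / t_norm E X n) \<le> \<alpha> * (l * s_norm E X i / t_norm E X i)"
    using s t \<alpha> t_norm_ge1[of i] s_norm_nonneg[of n] by (intro mult_left_mono frac_le) auto
  then have thr: "\<alpha> * s_norm E X n / t_norm E X n \<le> l * \<alpha> * s_norm E X i / t_norm E X i"
    by (simp add: mult.assoc mult.left_commute)
  have "trunc_excess E X p (l * \<alpha>) i i \<omega> \<le> trunc_excess E X p \<alpha> n i \<omega>" for \<omega>
  proof -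
    have "min \<bar>X i \<omega>\<bar> (a_norm E X i) \<le> min \<bar>X i \<omega>\<bar> (a_norm E X n)"
      using a_norm_mono[OF i(2)] by (intro min.mono) auto
    then have "max (min \<bar>X i \<omega>\<bar> (a_norm E X i) - l * \<alpha> * s_norm E X i / t_norm E X i) 0
        \<le> max (min \<bar>X i \<omega>\<bar> (a_norm E X n) - \<alpha> * s_norm E X n / t_norm E X n) 0"
      using thr by (intro max.mono) auto
    then show ?thesis unfolding trunc_excess_def using p by (intro powr_mono2) auto
  qed
  then have "E (trunc_excess E X p (l * \<alpha>) i i) \<le> E (trunc_excess E X p \<alpha> n i)"
    using p l \<alpha> i1 by (intro E_mono trunc_excess_H) auto
  then have "ereal (Gam E X p (l * \<alpha>) i) \<le> ereal (real_of_ereal (E (trunc_excess E X p \<alpha> n i)))"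
    using E_trunc_excess_self[of p "l * \<alpha>" i] E_trunc_excess(1)[of p \<alpha> i n] p l \<alpha> i1 by simp
  then show ?thesis by simp
qed

text \<open>Up to each n of the block, the sum of the \<open>Gam\<close> is at most
  \<open>Lam\<close> at n, so the weighted sum of \<open>powr_sum_le_weighted_sum\<close> turns into
  a sum of \<open>GL_term\<close>. Replacing a_n by l^k * t costs a factor l^2 before powers are
  taken, whence the power of l.\<close>

lemma block_Gam_powr_le:
  fixes k :: nat
  assumes l: "1 < l" and \<alpha>: "0 < \<alpha>" and p: "1 \<le> p" and d: "0 \<le> d"
  defines "I \<equiv> {Suc (block_end l k)..<Suc (block_end l (Suc k))}"
  shows "((\<Sum>i\<in>I. Gam E X p (l * \<alpha>) i) / (l ^ k * tscale (l ^ k)) powr p) powr (d + 1)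
    \<le> (d + 1) * l powr (2 * p * (d + 1)) * (\<Sum>n\<in>I. GL_term E X p d \<alpha> n)"
proof -
  \<comment> \<open>Extended by 0 to the index 0, because \<open>powr_sum_le_weighted_sum\<close>
    asks for nonnegativity at all indices.\<close>
  define \<gamma> where "\<gamma> i = (if 1 \<le> i then Gam E X p (l * \<alpha>) i else 0)" for i
  have \<gamma>0: "0 \<le> \<gamma> i" for i using Gam_nonneg[of p "l * \<alpha>" i] p l \<alpha> by (auto simp: \<gamma>_def)
  have eqI: "(\<Sum>i\<in>I. Gam E X p (l * \<alpha>) i) = (\<Sum>i\<in>I. \<gamma> i)"
    by (intro sum.cong) (auto simp: \<gamma>_def I_def)
  define A where "A = l ^ k * tscale (l ^ k)"
  have A: "0 < A" unfolding A_def using l tscale_gt1[of "l ^ k"] by (intro mult_pos_pos) auto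
  have step: "\<gamma> n * (\<Sum>i\<in>{Suc (block_end l k)..n}. \<gamma> i) powr d / A powr (p * (d + 1))
      \<le> l powr (2 * p * (d + 1)) * GL_term E X p d \<alpha> n" if n: "n \<in> I" for n
  proof -
    have n': "block_end l k < n" "n \<le> block_end l (Suc k)" "1 \<le> n" using n by (auto simp: I_def)
    let ?a = "a_norm E X n" and ?P = "\<Sum>i\<in>{Suc (block_end l k)..n}. \<gamma> i"
    have a: "0 < ?a" using A block_lower_bounds(2)[OF l n'(1)] by (simp add: A_def)
    have alA: "?a \<le> l\<^sup>2 * A" using block_upper_bounds(2)[OF l n'(2)] by (simp add: A_def)
    have g: "\<gamma> n \<le> Gam E X p \<alpha> n"
      using Gam_le_excess[OF l \<alpha> p n'(1) order_refl n'(2)] n'(3) by (simp add: \<gamma>_def Gam_def)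
    have "?P \<le> (\<Sum>i\<in>{Suc (block_end l k)..n}. real_of_ereal (E (trunc_excess E X p \<alpha> n i)))"
      using Gam_le_excess[OF l \<alpha> p _ _ n'(2)] by (intro sum_mono) (auto simp: \<gamma>_def)
    also have "\<dots> \<le> Lam E X p \<alpha> n"
      unfolding Lam_def using E_trunc_excess(2)[of p \<alpha> _ n] p \<alpha> by (intro sum_mono2) auto
    finally have L: "?P \<le> Lam E X p \<alpha> n" .
    have P0: "0 \<le> ?P" by (intro sum_nonneg \<gamma>0)
    have L0: "0 \<le> Lam E X p \<alpha> n" using P0 L by simp
    have "\<gamma> n * ?P powr d \<le> Gam E X p \<alpha> n * Lam E X p \<alpha> n powr d"
      using g L P0 \<gamma>0[of n] d by (intro mult_mono powr_mono2) auto
    also have "\<dots> = GL_term E X p d \<alpha> n * ?a powr (p * (d + 1))"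
      using a L0 by (simp add: GL_term_def powr_divide powr_powr distrib_left powr_add)
    also have "\<dots> \<le> GL_term E X p d \<alpha> n * (l\<^sup>2 * A) powr (p * (d + 1))"
    proof (rule mult_left_mono)
      show "?a powr (p * (d + 1)) \<le> (l\<^sup>2 * A) powr (p * (d + 1))"
        using alA a p d by (intro powr_mono2) auto
      show "0 \<le> GL_term E X p d \<alpha> n"
        unfolding GL_term_def using Gam_nonneg[of p \<alpha> n] p \<alpha> n'(3) by simp
    qed
    also have "(l\<^sup>2 * A) powr (p * (d + 1)) = l powr (2 * p * (d + 1)) * A powr (p * (d + 1))"
    proof -
      have "l\<^sup>2 = l powr 2" using l by simp
      then have "(l\<^sup>2) powr (p * (d + 1)) = l powr (2 * (p * (d + 1)))" by (simp only: powr_powr)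
      then show ?thesis using A l by (simp add: powr_mult mult.assoc)
    qed
    finally have "\<gamma> n * ?P powr d
        \<le> (l powr (2 * p * (d + 1)) * GL_term E X p d \<alpha> n) * A powr (p * (d + 1))"
      by (simp only: mult_ac)
    then show ?thesis using A by (simp add: pos_divide_le_eq)
  qed
  have "((\<Sum>i\<in>I. \<gamma> i) / A powr p) powr (d + 1) = (\<Sum>i\<in>I. \<gamma> i) powr (d + 1) / A powr (p * (d + 1))"
    using A \<gamma>0 by (simp add: powr_divide powr_powr sum_nonneg)
  also have "\<dots> \<le> ((d + 1) * (\<Sum>n\<in>I. \<gamma> n * (\<Sum>i\<in>{Suc (block_end l k)..n}. \<gamma> i) powr d)) / A powr (p * (d + 1))"
    unfolding I_def using A by (intro divide_right_mono powr_sum_le_weighted_sum \<gamma>0 d) auto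
  also have "\<dots> = (d + 1) * (\<Sum>n\<in>I. \<gamma> n * (\<Sum>i\<in>{Suc (block_end l k)..n}. \<gamma> i) powr d / A powr (p * (d + 1)))"
    by (simp only: sum_divide_distrib[symmetric] times_divide_eq_right)
  also have "\<dots> \<le> (d + 1) * (\<Sum>n\<in>I. l powr (2 * p * (d + 1)) * GL_term E X p d \<alpha> n)"
    using d by (intro mult_left_mono sum_mono step) auto
  finally show ?thesis
    unfolding eqI A_def by (simp only: sum_distrib_left[symmetric] mult.assoc)
qed

lemma summable_block_Gam:
  assumes l: "1 < l" and \<alpha>: "0 < \<alpha>" and p: "2 \<le> p" and d: "0 \<le> d"
    and GL: "summable (\<lambda>n. GL_term E X p d \<alpha> (Suc n))"
  shows "summable (\<lambda>k. ((\<Sum>i=1..block_end l (Suc k). Gam E X p (l * \<alpha>) i)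
    / (l ^ k * tscale (l ^ k)) powr p) powr (d + 1))"
proof -
  define \<gamma> where "\<gamma> i = Gam E X p (l * \<alpha>) i" for i
  have \<gamma>0: "0 \<le> \<gamma> i" if "1 \<le> i" for i
    unfolding \<gamma>_def using p l \<alpha> that by (intro Gam_nonneg) auto
  define A where "A k = l ^ k * tscale (l ^ k)" for k
  have A: "0 < A k" for k unfolding A_def using l tscale_gt1[of "l ^ k"] by (intro mult_pos_pos) auto
  define w where "w k = (\<Sum>i\<in>{Suc (block_end l k)..<Suc (block_end l (Suc k))}. \<gamma> i)" for k
  define G0 where "G0 = (\<Sum>i=1..block_end l 0. \<gamma> i)"
  \<comment> \<open>The indices before block 0, where s < 1, are joined to block 0. Only one term
    changes, so summability is recovered from the shifted series.\<close>
  define w' where "w' k = (if k = 0 then G0 + w 0 else w k)" for k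
  define v where "v k = w' k / A k powr p" for k
  have w0: "0 \<le> w k" "0 \<le> G0" for k unfolding w_def G0_def by (intro sum_nonneg \<gamma>0; simp)+
  have v0: "0 \<le> v k" for k using w0 by (auto simp: v_def w'_def)
  have GL0: "0 \<le> GL_term E X p d \<alpha> (Suc n)" for n
    unfolding GL_term_def using Gam_nonneg[of p \<alpha> "Suc n"] p \<alpha> by simp
  have bl: "summable (\<lambda>k. \<Sum>n\<in>{block_end l k..<block_end l (Suc k)}. GL_term E X p d \<alpha> (Suc n))"
    by (rule summable_block_sums[OF GL0 GL block_end_mono[OF l]])
  have "summable (\<lambda>k. (w k / A k powr p) powr (d + 1))"
  proof (rule summable_comparison_test'[where N = 0])
    show "summable (\<lambda>k. (d + 1) * l powr (2 * p * (d + 1))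
        * (\<Sum>n\<in>{block_end l k..<block_end l (Suc k)}. GL_term E X p d \<alpha> (Suc n)))"
      by (rule summable_mult[OF bl])
    show "norm ((w k / A k powr p) powr (d + 1)) \<le> (d + 1) * l powr (2 * p * (d + 1))
        * (\<Sum>n\<in>{block_end l k..<block_end l (Suc k)}. GL_term E X p d \<alpha> (Suc n))" for k
      using block_Gam_powr_le[of l \<alpha> p d k, OF l \<alpha> _ d] p
      unfolding w_def A_def \<gamma>_def sum.shift_bounds_Suc_ivl by simp
  qed
  then have "summable (\<lambda>k. (w (Suc k) / A (Suc k) powr p) powr (d + 1))"
    by (subst summable_Suc_iff)
  then have "summable (\<lambda>k. v (Suc k) powr (d + 1))" by (simp add: v_def w'_def)
  then have sv: "summable (\<lambda>k. v k powr (d + 1))" by (subst (asm) summable_Suc_iff)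
  have conv: "summable (\<lambda>k. (\<Sum>j\<le>k. v j * ((1 / l)\<^sup>2) ^ (k - j)) powr (d + 1))"
    using l d by (intro summable_geometric_convolution_powr v0 sv) auto
  have tot: "(\<Sum>i=1..block_end l (Suc k). \<gamma> i) = (\<Sum>j\<le>k. w' j)" for k
  proof (induction k)
    case 0
    have "1 \<le> Suc (block_end l 0)" "Suc (block_end l 0) \<le> Suc (block_end l (Suc 0))"
      using block_end_mono[OF l] by (auto simp: mono_def)
    from sum.atLeastLessThan_concat[OF this, of \<gamma>] show ?case
      by (simp add: w'_def w_def G0_def atLeastLessThanSuc_atLeastAtMost)
  next
    case (Suc k)
    have "1 \<le> Suc (block_end l (Suc k))" "Suc (block_end l (Suc k)) \<le> Suc (block_end l (Suc (Suc k)))"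
      using block_end_mono[OF l] by (auto simp: mono_def)
    from sum.atLeastLessThan_concat[OF this, of \<gamma>] Suc.IH show ?case
      by (simp add: w'_def w_def atLeastLessThanSuc_atLeastAtMost)
  qed
  have le: "(\<Sum>j\<le>k. w' j) / A k powr p \<le> (\<Sum>j\<le>k. v j * ((1 / l)\<^sup>2) ^ (k - j))" for k
    unfolding sum_divide_distrib
  proof (rule sum_mono)
    fix j assume "j \<in> {..k}"
    then have j: "j \<le> k" by simp
    have lk: "l ^ k = l ^ j * l ^ (k - j)" using j by (simp add: power_add[symmetric])
    have "A j * l ^ (k - j) = l ^ k * tscale (l ^ j)" by (simp add: A_def lk)
    also have "\<dots> \<le> A k"
      unfolding A_def using l j by (intro mult_left_mono tscale_mono) auto
    finally have "A j * l ^ (k - j) \<le> A k" .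
    then have "(A j * l ^ (k - j)) powr p \<le> A k powr p"
      using A[of j] l p by (intro powr_mono2) auto
    moreover have "(A j * l ^ (k - j)) powr p = A j powr p * (l ^ (k - j)) powr p"
      using A[of j] l by (simp add: powr_mult)
    \<comment> \<open>Here p \<ge> 2 enters: A grows at least like l^k, so the contribution of block
      j is damped by l^(-p(k-j)) \<le> l^(-2(k-j)).\<close>
    moreover have "(l ^ (k - j)) powr 2 \<le> (l ^ (k - j)) powr p"
      using l p by (intro powr_mono) auto
    moreover have "(l ^ (k - j)) powr 2 = (l\<^sup>2) ^ (k - j)"
      using l by (simp add: power_mult[symmetric] mult.commute)
    ultimately have "A j powr p * (l\<^sup>2) ^ (k - j) \<le> A k powr p"
      using mult_left_mono[of "(l\<^sup>2) ^ (k - j)" "(l ^ (k - j)) powr p" "A j powr p"] by simp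
    then have "w' j / A k powr p \<le> w' j / (A j powr p * (l\<^sup>2) ^ (k - j))"
      using A[of j] A[of k] l w0 by (intro divide_left_mono mult_pos_pos) (auto simp: w'_def)
    also have "\<dots> = v j * ((1 / l)\<^sup>2) ^ (k - j)"
      by (simp add: v_def power_divide power_one_over)
    finally show "w' j / A k powr p \<le> v j * ((1 / l)\<^sup>2) ^ (k - j)" .
  qed
  show ?thesis
  proof (rule summable_comparison_test'[OF conv, where N = 0])
    fix k
    have "0 \<le> (\<Sum>j\<le>k. w' j) / A k powr p"
      using w0 by (intro divide_nonneg_nonneg sum_nonneg) (auto simp: w'_def)
    then have "((\<Sum>j\<le>k. w' j) / A k powr p) powr (d + 1)
        \<le> (\<Sum>j\<le>k. v j * ((1 / l)\<^sup>2) ^ (k - j)) powr (d + 1)"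
      using le[of k] d by (intro powr_mono2) auto
    then show "norm (((\<Sum>i=1..block_end l (Suc k). Gam E X p (l * \<alpha>) i)
        / (l ^ k * tscale (l ^ k)) powr p) powr (d + 1))
        \<le> (\<Sum>j\<le>k. v j * ((1 / l)\<^sup>2) ^ (k - j)) powr (d + 1)"
      unfolding tot[symmetric] \<gamma>_def A_def by simp
  qed
qed

end

section \<open>Sequences of events with small tails\<close>

text \<open>The B j do not depend on m, so the union of all late A m lies in the union of the B j,
  which suits countable sub-additivity. Each single A m lies in finitely many B j, so finite unions
  of the A m can be handled with finite sub-additivity. The r j are real majorants of the values of
  F, so that sums are taken in the reals.\<close>

definition tail_null :: "'a set set \<Rightarrow> ('a set \<Rightarrow> ereal) \<Rightarrow> (nat \<Rightarrow> 'a set) \<Rightarrow> bool" where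
  "tail_null S F A \<longleftrightarrow> (\<forall>\<eta>>0. \<exists>n B r.
     (\<forall>j. B j \<in> S \<and> F (B j) \<le> ereal (r j) \<and> 0 \<le> r j) \<and> summable r \<and> suminf r \<le> \<eta> \<and>
     (\<forall>m\<ge>n. \<exists>J::nat. A m \<subseteq> (\<Union>j<J. B j)))"

lemma tail_nullE:
  fixes \<eta> :: real
  assumes "tail_null S F A" "0 < \<eta>"
  obtains B r n where "\<forall>j. B j \<in> S" "\<forall>j. F (B j) \<le> ereal (r j)" "\<forall>j. 0 \<le> r j"
    "summable r" "suminf r \<le> \<eta>" "\<forall>m\<ge>n. \<exists>J::nat. A m \<subseteq> (\<Union>j<J. B j)"
proof -
  from assms(1)[unfolded tail_null_def, THEN spec, THEN mp, OF assms(2)]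
  obtain n B r where *: "\<forall>j. B j \<in> S \<and> F (B j) \<le> ereal (r j) \<and> 0 \<le> r j"
    "summable r" "suminf r \<le> \<eta>" "\<forall>m\<ge>n. \<exists>J::nat. A m \<subseteq> (\<Union>j<J. B j)"
    by (elim exE conjE)
  show thesis
    by (rule that[of B r n]) (simp_all add: *)
qed

lemma tail_null_mono:
  assumes "tail_null S F A" "\<And>m. A' m \<subseteq> A m"
  shows "tail_null S F A'"
  unfolding tail_null_def
proof (intro allI impI)
  fix \<eta> :: real assume "0 < \<eta>"
  then obtain B r n where *: "\<forall>j. B j \<in> S" "\<forall>j. F (B j) \<le> ereal (r j)" "\<forall>j. 0 \<le> r j"
    "summable r" "suminf r \<le> \<eta>" "\<forall>m\<ge>n. \<exists>J::nat. A m \<subseteq> (\<Union>j<J. B j)"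
    by (rule tail_nullE[OF assms(1)])
  have cover: "\<exists>J::nat. A' m \<subseteq> (\<Union>j<J. B j)" if m: "n \<le> m" for m
  proof -
    obtain J :: nat where "A m \<subseteq> (\<Union>j<J. B j)" using *(6)[rule_format, OF m] by (elim exE)
    then have "A' m \<subseteq> (\<Union>j<J. B j)" using assms(2)[of m] by (rule subset_trans[rotated])
    then show ?thesis by (rule exI)
  qed
  show "\<exists>n B r. (\<forall>j. B j \<in> S \<and> F (B j) \<le> ereal (r j) \<and> 0 \<le> r j) \<and> summable r \<and>
      suminf r \<le> \<eta> \<and> (\<forall>m\<ge>n. \<exists>J::nat. A' m \<subseteq> (\<Union>j<J. B j))"
    by (rule exI[of _ n], rule exI[of _ B], rule exI[of _ r]) (simp add: * cover)
qed

lemma tail_null_Un: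
  assumes "tail_null S F A" "tail_null S F A'"
  shows "tail_null S F (\<lambda>m. A m \<union> A' m)"
  unfolding tail_null_def
proof (intro allI impI)
  fix \<eta> :: real assume "0 < \<eta>"
  then have \<eta>: "0 < \<eta> / 2" by simp
  obtain B r n where 1: "\<forall>j. B j \<in> S" "\<forall>j. F (B j) \<le> ereal (r j)" "\<forall>j. 0 \<le> r j"
    "summable r" "suminf r \<le> \<eta> / 2" "\<forall>m\<ge>n. \<exists>J::nat. A m \<subseteq> (\<Union>j<J. B j)"
    by (rule tail_nullE[OF assms(1) \<eta>])
  obtain B' r' n' where 2: "\<forall>j. B' j \<in> S" "\<forall>j. F (B' j) \<le> ereal (r' j)" "\<forall>j. 0 \<le> r' j"
    "summable r'" "suminf r' \<le> \<eta> / 2" "\<forall>m\<ge>n'. \<exists>J::nat. A' m \<subseteq> (\<Union>j<J. B' j)"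
    by (rule tail_nullE[OF assms(2) \<eta>])
  \<comment> \<open>The two covers are interleaved, so that finitely many sets of each lie in an
    initial segment of the new sequence.\<close>
  define B'' where "B'' j = (if even j then B (j div 2) else B' ((j - 1) div 2))" for j
  define r'' where "r'' j = (if even j then r (j div 2) else r' ((j - 1) div 2))" for j
  have sums: "r'' sums (suminf r' + suminf r)"
    unfolding r''_def[abs_def]
    using sums_if[OF summable_sums[OF 2(4)] summable_sums[OF 1(4)]] .
  have cover: "\<exists>J::nat. A m \<union> A' m \<subseteq> (\<Union>j<J. B'' j)" if m: "max n n' \<le> m" for m
  proof -
    have nm: "n \<le> m" "n' \<le> m" using m by auto
    obtain J where J: "A m \<subseteq> (\<Union>j<J. B j)" using 1(6)[rule_format, OF nm(1)] by (elim exE)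
    obtain J' where J': "A' m \<subseteq> (\<Union>j<J'. B' j)" using 2(6)[rule_format, OF nm(2)] by (elim exE)
    have "B j \<subseteq> (\<Union>j<2 * (J + J'). B'' j)" if "j < J" for j
    proof -
      have "B j = B'' (2 * j)" "2 * j < 2 * (J + J')" using that by (auto simp: B''_def)
      then show ?thesis by blast
    qed
    moreover have "B' j \<subseteq> (\<Union>j<2 * (J + J'). B'' j)" if "j < J'" for j
    proof -
      have "B' j = B'' (2 * j + 1)" "2 * j + 1 < 2 * (J + J')" using that by (auto simp: B''_def)
      then show ?thesis by blast
    qed
    ultimately have "(\<Union>j<J. B j) \<subseteq> (\<Union>j<2 * (J + J'). B'' j)" "(\<Union>j<J'. B' j) \<subseteq> (\<Union>j<2 * (J + J'). B'' j)"
      by (intro UN_least; simp)+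
    then have "A m \<union> A' m \<subseteq> (\<Union>j<2 * (J + J'). B'' j)"
      by (rule Un_least[OF subset_trans[OF J] subset_trans[OF J']])
    then show ?thesis by (rule exI)
  qed
  show "\<exists>n B r. (\<forall>j. B j \<in> S \<and> F (B j) \<le> ereal (r j) \<and> 0 \<le> r j) \<and> summable r \<and>
      suminf r \<le> \<eta> \<and> (\<forall>m\<ge>n. \<exists>J::nat. A m \<union> A' m \<subseteq> (\<Union>j<J. B j))"
  proof (intro exI[of _ "max n n'"] exI[of _ B''] exI[of _ r''] conjI)
    show "\<forall>j. B'' j \<in> S \<and> F (B'' j) \<le> ereal (r'' j) \<and> 0 \<le> r'' j"
      using 1(1-3) 2(1-3) by (simp add: B''_def r''_def)
    show "summable r''" using sums by (rule sums_summable)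
    show "suminf r'' \<le> \<eta>" using sums_unique[OF sums] 1(5) 2(5) by simp
    show "\<forall>m\<ge>max n n'. \<exists>J::nat. A m \<union> A' m \<subseteq> (\<Union>j<J. B'' j)" using cover by blast
  qed
qed

lemma capacity_UN_le:
  assumes "sub_additive M V" "capacity M V" "\<And>j. B j \<in> sets M"
  shows "V (\<Union>j<(J::nat). B j) \<le> (\<Sum>j<J. V (B j))"
proof (induction J)
  case 0
  show ?case using assms(2) by (simp add: capacity_def)
next
  case (Suc J)
  have "(\<Union>j<Suc J. B j) = (\<Union>j<J. B j) \<union> B J" by (auto simp: less_Suc_eq)
  then have "V (\<Union>j<Suc J. B j) \<le> V (\<Union>j<J. B j) + V (B J)"
    using assms(1)[unfolded sub_additive_def, rule_format, of "\<Union>j<J. B j" "B J"] assms(3) by auto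
  with Suc.IH show ?case by simp
qed

context diverging_sequence
begin

lemma X_measurable: "1 \<le> i \<Longrightarrow> X i \<in> borel_measurable M"
  using X_H H_measurable by blast

lemma trunc_sum_measurable: "trunc_sum y m \<in> borel_measurable M"
  unfolding trunc_sum_def[abs_def]
  by (intro borel_measurable_sum borel_measurable_min borel_measurable_const) (auto intro: X_measurable)

lemma ex_block:
  assumes l: "1 < l" and m: "block_end l K < m"
  obtains k where "K \<le> k" "block_end l k < m" "m \<le> block_end l (Suc k)"
proof -
  obtain j where "s_norm E X m < l ^ j" using real_arch_pow[OF l] by blast
  also have "\<dots> \<le> l ^ Suc j" using l by simp
  finally have ex: "m \<le> block_end l (Suc j)" using le_block_end_iff[of l m "Suc j"] l by simp
  define k where "k = (LEAST k. m \<le> block_end l (Suc k))"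
  have k: "m \<le> block_end l (Suc k)" unfolding k_def by (rule LeastI[of "\<lambda>k. m \<le> block_end l (Suc k)", OF ex])
  have mono: "block_end l i \<le> block_end l j" if "i \<le> j" for i j
    using block_end_mono[OF l] that by (auto simp: mono_def)
  have Kk: "K \<le> k"
  proof (rule ccontr)
    assume "\<not> K \<le> k"
    then have "block_end l (Suc k) \<le> block_end l K" by (intro mono) simp
    with k m show False by simp
  qed
  have "block_end l k < m"
  proof (cases "k = K")
    case False
    then have "k - 1 < k" "Suc (k - 1) = k" using Kk by auto
    then show ?thesis using not_less_Least[of "k - 1" "\<lambda>k. m \<le> block_end l (Suc k)"]
      by (simp add: k_def[symmetric])
  qed (use m in simp)
  with Kk k show thesis by (intro that)
qed

lemma tail_null_trunc_sum:
  assumes \<epsilon>: "0 < \<epsilon>"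
    and GL: "\<And>\<alpha>::real. \<alpha> > 0 \<Longrightarrow> \<exists>p\<ge>2. \<exists>d\<ge>0. summable (\<lambda>n. GL_term E X p d \<alpha> (Suc n))"
  obtains \<delta> where "0 < \<delta>" "tail_null (sets M) (V_hat M H E) (\<lambda>m. {\<omega> \<in> space M.
    (1 + \<epsilon>) * a_norm E X m < trunc_sum (\<lambda>i. \<delta> * a_norm E X i) m \<omega> - (\<Sum>i=1..m. mean i)})"
proof -
  \<comment> \<open>The fourth root of 1 + \<epsilon>: both l^2 and exp(2 * \<alpha> * l^2) then
    equal sqrt(1 + \<epsilon>), and their product is exactly the allowed 1 + \<epsilon>.\<close>
  define l where "l = sqrt (sqrt (1 + \<epsilon>))"
  have l: "1 < l" using \<epsilon> by (simp add: l_def)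
  have l2: "l\<^sup>2 = sqrt (1 + \<epsilon>)" using \<epsilon> by (simp add: l_def)
  define \<alpha> where "\<alpha> = ln (1 + \<epsilon>) / (4 * l\<^sup>2)"
  have \<alpha>: "0 < \<alpha>" using \<epsilon> l by (simp add: \<alpha>_def)
  have "2 * \<alpha> * l\<^sup>2 = ln (sqrt (1 + \<epsilon>))" using \<epsilon> l by (simp add: \<alpha>_def ln_sqrt)
  then have ex: "exp (2 * \<alpha> * l\<^sup>2) * l\<^sup>2 \<le> 1 + \<epsilon>" using \<epsilon> by (simp add: l2)
  obtain p d where p: "2 \<le> p" and d: "0 \<le> d"
    and sm: "summable (\<lambda>n. GL_term E X p d \<alpha> (Suc n))" using GL[OF \<alpha>] by blast
  \<comment> \<open>The truncation level depends on p and d, which are known only after \<alpha> is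
    fixed; this is why exceedances must be controlled at arbitrary multiples of a_n.\<close>
  define \<delta> where "\<delta> = 1 / (4 * p * (d + 1) * l\<^sup>2)"
  have \<delta>: "0 < \<delta>" unfolding \<delta>_def using p d l by (intro divide_pos_pos mult_pos_pos) auto
  have D: "1 \<le> d + 1" using d by simp
  define Ev where "Ev k = {\<omega> \<in> space M. \<exists>m\<le>block_end l (Suc k). (1 + \<epsilon>) * (l ^ k * tscale (l ^ k))
        < trunc_sum (\<lambda>i. \<delta> * a_norm E X i) m \<omega> - (\<Sum>i=1..m. mean i)}" for k
  obtain C where C: "0 < C" "\<And>k. V_hat M H E (Ev k)
    \<le> ereal (4 * (C * (exp (- (1 + \<epsilon>) * (tscale (l ^ k))\<^sup>2 / 2)
        + ((\<Sum>i=1..block_end l (Suc k). Gam E X p (l * \<alpha>) i) / (l ^ k * tscale (l ^ k)) powr p) powr (d + 1))))"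
    using block_deviation_bound[OF l \<alpha> \<epsilon> ex p D] unfolding Ev_def \<delta>_def by blast
  define r where "r k = 4 * (C * (exp (- (1 + \<epsilon>) * (tscale (l ^ k))\<^sup>2 / 2)
        + ((\<Sum>i=1..block_end l (Suc k). Gam E X p (l * \<alpha>) i) / (l ^ k * tscale (l ^ k)) powr p) powr (d + 1)))" for k
  have r0: "0 \<le> r k" for k using C(1) by (simp add: r_def)
  have sr: "summable r" unfolding r_def[abs_def]
    by (intro summable_mult summable_add summable_exp_tscale[OF l \<epsilon>] summable_block_Gam[OF l \<alpha> p d sm])
  have Ev_sets: "Ev k \<in> sets M" for k
    unfolding Ev_def using trunc_sum_measurable by measurable
  show thesis
  proof (rule that[OF \<delta>], unfold tail_null_def, intro allI impI)
    fix \<eta> :: real assume "0 < \<eta>"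
    from suminf_exist_split[OF this sr] obtain K where K: "norm (\<Sum>i. r (i + K)) < \<eta>" by blast
    let ?A = "\<lambda>m. {\<omega> \<in> space M.
      (1 + \<epsilon>) * a_norm E X m < trunc_sum (\<lambda>i. \<delta> * a_norm E X i) m \<omega> - (\<Sum>i=1..m. mean i)}"
    have cover: "\<exists>J::nat. ?A m \<subseteq> (\<Union>j<J. Ev (j + K))" if m: "Suc (block_end l K) \<le> m" for m
    proof -
      obtain k where k: "K \<le> k" "block_end l k < m" "m \<le> block_end l (Suc k)"
        using ex_block[OF l, of K m] m by auto
      have "(1 + \<epsilon>) * (l ^ k * tscale (l ^ k)) \<le> (1 + \<epsilon>) * a_norm E X m"
        using \<epsilon> by (intro mult_left_mono block_lower_bounds(2)[OF l k(2)]) auto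
      then have "?A m \<subseteq> Ev k" unfolding Ev_def using k(3) by fastforce
      also have "Ev k = Ev ((k - K) + K)" using k(1) by simp
      finally show ?thesis by (intro exI[of _ "Suc (k - K)"]) blast
    qed
    show "\<exists>n B r. (\<forall>j. B j \<in> sets M \<and> V_hat M H E (B j) \<le> ereal (r j) \<and> 0 \<le> r j) \<and> summable r \<and>
      suminf r \<le> \<eta> \<and> (\<forall>m\<ge>n. \<exists>J::nat. ?A m \<subseteq> (\<Union>j<J. B j))"
    proof (intro exI[of _ "Suc (block_end l K)"] exI[of _ "\<lambda>j. Ev (j + K)"] exI[of _ "\<lambda>j. r (j + K)"] conjI)
      show "\<forall>j. Ev (j + K) \<in> sets M \<and> V_hat M H E (Ev (j + K)) \<le> ereal (r (j + K)) \<and> 0 \<le> r (j + K)"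
        using Ev_sets C(2) r0 by (simp add: r_def)
      show "summable (\<lambda>j. r (j + K))" using sr by (rule summable_ignore_initial_segment)
      show "(\<Sum>j. r (j + K)) \<le> \<eta>" using K by simp
      show "\<forall>m\<ge>Suc (block_end l K). \<exists>J::nat. ?A m \<subseteq> (\<Union>j<J. Ev (j + K))" using cover by blast
    qed
  qed
qed

text \<open>Property (C) speaks of functions in \<open>H\<close>, so V can bound
  \<open>V_hat\<close> only across a gap: a Lipschitz ramp from level b to level 2b lies above the
  indicator of X > 2b and below that of |X| \<ge> b, and (C) bounds its expectation by V.\<close>

lemma V_hat_exceedance_le:
  assumes C: "property_C M H E V" and \<delta>: "0 < \<delta>" and i: "1 \<le> i" and a: "0 < a_norm E X i"
  shows "V_hat M H E {\<omega> \<in> space M. \<delta> * a_norm E X i < X i \<omega>}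
    \<le> ereal (V {\<omega> \<in> space M. \<delta> / 2 * a_norm E X i \<le> \<bar>X i \<omega>\<bar>})"
proof -
  define b where "b = \<delta> / 2 * a_norm E X i"
  have b: "0 < b" "\<delta> * a_norm E X i = 2 * b" using a \<delta> by (auto simp: b_def)
  define g where "g u = max 0 (min 1 (\<bar>u\<bar> / b - 1))" for u :: real
  have lip: "(1 / b)-lipschitz_on UNIV g"
  proof (rule lipschitz_onI)
    fix u v :: real
    have "\<bar>g u - g v\<bar> \<le> \<bar>\<bar>u\<bar> / b - \<bar>v\<bar> / b\<bar>" unfolding g_def by linarith
    also have "\<dots> = \<bar>\<bar>u\<bar> - \<bar>v\<bar>\<bar> / b" using b by (simp add: diff_divide_distrib[symmetric])
    also have "\<dots> \<le> \<bar>u - v\<bar> / b" using b by (intro divide_right_mono abs_triangle_ineq3) auto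
    finally show "dist (g u) (g v) \<le> 1 / b * dist u v" by (simp add: dist_real_def)
  qed (use b in simp)
  have gH: "(\<lambda>\<omega>. g (X i \<omega>)) \<in> H" by (rule lipschitz_H[OF lip X_H[OF i]])
  have m1: "{\<omega> \<in> space M. b \<le> \<bar>X i \<omega>\<bar>} \<in> sets M"
    using X_measurable[OF i] by measurable
  have "V_hat M H E {\<omega> \<in> space M. \<delta> * a_norm E X i < X i \<omega>} \<le> E (\<lambda>\<omega>. g (X i \<omega>))"
  proof (rule V_hat_le[OF gH])
    fix \<omega>
    have "g (X i \<omega>) = 1" if "2 * b < X i \<omega>"
    proof -
      have "2 \<le> \<bar>X i \<omega>\<bar> / b" using that b by (simp add: pos_le_divide_eq)
      then show ?thesis by (simp add: g_def)
    qed
    moreover have "0 \<le> g (X i \<omega>)" by (simp add: g_def)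
    ultimately show "indicator {\<omega> \<in> space M. \<delta> * a_norm E X i < X i \<omega>} \<omega> \<le> g (X i \<omega>)"
      unfolding b(2) by (simp add: indicator_def)
  qed
  also have "\<dots> \<le> ereal (V {\<omega> \<in> space M. b \<le> \<bar>X i \<omega>\<bar>})"
  proof -
    have "\<forall>\<omega>\<in>space M. g (X i \<omega>) \<le> indicator {\<omega> \<in> space M. b \<le> \<bar>X i \<omega>\<bar>} \<omega>
        \<and> indicator {\<omega> \<in> space M. b \<le> \<bar>X i \<omega>\<bar>} \<omega> \<le> (1::real)"
    proof
      fix \<omega> assume \<omega>: "\<omega> \<in> space M"
      have "g (X i \<omega>) = 0" if "\<not> b \<le> \<bar>X i \<omega>\<bar>"
      proof -
        have "\<bar>X i \<omega>\<bar> / b < 1" using that b by (simp add: pos_divide_less_eq)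
        then show ?thesis by (simp add: g_def)
      qed
      moreover have "g (X i \<omega>) \<le> 1" by (simp add: g_def)
      ultimately show "g (X i \<omega>) \<le> indicator {\<omega> \<in> space M. b \<le> \<bar>X i \<omega>\<bar>} \<omega>
          \<and> indicator {\<omega> \<in> space M. b \<le> \<bar>X i \<omega>\<bar>} \<omega> \<le> (1::real)"
        using \<omega> by (auto simp: indicator_def)
    qed
    with C gH H_const[of 1] m1 show ?thesis unfolding property_C_def by simp
  qed
  finally show ?thesis by (simp add: b_def)
qed

text \<open>The difference is the sum of the parts cut off. The first n0 variables contribute little
  against a_n by Markov's inequality, and the others nothing unless one of them exceeds its level,
  which has a small total \<open>V_hat\<close>.\<close>

lemma tail_null_excess:
  assumes C: "property_C M H E V" and cap: "capacity M V"
    and \<delta>: "0 < \<delta>" and \<epsilon>: "0 < \<epsilon>"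
    and sV: "\<And>\<epsilon>::real. \<epsilon> > 0 \<Longrightarrow>
           summable (\<lambda>n. V {\<omega> \<in> space M. \<bar>X (Suc n) \<omega>\<bar> \<ge> \<epsilon> * a_norm E X (Suc n)})"
  shows "tail_null (sets M) (V_hat M H E) (\<lambda>m. {\<omega> \<in> space M.
    \<epsilon> * a_norm E X m < S_part X m \<omega> - trunc_sum (\<lambda>i. \<delta> * a_norm E X i) m \<omega>})"
  unfolding tail_null_def
proof (intro allI impI)
  fix \<eta> :: real assume \<eta>: "0 < \<eta>"
  define q where "q n = V {\<omega> \<in> space M. \<delta> / 2 * a_norm E X (Suc n) \<le> \<bar>X (Suc n) \<omega>\<bar>}" for n
  have q0: "0 \<le> q n" for n
  proof -
    have "{\<omega> \<in> space M. \<delta> / 2 * a_norm E X (Suc n) \<le> \<bar>X (Suc n) \<omega>\<bar>} \<in> sets M"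
      using X_measurable[of "Suc n"] by measurable
    then show ?thesis using cap unfolding q_def capacity_def by blast
  qed
  have sq: "summable q" unfolding q_def using sV[of "\<delta> / 2"] \<delta> by simp
  obtain n1 where n1: "\<And>n. n1 \<le> n \<Longrightarrow> norm (\<Sum>i. q (i + n)) < \<eta> / 2"
    using suminf_exist_split[of "\<eta> / 2" q] sq \<eta> by auto
  obtain n2 where n2: "\<And>n. n2 \<le> n \<Longrightarrow> 1 \<le> a_norm E X n"
    using a_norm_at_top unfolding filterlim_at_top eventually_sequentially by blast
  define n0 where "n0 = max n1 n2"
  define K where "K = (\<Sum>i=1..n0. real_of_ereal (E (\<lambda>\<omega>. \<bar>X i \<omega>\<bar>)))"
  obtain n3 where n3: "\<And>n. n3 \<le> n \<Longrightarrow> K * 2 / (\<epsilon> * \<eta>) \<le> a_norm E X n"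
    using a_norm_at_top unfolding filterlim_at_top eventually_sequentially by blast
  \<comment> \<open>Chosen after n0, since K depends on n0: now a_n is so large that the Markov
    bound K / (\<epsilon> * a_n) takes the half of \<eta> left by the tail of q.\<close>
  define n where "n = max n0 n3"
  have an: "1 \<le> a_norm E X n" using n2[of n] by (simp add: n_def n0_def)
  have "K * 2 / (\<epsilon> * \<eta>) \<le> a_norm E X n" using n3[of n] by (simp add: n_def)
  then have Kle: "K / (\<epsilon> * a_norm E X n) \<le> \<eta> / 2"
    using \<epsilon> \<eta> an by (simp add: field_simps)
  have aH: "(\<lambda>\<omega>. \<bar>X i \<omega>\<bar>) \<in> H" "integ (\<lambda>\<omega>. \<bar>X i \<omega>\<bar>)" if "1 \<le> i" for i
    using X_integ[OF that] abs_H by (auto simp: integ_def)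
  have K0: "0 \<le> K"
    unfolding K_def
  proof (rule sum_nonneg)
    fix i assume "i \<in> {1..n0}"
    then have "0 \<le> E (\<lambda>\<omega>. \<bar>X i \<omega>\<bar>)" by (intro E_nonneg aH) auto
    then show "0 \<le> real_of_ereal (E (\<lambda>\<omega>. \<bar>X i \<omega>\<bar>))" by (rule real_of_ereal_pos)
  qed
  \<comment> \<open>Index 0 is the Markov event for the first n0 variables; index j + 1 is the
    exceedance by the variable number j + n0 + 1.\<close>
  define B where "B j = (case j of 0 \<Rightarrow> {\<omega> \<in> space M. \<epsilon> * a_norm E X n < (\<Sum>i=1..n0. \<bar>X i \<omega>\<bar>)}
    | Suc j \<Rightarrow> {\<omega> \<in> space M. \<delta> * a_norm E X (Suc (j + n0)) < X (Suc (j + n0)) \<omega>})" for j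
  define r where "r j = (case j of 0 \<Rightarrow> K / (\<epsilon> * a_norm E X n) | Suc j \<Rightarrow> q (j + n0))" for j
  have sumH: "(\<lambda>\<omega>. \<Sum>i=1..n0. \<bar>X i \<omega>\<bar>) \<in> H" by (intro sum_H aH) auto
  have B0: "V_hat M H E (B 0) \<le> ereal (r 0)"
  proof -
    let ?c = "1 / (\<epsilon> * a_norm E X n)"
    have c: "0 < ?c" using \<epsilon> an by simp
    have "V_hat M H E (B 0) \<le> E (\<lambda>\<omega>. ?c * (\<Sum>i=1..n0. \<bar>X i \<omega>\<bar>))"
    proof (rule V_hat_le[OF H_scale[OF sumH]])
      fix \<omega>
      have "0 \<le> ?c * (\<Sum>i=1..n0. \<bar>X i \<omega>\<bar>)" using c by (intro mult_nonneg_nonneg sum_nonneg) auto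
      moreover have "1 \<le> ?c * (\<Sum>i=1..n0. \<bar>X i \<omega>\<bar>)" if "\<epsilon> * a_norm E X n < (\<Sum>i=1..n0. \<bar>X i \<omega>\<bar>)"
        using that \<epsilon> an by (simp add: pos_le_divide_eq)
      ultimately show "indicator (B 0) \<omega> \<le> ?c * (\<Sum>i=1..n0. \<bar>X i \<omega>\<bar>)"
        unfolding B_def by (simp add: indicator_def)
    qed
    also have "\<dots> \<le> ereal (?c * K)"
    proof (rule E_scale_le[OF sumH])
      show "E (\<lambda>\<omega>. \<Sum>i=1..n0. \<bar>X i \<omega>\<bar>) \<le> ereal K"
        unfolding K_def
      proof (rule E_sum_le)
        fix i assume "i \<in> {1..n0}"
        then show "E (\<lambda>\<omega>. \<bar>X i \<omega>\<bar>) \<le> ereal (real_of_ereal (E (\<lambda>\<omega>. \<bar>X i \<omega>\<bar>)))"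
          using integ_real[OF aH(2)[of i]] by simp
      qed (auto intro: aH)
    qed (use c in simp)
    finally show ?thesis by (simp add: r_def)
  qed
  have BS: "V_hat M H E (B (Suc j)) \<le> ereal (r (Suc j))" for j
  proof -
    have "1 \<le> a_norm E X (Suc (j + n0))" by (rule n2) (simp add: n0_def)
    then have "0 < a_norm E X (Suc (j + n0))" by linarith
    from V_hat_exceedance_le[OF C \<delta> _ this] show ?thesis by (simp add: B_def r_def q_def)
  qed
  have Bsets: "B j \<in> sets M" for j
  proof (cases j)
    case 0
    have "(\<lambda>\<omega>. \<Sum>i=1..n0. \<bar>X i \<omega>\<bar>) \<in> borel_measurable M" using sumH H_measurable by blast
    then show ?thesis unfolding B_def 0 by simp
  next
    case (Suc k)
    show ?thesis unfolding B_def Suc using X_measurable[of "Suc (k + n0)"] by simp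
  qed
  have shift: "summable (\<lambda>j. q (j + n0))" using sq by (rule summable_ignore_initial_segment)
  have sr: "summable r"
  proof -
    have "summable (\<lambda>j. r (Suc j))" using shift by (simp add: r_def)
    then show ?thesis by (subst (asm) summable_Suc_iff)
  qed
  have sumr: "suminf r \<le> \<eta>"
  proof -
    have "suminf r = r 0 + (\<Sum>j. r (Suc j))" using suminf_split_head[OF sr] by simp
    also have "\<dots> = K / (\<epsilon> * a_norm E X n) + (\<Sum>j. q (j + n0))" by (simp add: r_def)
    also have "\<dots> \<le> \<eta> / 2 + \<eta> / 2" using Kle n1[of n0] by (intro add_mono) (auto simp: n0_def)
    finally show ?thesis by simp
  qed
  let ?A = "\<lambda>m. {\<omega> \<in> space M.
    \<epsilon> * a_norm E X m < S_part X m \<omega> - trunc_sum (\<lambda>i. \<delta> * a_norm E X i) m \<omega>}"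
  have cover: "?A m \<subseteq> (\<Union>j<Suc m. B j)" if m: "n \<le> m" for m
  proof
    fix \<omega> assume \<omega>: "\<omega> \<in> ?A m"
    show "\<omega> \<in> (\<Union>j<Suc m. B j)"
    proof (rule ccontr)
      assume no: "\<omega> \<notin> (\<Union>j<Suc m. B j)"
      have n0m: "n0 \<le> m" using m by (simp add: n_def)
      have small: "X i \<omega> \<le> \<delta> * a_norm E X i" if "n0 < i" "i \<le> m" for i
      proof -
        have i: "Suc ((i - Suc n0) + n0) = i" "Suc (i - Suc n0) < Suc m" using that by auto
        then have "\<omega> \<notin> B (Suc (i - Suc n0))" using no by blast
        then show ?thesis using \<omega> i(1) unfolding B_def by simp
      qed
      have "S_part X m \<omega> - trunc_sum (\<lambda>i. \<delta> * a_norm E X i) m \<omega>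
          = (\<Sum>i=1..m. X i \<omega> - min (X i \<omega>) (\<delta> * a_norm E X i))"
        by (simp add: S_part_def trunc_sum_def sum_subtractf)
      also have "\<dots> = (\<Sum>i=1..n0. X i \<omega> - min (X i \<omega>) (\<delta> * a_norm E X i))"
        using n0m small by (intro sum.mono_neutral_right) auto
      also have "\<dots> \<le> (\<Sum>i=1..n0. \<bar>X i \<omega>\<bar>)"
      proof (rule sum_mono)
        fix i
        have "0 \<le> \<delta> * a_norm E X i" using \<delta> a_norm_nonneg[of i] by simp
        then show "X i \<omega> - min (X i \<omega>) (\<delta> * a_norm E X i) \<le> \<bar>X i \<omega>\<bar>" by linarith
      qed
      finally have "\<epsilon> * a_norm E X m < (\<Sum>i=1..n0. \<bar>X i \<omega>\<bar>)" using \<omega> by simp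
      moreover have "\<epsilon> * a_norm E X n \<le> \<epsilon> * a_norm E X m"
        using \<epsilon> by (intro mult_left_mono a_norm_mono m) auto
      ultimately have "\<omega> \<in> B 0" using \<omega> by (simp add: B_def)
      with no show False by blast
    qed
  qed
  show "\<exists>n B r. (\<forall>j. B j \<in> sets M \<and> V_hat M H E (B j) \<le> ereal (r j) \<and> 0 \<le> r j) \<and> summable r \<and>
      suminf r \<le> \<eta> \<and> (\<forall>m\<ge>n. \<exists>J::nat. ?A m \<subseteq> (\<Union>j<J. B j))"
  proof (intro exI[of _ n] exI[of _ B] exI[of _ r] conjI)
    have "V_hat M H E (B j) \<le> ereal (r j)" for j using B0 BS by (cases j) auto
    moreover have "0 \<le> r j" for j using K0 q0 \<epsilon> an by (cases j) (auto simp: r_def)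
    ultimately show "\<forall>j. B j \<in> sets M \<and> V_hat M H E (B j) \<le> ereal (r j) \<and> 0 \<le> r j"
      using Bsets by blast
    show "summable r" by (rule sr)
    show "suminf r \<le> \<eta>" by (rule sumr)
    show "\<forall>m\<ge>n. \<exists>J::nat. ?A m \<subseteq> (\<Union>j<J. B j)" using cover by blast
  qed
qed

lemma tail_null_dev_upper:
  assumes C: "property_C M H E V" and cap: "capacity M V" and \<epsilon>: "0 < \<epsilon>"
    and sV: "\<And>\<epsilon>::real. \<epsilon> > 0 \<Longrightarrow>
           summable (\<lambda>n. V {\<omega> \<in> space M. \<bar>X (Suc n) \<omega>\<bar> \<ge> \<epsilon> * a_norm E X (Suc n)})"
    and GL: "\<And>\<alpha>::real. \<alpha> > 0 \<Longrightarrow> \<exists>p\<ge>2. \<exists>d\<ge>0. summable (\<lambda>n. GL_term E X p d \<alpha> (Suc n))"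
  shows "tail_null (sets M) (V_hat M H E) (\<lambda>m. {\<omega> \<in> space M. 1 + \<epsilon> < dev_upper E X m \<omega>})"
proof -
  have \<epsilon>2: "0 < \<epsilon> / 2" using \<epsilon> by simp
  obtain \<delta> where \<delta>: "0 < \<delta>" and t1: "tail_null (sets M) (V_hat M H E) (\<lambda>m. {\<omega> \<in> space M.
    (1 + \<epsilon> / 2) * a_norm E X m < trunc_sum (\<lambda>i. \<delta> * a_norm E X i) m \<omega> - (\<Sum>i=1..m. mean i)})"
    using tail_null_trunc_sum[OF \<epsilon>2 GL] by blast
  have t2: "tail_null (sets M) (V_hat M H E) (\<lambda>m. {\<omega> \<in> space M.
    \<epsilon> / 2 * a_norm E X m < S_part X m \<omega> - trunc_sum (\<lambda>i. \<delta> * a_norm E X i) m \<omega>})"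
    by (rule tail_null_excess[OF C cap \<delta> \<epsilon>2 sV])
  show ?thesis
  proof (rule tail_null_mono[OF tail_null_Un[OF t1 t2]], rule subsetI)
    fix m \<omega> assume "\<omega> \<in> {\<omega> \<in> space M. 1 + \<epsilon> < dev_upper E X m \<omega>}"
    then have \<omega>: "\<omega> \<in> space M" "1 + \<epsilon> < dev_upper E X m \<omega>" by auto
    have dev: "dev_upper E X m \<omega> = (S_part X m \<omega> - (\<Sum>i=1..m. mean i)) / a_norm E X m"
      unfolding dev_upper_def E_S_part mean_def by simp
    \<comment> \<open>Division by zero yields 0, so an exceedance of 1 + \<epsilon> excludes a_m =
      0.\<close>
    have "a_norm E X m \<noteq> 0" using \<omega>(2) \<epsilon> unfolding dev by (intro notI) simp
    then have "0 < a_norm E X m" using a_norm_nonneg[of m] by simp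
    then have "(1 + \<epsilon>) * a_norm E X m < S_part X m \<omega> - (\<Sum>i=1..m. mean i)"
      using \<omega>(2) unfolding dev by (simp add: pos_less_divide_eq)
    moreover have "(1 + \<epsilon>) * a_norm E X m = (1 + \<epsilon> / 2) * a_norm E X m + \<epsilon> / 2 * a_norm E X m"
      by (simp add: algebra_simps)
    ultimately have "(1 + \<epsilon> / 2) * a_norm E X m
          < trunc_sum (\<lambda>i. \<delta> * a_norm E X i) m \<omega> - (\<Sum>i=1..m. mean i)
        \<or> \<epsilon> / 2 * a_norm E X m < S_part X m \<omega> - trunc_sum (\<lambda>i. \<delta> * a_norm E X i) m \<omega>"
      by linarith
    then show "\<omega> \<in> {\<omega> \<in> space M.
        (1 + \<epsilon> / 2) * a_norm E X m < trunc_sum (\<lambda>i. \<delta> * a_norm E X i) m \<omega> - (\<Sum>i=1..m. mean i)}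
      \<union> {\<omega> \<in> space M.
        \<epsilon> / 2 * a_norm E X m < S_part X m \<omega> - trunc_sum (\<lambda>i. \<delta> * a_norm E X i) m \<omega>}"
      using \<omega>(1) by blast
  qed
qed

end

section \<open>Symmetry and the limit statements\<close>

lemma C_lLip_uminus:
  assumes "\<phi> \<in> C_lLip n"
  shows "(\<lambda>x. \<phi> (\<lambda>i. - x i)) \<in> C_lLip n"
proof -
  obtain C m where C: "0 < C" "\<And>x y. \<bar>\<phi> x - \<phi> y\<bar> \<le> C * (1 + L2_set x {..<n} ^ m + L2_set y {..<n} ^ m)
                      * L2_set (\<lambda>i. x i - y i) {..<n}"
    using assms unfolding C_lLip_def by blast
  have neg: "L2_set (\<lambda>i. - x i) {..<n} = L2_set x {..<n}" for x by (simp add: L2_set_def)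
  have diff: "L2_set (\<lambda>i. - x i - - y i) {..<n} = L2_set (\<lambda>i. x i - y i) {..<n}" for x y :: "nat \<Rightarrow> real"
    by (simp add: L2_set_def power2_commute)
  have "\<bar>\<phi> (\<lambda>i. - x i) - \<phi> (\<lambda>i. - y i)\<bar>
      \<le> C * (1 + L2_set x {..<n} ^ m + L2_set y {..<n} ^ m) * L2_set (\<lambda>i. x i - y i) {..<n}" for x y
    using C(2)[of "\<lambda>i. - x i" "\<lambda>i. - y i"] by (simp only: neg diff)
  with C(1) show ?thesis unfolding C_lLip_def by blast
qed

lemma independent_to_uminus:
  assumes ind: "independent_to H E n Y m X" and H: "\<And>Z. Z \<in> H \<Longrightarrow> (\<lambda>\<omega>. - Z \<omega>) \<in> H"
  shows "independent_to H E n (\<lambda>i \<omega>. - Y i \<omega>) m (\<lambda>i \<omega>. - X i \<omega>)"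
  unfolding independent_to_def Let_def
proof (intro conjI ballI impI)
  show "\<forall>i<n. (\<lambda>\<omega>. - Y i \<omega>) \<in> H" "\<forall>i<m. (\<lambda>\<omega>. - X i \<omega>) \<in> H"
    using ind H by (auto simp: independent_to_def)
  fix \<phi> :: "(nat \<Rightarrow> real) \<Rightarrow> real" assume \<phi>: "\<phi> \<in> C_lLip (m + n)"
  \<comment> \<open>Reflecting the test function moves the sign from the variables to \<phi>, and
    \<open>C_lLip\<close> is invariant under this.\<close>
  define \<phi>' where "\<phi>' z = \<phi> (\<lambda>i. - z i)" for z
  have \<phi>': "\<phi>' \<in> C_lLip (m + n)" unfolding \<phi>'_def[abs_def] by (rule C_lLip_uminus[OF \<phi>])
  have flip: "\<phi> (vec_append m x (\<lambda>i. - y i)) = \<phi>' (vec_append m (\<lambda>i. - x i) y)" for x y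
    unfolding \<phi>'_def by (rule arg_cong[of _ _ \<phi>]) (auto simp: vec_append_def)
  let ?b = "\<lambda>x. E (\<lambda>\<omega>. \<bar>\<phi>' (vec_append m x (\<lambda>i. Y i \<omega>))\<bar>)"
  let ?e = "\<lambda>x. E (\<lambda>\<omega>. \<phi>' (vec_append m x (\<lambda>i. Y i \<omega>)))"
  assume fin: "\<forall>x. E (\<lambda>\<omega>. \<bar>\<phi> (vec_append m x (\<lambda>i. - Y i \<omega>))\<bar>) < \<infinity>"
    and h1: "(\<lambda>\<omega>. real_of_ereal (E (\<lambda>\<omega>'. \<bar>\<phi> (vec_append m (\<lambda>i. - X i \<omega>) (\<lambda>i. - Y i \<omega>'))\<bar>))) \<in> H"
    and h2: "(\<lambda>\<omega>. real_of_ereal (E (\<lambda>\<omega>'. \<phi> (vec_append m (\<lambda>i. - X i \<omega>) (\<lambda>i. - Y i \<omega>'))))) \<in> H"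
    and h3: "E (\<lambda>\<omega>. \<bar>real_of_ereal (E (\<lambda>\<omega>'. \<bar>\<phi> (vec_append m (\<lambda>i. - X i \<omega>) (\<lambda>i. - Y i \<omega>'))\<bar>))\<bar>) < \<infinity>"
  have fin': "\<forall>x. ?b x < \<infinity>"
  proof
    fix x show "?b x < \<infinity>" using fin[rule_format, of "\<lambda>i. - x i"] by (simp add: flip)
  qed
  have "E (\<lambda>\<omega>. \<phi>' (vec_append m (\<lambda>i. X i \<omega>) (\<lambda>i. Y i \<omega>)))
      = E (\<lambda>\<omega>. real_of_ereal (?e (\<lambda>i. X i \<omega>)))"
    using ind[unfolded independent_to_def Let_def, THEN conjunct2, THEN conjunct2, rule_format, OF \<phi>']
      fin' h1 h2 h3 by (simp add: flip)
  then show "E (\<lambda>\<omega>. \<phi> (vec_append m (\<lambda>i. - X i \<omega>) (\<lambda>i. - Y i \<omega>)))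
      = E (\<lambda>\<omega>. real_of_ereal (E (\<lambda>\<omega>'. \<phi> (vec_append m (\<lambda>i. - X i \<omega>) (\<lambda>i. - Y i \<omega>')))))"
    by (simp add: flip)
qed

lemma independent_seq_uminus:
  assumes "independent_seq H E X" "\<And>Z. Z \<in> H \<Longrightarrow> (\<lambda>\<omega>. - Z \<omega>) \<in> H"
  shows "independent_seq H E (\<lambda>n \<omega>. - X n \<omega>)"
  using assms(1) independent_to_uminus[OF _ assms(2)] unfolding independent_seq_def by blast

lemma norms_uminus:
  "s_sq E (\<lambda>n \<omega>. - X n \<omega>) = s_sq E X"
  "a_norm E (\<lambda>n \<omega>. - X n \<omega>) = a_norm E X"
  "GL_term E (\<lambda>n \<omega>. - X n \<omega>) = GL_term E X"
proof -
  show s: "s_sq E (\<lambda>n \<omega>. - X n \<omega>) = s_sq E X"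
    by (rule ext) (simp add: s_sq_def)
  have sn: "s_norm E (\<lambda>n \<omega>. - X n \<omega>) = s_norm E X" "t_norm E (\<lambda>n \<omega>. - X n \<omega>) = t_norm E X"
    by (rule ext, simp add: s_norm_def t_norm_def s)+
  show a: "a_norm E (\<lambda>n \<omega>. - X n \<omega>) = a_norm E X"
    by (rule ext) (simp add: a_norm_def sn)
  have "trunc_excess E (\<lambda>n \<omega>. - X n \<omega>) = trunc_excess E X"
    by (intro ext) (simp add: trunc_excess_def sn a)
  then show "GL_term E (\<lambda>n \<omega>. - X n \<omega>) = GL_term E X"
    by (intro ext) (simp add: GL_term_def Gam_def Lam_def a)
qed

text \<open>The expectation of -S is minus the conjugate expectation of S, so reflection exchanges
  the two centrings.\<close>

lemma dev_upper_uminus: "dev_upper E (\<lambda>n \<omega>. - X n \<omega>) m \<omega> = - dev_lower E X m \<omega>"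
proof -
  have S: "S_part (\<lambda>n \<omega>. - X n \<omega>) m = (\<lambda>\<omega>. - S_part X m \<omega>)"
    by (rule ext) (simp add: S_part_def sum_negf)
  show ?thesis
    by (simp add: dev_upper_def dev_lower_def S conj_expectation_def norms_uminus minus_divide_left)
qed

context diverging_sequence
begin

lemma tail_null_deviations:
  assumes C: "property_C M H E V" and cap: "capacity M V" and \<epsilon>: "0 < \<epsilon>"
    and sV: "\<And>\<epsilon>::real. \<epsilon> > 0 \<Longrightarrow>
           summable (\<lambda>n. V {\<omega> \<in> space M. \<bar>X (Suc n) \<omega>\<bar> \<ge> \<epsilon> * a_norm E X (Suc n)})"
    and GL: "\<And>\<alpha>::real. \<alpha> > 0 \<Longrightarrow> \<exists>p\<ge>2. \<exists>d\<ge>0. summable (\<lambda>n. GL_term E X p d \<alpha> (Suc n))"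
  shows "tail_null (sets M) (V_hat M H E)
    (\<lambda>m. {\<omega> \<in> space M. dev_lower E X m \<omega> < - 1 - \<epsilon> \<or> 1 + \<epsilon> < dev_upper E X m \<omega>})"
proof -
  interpret neg: diverging_sequence M H E "\<lambda>n \<omega>. - X n \<omega>"
  proof
    show "1 \<le> n \<Longrightarrow> (\<lambda>\<omega>. - X n \<omega>) \<in> H" for n by (intro uminus_H X_H)
    show "independent_seq H E (\<lambda>n \<omega>. - X n \<omega>)"
      by (rule independent_seq_uminus[OF X_indep uminus_H])
    show "1 \<le> n \<Longrightarrow> E (\<lambda>\<omega>. (- X n \<omega>)\<^sup>2) < \<infinity>" for n using X_square[of n] by simp
    show "filterlim (s_sq E (\<lambda>n \<omega>. - X n \<omega>)) at_top sequentially"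
      unfolding norms_uminus by (rule s_sq_at_top)
  qed
  have up: "tail_null (sets M) (V_hat M H E) (\<lambda>m. {\<omega> \<in> space M. 1 + \<epsilon> < dev_upper E X m \<omega>})"
    by (rule tail_null_dev_upper[OF C cap \<epsilon> sV GL])
  have "tail_null (sets M) (V_hat M H E)
      (\<lambda>m. {\<omega> \<in> space M. 1 + \<epsilon> < dev_upper E (\<lambda>n \<omega>. - X n \<omega>) m \<omega>})"
    by (rule neg.tail_null_dev_upper[OF C cap \<epsilon>]) (simp_all add: norms_uminus sV GL)
  from tail_null_Un[OF this up] show ?thesis
    unfolding dev_upper_uminus
    by (rule tail_null_mono) auto
qed

lemma deviations_measurable:
  "{\<omega> \<in> space M. dev_lower E X m \<omega> < a \<or> b < dev_upper E X m \<omega>} \<in> sets M"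
proof -
  have "S_part X m \<in> borel_measurable M"
    unfolding S_part_def by (intro borel_measurable_sum X_measurable) auto
  then show ?thesis unfolding dev_lower_def dev_upper_def by measurable
qed

end

section \<open>Limits deduced from small tails\<close>

context sublinear_expectation_space
begin

lemma tail_null_SUP_tendsto:
  assumes cap: "capacity M V" and sub: "sub_additive M V" and C: "property_C M H E V"
    and D: "\<And>m. D m \<in> sets M" and tn: "tail_null (sets M) (V_hat M H E) D"
  shows "(\<lambda>n. SUP N\<in>{n..}. V (\<Union>m\<in>{n..N}. D m)) \<longlonglongrightarrow> 0"
proof (rule LIMSEQ_I)
  fix e :: real assume "0 < e"
  then have "0 < e / 2" by simp
  then obtain B r n where *: "\<forall>j. B j \<in> sets M" "\<forall>j. V_hat M H E (B j) \<le> ereal (r j)" "\<forall>j. 0 \<le> r j"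
    "summable r" "suminf r \<le> e / 2" "\<forall>m\<ge>n. \<exists>J::nat. D m \<subseteq> (\<Union>j<J. B j)"
    by (rule tail_nullE[OF tn])
  have U: "(\<Union>m\<in>{k..N}. D m) \<in> sets M" for k N using D by auto
  have bd: "0 \<le> V (\<Union>m\<in>{k..N}. D m)" "V (\<Union>m\<in>{k..N}. D m) \<le> 1" for k N
    using cap U[of k N] unfolding capacity_def by auto
  have VB: "V (B j) \<le> r j" for j
    using order_trans[OF capacity_le_V_hat[OF C *(1)[rule_format]] *(2)[rule_format]] by simp
  have le: "V (\<Union>m\<in>{k..N}. D m) \<le> e / 2" if k: "n \<le> k" for k N
  proof -
    have "\<forall>m\<in>{k..N}. \<exists>J::nat. D m \<subseteq> (\<Union>j<J. B j)" using *(6) k by auto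
    then obtain J :: "nat \<Rightarrow> nat" where J: "\<forall>m\<in>{k..N}. D m \<subseteq> (\<Union>j<J m. B j)"
      by (rule bchoice[THEN exE])
    \<comment> \<open>The finite covers of the D m have different lengths; the sum of the lengths
      serves as a common bound.\<close>
    define L where "L = Suc (\<Sum>m\<in>{k..N}. J m)"
    have "D m \<subseteq> (\<Union>j<L. B j)" if m: "m \<in> {k..N}" for m
    proof -
      have "J m \<le> (\<Sum>m\<in>{k..N}. J m)" using m by (intro member_le_sum) auto
      then have "{..<J m} \<subseteq> {..<L}" by (auto simp: L_def)
      then have "(\<Union>j<J m. B j) \<subseteq> (\<Union>j<L. B j)" by (intro UN_mono) auto
      then show ?thesis using J m by blast
    qed
    then have "(\<Union>m\<in>{k..N}. D m) \<subseteq> (\<Union>j<L. B j)" by (rule UN_least)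
    moreover have "(\<Union>j<L. B j) \<in> sets M" using *(1) by auto
    ultimately have "V (\<Union>m\<in>{k..N}. D m) \<le> V (\<Union>j<L. B j)"
      using cap U[of k N] unfolding capacity_def by blast
    also have "\<dots> \<le> (\<Sum>j<L. V (B j))" using *(1) by (intro capacity_UN_le[OF sub cap]) auto
    also have "\<dots> \<le> (\<Sum>j<L. r j)" by (intro sum_mono VB)
    also have "\<dots> \<le> suminf r" using *(3,4) by (intro sum_le_suminf) auto
    also have "\<dots> \<le> e / 2" by (rule *(5))
    finally show ?thesis .
  qed
  show "\<exists>n0. \<forall>n\<ge>n0. norm ((SUP N\<in>{n..}. V (\<Union>m\<in>{n..N}. D m)) - 0) < e"
  proof (intro exI[of _ n] allI impI)
    fix k assume k: "n \<le> k"
    have "(SUP N\<in>{k..}. V (\<Union>m\<in>{k..N}. D m)) \<le> e / 2"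
      by (rule cSUP_least) (use le[OF k] in auto)
    moreover have "0 \<le> (SUP N\<in>{k..}. V (\<Union>m\<in>{k..N}. D m))"
    proof (rule cSUP_upper2[of _ _ k])
      \<comment> \<open>The supremum is taken in the reals, hence the appeal to V \<le> 1.\<close>
      show "bdd_above ((\<lambda>N. V (\<Union>m\<in>{k..N}. D m)) ` {k..})"
        using bd(2) by (intro bdd_aboveI2[of _ _ 1])
    qed (use bd(1)[of k k] in simp_all)
    ultimately show "norm ((SUP N\<in>{k..}. V (\<Union>m\<in>{k..N}. D m)) - 0) < e"
      using \<open>0 < e\<close> by simp
  qed
qed

lemma tail_null_UN_tendsto:
  assumes cap: "capacity M V" and sub: "countably_sub_additive M V" and C: "property_C M H E V"
    and D: "\<And>m. D m \<in> sets M" and tn: "tail_null (sets M) (V_hat M H E) D"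
  shows "(\<lambda>n. V (\<Union>m\<in>{n..}. D m)) \<longlonglongrightarrow> 0"
proof (rule LIMSEQ_I)
  fix e :: real assume "0 < e"
  then have "0 < e / 2" by simp
  then obtain B r n where *: "\<forall>j. B j \<in> sets M" "\<forall>j. V_hat M H E (B j) \<le> ereal (r j)" "\<forall>j. 0 \<le> r j"
    "summable r" "suminf r \<le> e / 2" "\<forall>m\<ge>n. \<exists>J::nat. D m \<subseteq> (\<Union>j<J. B j)"
    by (rule tail_nullE[OF tn])
  have U: "(\<Union>m\<in>{k..}. D m) \<in> sets M" for k using D by auto
  have V0: "0 \<le> V A" if "A \<in> sets M" for A using cap that unfolding capacity_def by blast
  have VB: "V (B j) \<le> r j" for j
    using order_trans[OF capacity_le_V_hat[OF C *(1)[rule_format]] *(2)[rule_format]] by simp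
  have "ereal (V (\<Union>j. B j)) \<le> (\<Sum>j. ereal (V (B j)))"
    using sub[unfolded countably_sub_additive_def, rule_format, of B] *(1) by auto
  also have "\<dots> \<le> (\<Sum>j. ereal (r j))" using VB V0 *(1) by (intro suminf_le_pos) auto
  also have "\<dots> = ereal (suminf r)" using *(4) by (rule suminf_ereal')
  finally have VU: "V (\<Union>j. B j) \<le> e / 2" using *(5) by simp
  have le: "V (\<Union>m\<in>{k..}. D m) \<le> e / 2" if k: "n \<le> k" for k
  proof -
    have "D m \<subseteq> (\<Union>j. B j)" if m: "m \<in> {k..}" for m
    proof -
      have "n \<le> m" using m k by simp
      then obtain J where "D m \<subseteq> (\<Union>j<J. B j)" using *(6) by blast
      then show ?thesis by blast
    qed
    then have "(\<Union>m\<in>{k..}. D m) \<subseteq> (\<Union>j. B j)" by (rule UN_least)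
    moreover have "(\<Union>j. B j) \<in> sets M" using *(1) by auto
    ultimately have "V (\<Union>m\<in>{k..}. D m) \<le> V (\<Union>j. B j)"
      using cap U[of k] unfolding capacity_def by blast
    with VU show ?thesis by simp
  qed
  show "\<exists>n0. \<forall>n\<ge>n0. norm (V (\<Union>m\<in>{n..}. D m) - 0) < e"
  proof (intro exI[of _ n] allI impI)
    fix k assume "n \<le> k"
    from le[OF this] V0[OF U[of k]] \<open>0 < e\<close> show "norm (V (\<Union>m\<in>{k..}. D m) - 0) < e" by simp
  qed
qed

text \<open>A finite set of pairs lies in a finite rectangle, whose sum is at most that of finitely
  many complete rows.\<close>

lemma sum_prod_decode_le:
  fixes r :: "nat \<Rightarrow> nat \<Rightarrow> real"
  assumes "\<And>j k. 0 \<le> r j k" "\<And>j. summable (r j)" "\<And>j. suminf (r j) \<le> c j"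
    and "summable c" "suminf c \<le> e"
  shows "(\<Sum>i<n. case_prod r (prod_decode i)) \<le> e"
proof -
  define P where "P = prod_decode ` {..<n}"
  have fin: "finite P" by (simp add: P_def)
  have c0: "0 \<le> c j" for j using suminf_nonneg[OF assms(2)[of j] assms(1)] assms(3)[of j] by linarith
  have "(\<Sum>i<n. case_prod r (prod_decode i)) = (\<Sum>x\<in>P. case_prod r x)"
    unfolding P_def by (subst sum.reindex) (auto simp: inj_on_def)
  also have "\<dots> \<le> (\<Sum>x\<in>fst ` P \<times> snd ` P. case_prod r x)"
  proof (rule sum_mono2)
    show "P \<subseteq> fst ` P \<times> snd ` P" by force
  qed (use fin assms(1) in auto)
  also have "\<dots> = (\<Sum>j\<in>fst ` P. \<Sum>k\<in>snd ` P. r j k)" by (simp add: sum.cartesian_product)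
  also have "\<dots> \<le> (\<Sum>j\<in>fst ` P. c j)"
  proof (rule sum_mono)
    fix j
    have "(\<Sum>k\<in>snd ` P. r j k) \<le> suminf (r j)" using fin assms(1,2) by (intro sum_le_suminf) auto
    then show "(\<Sum>k\<in>snd ` P. r j k) \<le> c j" using assms(3)[of j] by linarith
  qed
  also have "\<dots> \<le> suminf c" using fin assms(4) c0 by (intro sum_le_suminf) auto
  finally show ?thesis using assms(5) by linarith
qed

text \<open>The j-th family receives the share e / 2^(j+1), and all covers together, enumerated by
  pairs, form one countable cover of A. A point of A lies in D j m for arbitrarily late m, hence for
  some m past the index from which the j-th cover is valid.\<close>

lemma V_hat_star_limsup_eq_0:
  fixes D :: "nat \<Rightarrow> nat \<Rightarrow> 'a set"
  assumes tn: "\<And>j. tail_null (sets M) (V_hat M H E) (D j)"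
    and A: "\<And>\<omega>. \<omega> \<in> A \<Longrightarrow> \<exists>j. \<forall>n. \<exists>m\<ge>n. \<omega> \<in> D j m"
  shows "V_hat_star M H E A = 0"
proof (rule antisym)
  show "0 \<le> V_hat_star M H E A"
    unfolding V_hat_star_def by (rule Inf_greatest) (auto intro!: suminf_0_le V_hat_nonneg)
  show "V_hat_star M H E A \<le> 0"
  proof (rule ereal_le_epsilon2)
    fix e :: real assume e: "0 < e"
    \<comment> \<open>Sets, majorants and starting index are packed into one triple, so that one
      application of choice over j suffices.\<close>
    have "\<forall>j. \<exists>x. (\<forall>k. fst x k \<in> sets M) \<and> (\<forall>k. V_hat M H E (fst x k) \<le> ereal (fst (snd x) k)) \<and>
        (\<forall>k. 0 \<le> fst (snd x) k) \<and> summable (fst (snd x)) \<and> suminf (fst (snd x)) \<le> e * (1/2) ^ Suc j \<and>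
        (\<forall>m\<ge>snd (snd x). \<exists>J::nat. D j m \<subseteq> (\<Union>k<J. fst x k))"
    proof
      fix j
      have "0 < e * (1/2) ^ Suc j" using e by simp
      then obtain B r n where "\<forall>k. B k \<in> sets M" "\<forall>k. V_hat M H E (B k) \<le> ereal (r k)" "\<forall>k. 0 \<le> r k"
        "summable r" "suminf r \<le> e * (1/2) ^ Suc j" "\<forall>m\<ge>n. \<exists>J::nat. D j m \<subseteq> (\<Union>k<J. B k)"
        by (rule tail_nullE[OF tn[of j]])
      then show "\<exists>x. (\<forall>k. fst x k \<in> sets M) \<and> (\<forall>k. V_hat M H E (fst x k) \<le> ereal (fst (snd x) k)) \<and>
        (\<forall>k. 0 \<le> fst (snd x) k) \<and> summable (fst (snd x)) \<and> suminf (fst (snd x)) \<le> e * (1/2) ^ Suc j \<and>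
        (\<forall>m\<ge>snd (snd x). \<exists>J::nat. D j m \<subseteq> (\<Union>k<J. fst x k))"
        by (intro exI[of _ "(B, r, n)"] conjI) (unfold fst_conv snd_conv, assumption+)
    qed
    from choice[OF this] obtain x where x: "\<forall>j. (\<forall>k. fst (x j) k \<in> sets M) \<and>
        (\<forall>k. V_hat M H E (fst (x j) k) \<le> ereal (fst (snd (x j)) k)) \<and>
        (\<forall>k. 0 \<le> fst (snd (x j)) k) \<and> summable (fst (snd (x j))) \<and>
        suminf (fst (snd (x j))) \<le> e * (1/2) ^ Suc j \<and>
        (\<forall>m\<ge>snd (snd (x j)). \<exists>J::nat. D j m \<subseteq> (\<Union>k<J. fst (x j) k))"
      by (elim exE)
    define B r n where "B j = fst (x j)" and "r j = fst (snd (x j))" and "n j = snd (snd (x j))" for j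
    have B: "B j k \<in> sets M" "V_hat M H E (B j k) \<le> ereal (r j k)" "0 \<le> r j k" "summable (r j)"
      "suminf (r j) \<le> e * (1/2) ^ Suc j" for j k
      using x unfolding B_def r_def by simp_all
    have cov: "\<exists>J::nat. D j m \<subseteq> (\<Union>k<J. B j k)" if "n j \<le> m" for j m
      using x that unfolding B_def n_def by simp
    define B' where "B' i = case_prod B (prod_decode i)" for i
    have B'sets: "B' i \<in> sets M" for i unfolding B'_def using B(1) by (simp split: prod.split)
    have "A \<subseteq> (\<Union>i. B' i)"
    proof
      fix \<omega> assume "\<omega> \<in> A"
      then obtain j where j: "\<forall>n. \<exists>m\<ge>n. \<omega> \<in> D j m" using A by blast
      then obtain m where m: "n j \<le> m" "\<omega> \<in> D j m" by blast
      obtain k where "\<omega> \<in> B j k" using cov[OF m(1)] m(2) by blast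
      then have "\<omega> \<in> B' (prod_encode (j, k))" by (simp add: B'_def)
      then show "\<omega> \<in> (\<Union>i. B' i)" by blast
    qed
    then have "V_hat_star M H E A \<le> (\<Sum>i. V_hat M H E (B' i))"
      unfolding V_hat_star_def using B'sets by (intro Inf_lower) auto
    also have "\<dots> \<le> ereal e"
    proof (rule suminf_bound)
      show "0 \<le> V_hat M H E (B' i)" for i by (rule V_hat_nonneg)
      have half: "(\<lambda>j. e * (1/2) ^ Suc j) sums (e * 1)" by (intro sums_mult power_half_series)
      show "\<forall>N. (\<Sum>i<N. V_hat M H E (B' i)) \<le> ereal e"
      proof
        fix N
        have "(\<Sum>i<N. V_hat M H E (B' i)) \<le> (\<Sum>i<N. ereal (case_prod r (prod_decode i)))"
          unfolding B'_def using B(2) by (intro sum_mono) (simp split: prod.split)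
        also have "\<dots> = ereal (\<Sum>i<N. case_prod r (prod_decode i))" by simp
        also have "\<dots> \<le> ereal e"
          using sum_prod_decode_le[OF B(3) B(4) B(5) sums_summable[OF half], of e N] sums_unique[OF half]
          by simp
        finally show "(\<Sum>i<N. V_hat M H E (B' i)) \<le> ereal e" .
      qed
    qed
    finally show "V_hat_star M H E A \<le> 0 + ereal e" by simp
  qed
qed

end

lemma ereal_gap:
  fixes z :: ereal and a :: real
  assumes "z < ereal a"
  obtains j :: nat where "z < ereal (a - inverse (Suc j))"
proof -
  obtain c where c: "z < ereal c" "ereal c < ereal a" using ereal_dense2[OF assms] by blast
  then obtain j where "inverse (Suc j) < a - c" using reals_Archimedean[of "a - c"] by auto
  then have "ereal c < ereal (a - inverse (Suc j))" by simp
  with c(1) have "z < ereal (a - inverse (Suc j))" by (rule less_trans)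
  then show thesis by (rule that)
qed

text \<open>The margins 1/(j+1) tend to 0, so a strict inequality for the limit leaves room for one
  of them; this reduces all \<epsilon> > 0 to a countable family.\<close>

lemma frequently_of_liminf_or_limsup:
  fixes u v :: "nat \<Rightarrow> real"
  assumes "liminf (\<lambda>n. ereal (u n)) < - 1 \<or> limsup (\<lambda>n. ereal (v n)) > 1"
  shows "\<exists>j::nat. \<forall>n. \<exists>m\<ge>n. u m < - 1 - inverse (Suc j) \<or> 1 + inverse (Suc j) < v m"
proof (rule ccontr)
  assume "\<not> ?thesis"
  then have "\<forall>j::nat. \<exists>n. \<forall>m\<ge>n. - 1 - inverse (Suc j) \<le> u m \<and> v m \<le> 1 + inverse (Suc j)"
    by (simp add: not_less)
  then have ev: "eventually (\<lambda>m. - 1 - inverse (Suc j) \<le> u m \<and> v m \<le> 1 + inverse (Suc j)) sequentially"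
    for j :: nat by (simp add: eventually_sequentially)
  have lo: "ereal (- 1 - inverse (Suc j)) \<le> liminf (\<lambda>n. ereal (u n))" for j :: nat
    using ev[of j] by (intro Liminf_bounded) (auto elim: eventually_mono)
  have hi: "limsup (\<lambda>n. ereal (v n)) \<le> ereal (1 + inverse (Suc j))" for j :: nat
    using ev[of j] by (intro Limsup_bounded) (auto elim: eventually_mono)
  have "- 1 \<le> liminf (\<lambda>n. ereal (u n))"
  proof (rule ccontr)
    assume "\<not> - 1 \<le> liminf (\<lambda>n. ereal (u n))"
    then have "liminf (\<lambda>n. ereal (u n)) < ereal (- 1)" by (simp add: one_ereal_def)
    then obtain j :: nat where "liminf (\<lambda>n. ereal (u n)) < ereal (- 1 - inverse (Suc j))"
      by (rule ereal_gap)
    with lo[of j] show False using leD by blast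
  qed
  moreover have "limsup (\<lambda>n. ereal (v n)) \<le> 1"
  proof (rule ereal_le_epsilon2)
    fix e :: real assume "0 < e"
    then obtain j where "inverse (real (Suc j)) < e" using reals_Archimedean by blast
    then have "ereal (1 + inverse (Suc j)) \<le> 1 + ereal e" by (simp add: one_ereal_def)
    with hi[of j] show "limsup (\<lambda>n. ereal (v n)) \<le> 1 + ereal e" by (rule order_trans)
  qed
  ultimately show False using assms by auto
qed

theorem theorem5p1:
  fixes M :: "'a measure" and H :: "('a \<Rightarrow> real) set" and E :: "('a \<Rightarrow> real) \<Rightarrow> ereal"
    and V :: "'a set \<Rightarrow> real" and X :: "nat \<Rightarrow> 'a \<Rightarrow> real"
  assumes "sublinear_expectation_space M H E"
    and "capacity M V" and "sub_additive M V" and "property_C M H E V"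
    and "\<And>n. n \<ge> 1 \<Longrightarrow> X n \<in> H"
    and "independent_seq H E X"
    and "\<And>n. n \<ge> 1 \<Longrightarrow> E (\<lambda>\<omega>. (X n \<omega>)\<^sup>2) < \<infinity>"
    and "filterlim (s_sq E X) at_top sequentially"
    and "\<And>\<epsilon>::real. \<epsilon> > 0 \<Longrightarrow>
           summable (\<lambda>n. V {\<omega> \<in> space M. \<bar>X (Suc n) \<omega>\<bar> \<ge> \<epsilon> * a_norm E X (Suc n)})"
    and "\<And>\<alpha>::real. \<alpha> > 0 \<Longrightarrow>
           \<exists>p\<ge>2. \<exists>d\<ge>0. summable (\<lambda>n. GL_term E X p d \<alpha> (Suc n))"
  shows "(\<forall>\<epsilon>>0. (\<lambda>n. SUP N\<in>{n..}. V {\<omega> \<in> space M.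
              (INF m\<in>{n..N}. ereal (dev_lower E X m \<omega>)) < ereal (- 1 - \<epsilon>) \<or>
              (SUP m\<in>{n..N}. ereal (dev_upper E X m \<omega>)) > ereal (1 + \<epsilon>)}) \<longlonglongrightarrow> 0)
       \<and> (countably_sub_additive M V \<longrightarrow>
           (\<forall>\<epsilon>>0. (\<lambda>n. V {\<omega> \<in> space M.
              (INF m\<in>{n..}. ereal (dev_lower E X m \<omega>)) < ereal (- 1 - \<epsilon>) \<or>
              (SUP m\<in>{n..}. ereal (dev_upper E X m \<omega>)) > ereal (1 + \<epsilon>)}) \<longlonglongrightarrow> 0))
       \<and> V_hat_star M H E {\<omega> \<in> space M.
              liminf (\<lambda>n. ereal (dev_lower E X n \<omega>)) < - 1 \<or>
              limsup (\<lambda>n. ereal (dev_upper E X n \<omega>)) > 1} = 0"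
proof -
  interpret sublinear_expectation_space M H E by (rule assms(1))
  interpret diverging_sequence M H E X
    by unfold_locales (fact assms(5-8))+
  define D where "D \<epsilon> m = {\<omega> \<in> space M. dev_lower E X m \<omega> < - 1 - \<epsilon> \<or> 1 + \<epsilon> < dev_upper E X m \<omega>}" for \<epsilon> m
  have tn: "tail_null (sets M) (V_hat M H E) (D \<epsilon>)" if "0 < \<epsilon>" for \<epsilon>
    unfolding D_def by (rule tail_null_deviations[OF assms(4,2) that assms(9,10)])
  have D: "D \<epsilon> m \<in> sets M" for \<epsilon> m
    unfolding D_def by (rule deviations_measurable)
  \<comment> \<open>The inequalities are strict, so an infimum or supremum satisfies one of them
    exactly if a single term does. Thus each event is a union of the D over its index range, be it
    finite or infinite.\<close>
  have U: "{\<omega> \<in> space M. (INF m\<in>I. ereal (dev_lower E X m \<omega>)) < ereal (- 1 - \<epsilon>) \<or>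
      (SUP m\<in>I. ereal (dev_upper E X m \<omega>)) > ereal (1 + \<epsilon>)} = (\<Union>m\<in>I. D \<epsilon> m)" for \<epsilon> I
    unfolding INF_less_iff less_SUP_iff D_def by auto
  show ?thesis
    unfolding U
  proof (intro conjI allI impI)
    show "(\<lambda>n. SUP N\<in>{n..}. V (\<Union>m\<in>{n..N}. D \<epsilon> m)) \<longlonglongrightarrow> 0" if "0 < \<epsilon>" for \<epsilon>
      by (rule tail_null_SUP_tendsto[OF assms(2,3,4) D tn[OF that]])
    show "(\<lambda>n. V (\<Union>m\<in>{n..}. D \<epsilon> m)) \<longlonglongrightarrow> 0" if "countably_sub_additive M V" "0 < \<epsilon>" for \<epsilon>
      by (rule tail_null_UN_tendsto[OF assms(2) that(1) assms(4) D tn[OF that(2)]])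
    show "V_hat_star M H E {\<omega> \<in> space M. liminf (\<lambda>n. ereal (dev_lower E X n \<omega>)) < - 1 \<or>
        limsup (\<lambda>n. ereal (dev_upper E X n \<omega>)) > 1} = 0"
    proof (rule V_hat_star_limsup_eq_0)
      show "tail_null (sets M) (V_hat M H E) (D (inverse (Suc j)))" for j :: nat
        by (rule tn) simp
      fix \<omega>
      assume "\<omega> \<in> {\<omega> \<in> space M. liminf (\<lambda>n. ereal (dev_lower E X n \<omega>)) < - 1 \<or>
        limsup (\<lambda>n. ereal (dev_upper E X n \<omega>)) > 1}"
      then have \<omega>: "\<omega> \<in> space M" "liminf (\<lambda>n. ereal (dev_lower E X n \<omega>)) < - 1 \<or>
        limsup (\<lambda>n. ereal (dev_upper E X n \<omega>)) > 1" by auto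
      from frequently_of_liminf_or_limsup[OF \<omega>(2)] \<omega>(1)
      show "\<exists>j. \<forall>n. \<exists>m\<ge>n. \<omega> \<in> D (inverse (Suc j)) m" unfolding D_def by simp
    qed
  qed
qed

end
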